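(* Let $n\in\mathbb{N}$, let $G=\mathbb{R}\oplus\mathbb{R}^n\oplus\mathbb{R}^n$ be the path group with its left-invariant sub-Riemannian structure, and consider the arc-length parametrized geodesics from the identity determined by the parameters $\theta=(\alpha,\rho,\sigma,k,k^\perp)$, where $\alpha\in S^1$, $\rho>0$, $\sigma\ge 0$ and $k,k^\perp\in\mathbb{R}^n$ are orthonormal, as described in the context. The cut time of the geodesic with parameters $\theta$ is $$t_{cut}(\theta)=\frac{2\pi}{\rho}\sqrt{1+\sigma^2}.$$ For $\sigma=0$, the time $t_{cut}(\theta)$ is also the first conjugate time. For $\sigma>0$, $t_{cut}(\theta)$ coincides with the first conjugate time if and only if $\alpha=0$ or $\alpha=\pi$.
   Context: The path group is $G=\mathbb{R}\oplus\mathbb{R}^n\oplus\mathbb{R}^n$ with coordinates $(x,\ell,y)$, $x\in\mathbb{R}$, $\ell,y\in\mathbb{R}^n$, and group law $(x,\ell,y)\cdot(\tilde x,\tilde\ell,\tilde y)=(x+\tilde x,\ \ell+\tilde\ell,\ y+\tilde y+\tfrac12(\ell\tilde x-x\tilde\ell))$. Its left-invariant sub-Riemannian structure $(G,\Delta,g)$ has distribution $\Delta$ spanned by the left-invariant fields $X_0=\partial_x+\sum_{i=1}^n\frac{\ell_i}{2}\partial_{y_i}$, $X_i=\partial_{\ell_i}-\frac{x}{2}\partial_{y_i}$ ($i=1,\dots,n$), and $g$ makes $X_0,\dots,X_n$ orthonormal; put $Y_i=[X_i,X_0]=\partial_{y_i}$. Geodesics (non-trivial horizontal curves of constant speed, locally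 minimizing length) are projections of integral curves $\lambda(t)$ of the Hamiltonian field on $T^*G$ of $H(\lambda)=\frac12\sum_{a=0}^n\langle\lambda,X_a\rangle^2$; arc-length parametrized ones have $\lambda(0)\in\Lambda_0=T_0^*G\cap H^{-1}(1/2)$. The exponential map is $\exp(t,\lambda_0)=\gamma(t)$, where $\gamma$ is the projection of the extremal with $\lambda(0)=\lambda_0\in\Lambda_0$; it is also regarded as a map $T_0^*G\to G$, $t\lambda_0\mapsto\exp(t,\lambda_0)$. Parametrization: $\theta=(\alpha,\rho,\sigma,k,k^\perp)$ corresponds to the covector $\lambda_0\in\Lambda_0$ with $\langle\lambda_0,X_0\rangle=\frac{\sin\alpha}{\sqrt{1+\sigma^2}}$, $\langle\lambda_0,X_i\rangle=\frac{k_i\cos\alpha+\sigma k_i^\perp}{\sqrt{1+\sigma^2}}$, $\langle\lambda_0,Y_i\rangle=\frac{\rho k_i}{\sqrt{1+\sigma^2}}$. When $\sigma=0$ the vector $k^\perp$ plays no role (for $n=1$ only $\sigma=0$ occurs). With $\tau=\rho t/\sqrt{1+\sigma^2}$ the geodesic is $$x(t)=\tfrac1\rho(\cos\alpha-\cos(\tau+\alpha)),\qquad \ell(t)=\tfrac1\rho\big[(\sin(\tau+\alpha)-\sin\alpha)\,k+\sigma\tau\,k^\perp\big],$$ $$y(t)=\tfrac1{\rho^2}\Big[\tfrac12(\tau-\sin\tau)\,k+\sigma\big(\sin(\tau+\alpha)-\sin\alpha-\tfrac\tau2(\cos(\tau+\alpha)+\cos\alpha)\big)\,k^\perp\Big].$$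 The cut time of a geodesic $\gamma$ is $\sup\{t>0:\gamma|_{[0,t]}\text{ is globally length-minimizing}\}$. The first conjugate time of $\gamma(t)=\exp(t\lambda_0)$ is $\inf\{t>0: t\lambda_0\text{ is a critical point of }\exp\}$. *)

theory Defs
  imports "HOL-Analysis.Analysis"
begin

text \<open>Points are written (x, l, y). The cotangent space at each point is identified with the
  same coordinate space via the Euclidean inner product, i.e. through the coordinates dual
  to (x, l, y), so the pairing of a covector p with a tangent vector v is the inner product of
  p and v.\<close>

type_synonym 'n path_group = "real \<times> (real^'n) \<times> (real^'n)"

definition pg_mult :: "'n::finite path_group \<Rightarrow> 'n path_group \<Rightarrow> 'n path_group" where
  "pg_mult = (\<lambda>(x, l, y) (x', l', y').
     (x + x', l + l', y + y' + (1/2) *\<^sub>R (x' *\<^sub>R l - x *\<^sub>R l')))"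

definition X0 :: "'n::finite path_group \<Rightarrow> 'n path_group" where
  "X0 = (\<lambda>(x, l, y). (1, 0, \<Sum>i\<in>UNIV. (l $ i / 2) *\<^sub>R axis i 1))"

definition X :: "'n \<Rightarrow> 'n::finite path_group \<Rightarrow> 'n path_group" where
  "X i = (\<lambda>(x, l, y). (0, axis i 1, - (x / 2) *\<^sub>R axis i 1))"

definition Y :: "'n \<Rightarrow> 'n::finite path_group \<Rightarrow> 'n path_group" where
  "Y i = (\<lambda>(x, l, y). (0, 0, axis i 1))"

lemma pg_mult_zero: "pg_mult 0 q = q" "pg_mult q 0 = q"
  by (cases q; simp add: pg_mult_def zero_prod_def)+

lemma pg_mult_assoc: "pg_mult (pg_mult p q) r = pg_mult p (pg_mult q r)"
  by (cases p; cases q; cases r; simp add: pg_mult_def algebra_simps add_divide_distrib)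

lemma X0_left_invariant:
  "((\<lambda>s. pg_mult q (s *\<^sub>R X0 0)) has_vector_derivative X0 q) (at 0)"
proof (cases q)
  case (fields x l y)
  have "(\<Sum>i\<in>UNIV. (l $ i / 2) *\<^sub>R axis i 1) = (1/2) *\<^sub>R l"
    by (simp add: vec_eq_iff axis_def if_distrib cong: if_cong)
  then show ?thesis
    unfolding fields pg_mult_def X0_def zero_prod_def
    by (auto intro!: derivative_eq_intros simp: has_vector_derivative_def algebra_simps
        cong: if_cong)
qed

lemma X_left_invariant:
  "((\<lambda>s. pg_mult q (s *\<^sub>R X i 0)) has_vector_derivative X i q) (at 0)"
proof (cases q)
  case (fields x l y)
  show ?thesis
    unfolding fields pg_mult_def X_def zero_prod_def
    by (auto intro!: derivative_eq_intros simp: has_vector_derivative_def algebra_simps)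
qed

text \<open>The fields X0, X i are orthonormal for the sub-Riemannian metric, so a horizontal vector
  is given by its coordinates u in this frame and its sub-Riemannian length is the Euclidean
  norm of u.\<close>

definition hor :: "'n::finite path_group \<Rightarrow> real \<times> (real^'n) \<Rightarrow> 'n path_group" where
  "hor q = (\<lambda>(u\<^sub>0, u). u\<^sub>0 *\<^sub>R X0 q + (\<Sum>i\<in>UNIV. (u $ i) *\<^sub>R X i q))"

text \<open>Absolutely continuous curves on [a, b] with velocity hor (g t) (u t) for almost all t,
  where u is Lebesgue integrable, written as the equivalent integral equation.\<close>

definition horizontal_on ::
  "real \<Rightarrow> real \<Rightarrow> (real \<Rightarrow> 'n::finite path_group) \<Rightarrow> (real \<Rightarrow> real \<times> (real^'n)) \<Rightarrow> bool" where
  "horizontal_on a b g u \<longleftrightarrow>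
     u absolutely_integrable_on {a..b} \<and>
     (\<forall>t\<in>{a..b}. ((\<lambda>s. hor (g s) (u s)) has_integral (g t - g a)) {a..t})"

definition sr_length :: "real \<Rightarrow> real \<Rightarrow> (real \<Rightarrow> real \<times> (real^'n::finite)) \<Rightarrow> real" where
  "sr_length a b u = integral {a..b} (\<lambda>s. norm (u s))"

definition length_minimizing_on :: "real \<Rightarrow> real \<Rightarrow> (real \<Rightarrow> 'n::finite path_group) \<Rightarrow> bool" where
  "length_minimizing_on a b g \<longleftrightarrow>
     (\<exists>u. horizontal_on a b g u \<and>
        (\<forall>c d h v. c \<le> d \<longrightarrow> horizontal_on c d h v \<longrightarrow> h c = g a \<longrightarrow> h d = g b \<longrightarrow>
           sr_length a b u \<le> sr_length c d v))"

text \<open>Extended reals, so that the supremum and the infimum below are meaningful for unbounded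
  and for empty sets of times.\<close>

definition cut_time :: "(real \<Rightarrow> 'n::finite path_group) \<Rightarrow> ereal" where
  "cut_time g = Sup {ereal t | t. t > 0 \<and> length_minimizing_on 0 t g}"

definition Ham :: "'n::finite path_group \<Rightarrow> 'n path_group \<Rightarrow> real" where
  "Ham q p = ((p \<bullet> X0 q)\<^sup>2 + (\<Sum>i\<in>UNIV. (p \<bullet> X i q)\<^sup>2)) / 2"

text \<open>Hamilton's equations in canonical coordinates: q' = dH/dp and p' = - dH/dq.\<close>

definition extremal :: "(real \<Rightarrow> 'n::finite path_group \<times> 'n path_group) \<Rightarrow> bool" where
  "extremal z \<longleftrightarrow> (\<forall>t. \<exists>Hq Hp.
     gderiv (\<lambda>q. Ham q (snd (z t))) (fst (z t)) Hq \<and>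
     gderiv (\<lambda>p. Ham (fst (z t)) p) (snd (z t)) Hp \<and>
     (z has_vector_derivative (Hp, - Hq)) (at t))"

text \<open>The identity of the group is 0. The extremal with given initial covector is unique and
  defined for all times.\<close>

definition sr_geodesic :: "'n::finite path_group \<Rightarrow> real \<Rightarrow> 'n path_group" where
  "sr_geodesic p t = fst ((THE z. extremal z \<and> z 0 = (0, p)) t)"

text \<open>By homogeneity of the Hamiltonian, sr_exp (t p) = sr_geodesic p t.\<close>

definition sr_exp :: "'n::finite path_group \<Rightarrow> 'n path_group" where
  "sr_exp p = sr_geodesic p 1"

definition critical_point :: "('a::euclidean_space \<Rightarrow> 'b::euclidean_space) \<Rightarrow> 'a \<Rightarrow> bool" where
  "critical_point f p \<longleftrightarrow> (\<exists>f'. (f has_derivative f') (at p) \<and> \<not> surj f')"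

definition first_conjugate_time :: "'n::finite path_group \<Rightarrow> ereal" where
  "first_conjugate_time p = Inf {ereal t | t. t > 0 \<and> critical_point sr_exp (t *\<^sub>R p)}"

definition covector :: "real \<Rightarrow> real \<Rightarrow> real \<Rightarrow> real^'n \<Rightarrow> real^'n \<Rightarrow> 'n::finite path_group" where
  "covector \<alpha> \<rho> \<sigma> k k' =
     (1 / sqrt (1 + \<sigma>\<^sup>2)) *\<^sub>R (sin \<alpha>, cos \<alpha> *\<^sub>R k + \<sigma> *\<^sub>R k', \<rho> *\<^sub>R k)"

lemma covector_pairing:
  "covector \<alpha> \<rho> \<sigma> k k' \<bullet> X0 0 = sin \<alpha> / sqrt (1 + \<sigma>\<^sup>2)"
  "covector \<alpha> \<rho> \<sigma> k k' \<bullet> X i 0 = (k $ i * cos \<alpha> + \<sigma> * k' $ i) / sqrt (1 + \<sigma>\<^sup>2)"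
  "covector \<alpha> \<rho> \<sigma> k k' \<bullet> Y i 0 = \<rho> * k $ i / sqrt (1 + \<sigma>\<^sup>2)"
  by (simp_all add: covector_def X0_def X_def Y_def zero_prod_def inner_axis algebra_simps add_divide_distrib)

lemma covector_arc_length:
  assumes "norm k = 1" and "\<sigma> > 0 \<Longrightarrow> norm k' = 1 \<and> k \<bullet> k' = 0" and "\<sigma> \<ge> 0"
  shows "Ham 0 (covector \<alpha> \<rho> \<sigma> k k') = 1 / 2"
proof -
  let ?v = "cos \<alpha> *\<^sub>R k + \<sigma> *\<^sub>R k'"
  have pos: "1 + \<sigma>\<^sup>2 > 0"
    by (simp add: add_pos_nonneg)
  have "k \<bullet> k = 1" and "\<sigma> \<noteq> 0 \<Longrightarrow> k' \<bullet> k' = 1" and "\<sigma> \<noteq> 0 \<Longrightarrow> k \<bullet> k' = 0"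
    using assms by (auto simp: norm_eq_1)
  then have v: "?v \<bullet> ?v = (cos \<alpha>)\<^sup>2 + \<sigma>\<^sup>2"
    by (cases "\<sigma> = 0") (simp_all add: inner_add inner_commute[of k' k] power2_eq_square)
  have "(\<Sum>i\<in>UNIV. (k $ i * cos \<alpha> + \<sigma> * k' $ i)\<^sup>2) = ?v \<bullet> ?v"
    by (simp add: inner_vec_def power2_eq_square mult.commute)
  then show ?thesis
    using pos v sin_cos_squared_add[of \<alpha>] unfolding Ham_def covector_pairing power_divide
    by (simp add: sum_divide_distrib[symmetric] add_divide_distrib[symmetric] field_simps)
qed

end

theory Submission
  imports Defs
begin

text \<open>Put $z = xl/2 - y$; horizontal curves satisfy $z' = x l'$, and along an extremal
  $w = p_y$ is constant, $x'' = c - |w|^2 x$ and $l' = u - x w$.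

  \<^bold>\<open>Minimality up to the period\<close> $2\pi/|w|$. There the projection of the geodesic to the plane
  $(l\cdot w, x)$ closes up to a full circle. The isoperimetric inequality in this plane and
  Minkowski's inequality in the direction of $u^\perp$ bound every competitor from below.

  \<^bold>\<open>No minimality after the period.\<close> Replace $x$ by $x + \varepsilon\sin(2\pi t/T)$ and $l'$ by the
  affine function of the new $x$ that restores the end point. For a suitable, possibly large,
  $\varepsilon$ this lowers the energy. If $x$ is not orthogonal to the sine, the choice that
  preserves the variance of $x$ is the reflected geodesic; otherwise a small $\varepsilon$ will do.

  \<^bold>\<open>Conjugate points.\<close> A kernel vector of the differential of the exponential map gives a Jacobi
  field $\eta$ with $\eta(0)=\eta(1)=0$ and
  $\int\eta'^2 = r^2 (\int\eta^2 - (\int\eta)^2) - V |dw|^2$, where $V$ is the variance of $x$ and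
  $r = |w|$. Wirtinger's inequality, which is the isoperimetric inequality for the curve
  $(\eta, 2\pi\int(\eta - \bar\eta))$, excludes this for $r < 2\pi$. For $r = 2\pi$ it leaves only
  $\eta$ proportional to the sine, which is in the kernel only if $\sigma\sin\alpha = 0$.\<close>

section \<open>The isoperimetric and the Wirtinger inequality\<close>

text \<open>If \<open>\<sigma> * sin \<alpha>\<close> is not zero, the end of the period is not
  conjugate. Minimality is lost there because the geodesics with angles \<alpha> and -\<alpha> meet:
  after a full period the end point depends on the angle only through its cosine. Jacobi fields do
  not see this, so the cut time and the conjugate times need separate arguments, and the variation
  used after the period must be allowed to be large.

  Competitors are integrals of merely integrable controls, and \<open>length_minimizing_on\<close>
  asks for some control of the curve, which is determined only up to null sets. Both the
  isoperimetric inequality and the bound for the length of an arbitrary control of the geodesic are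
  therefore drawn from increments whose errors are quadratic and disappear under refinement.

  \<open>first_conjugate_time\<close> is an infimum. That the differential is injective at the
  period does not by itself prevent conjugate times from accumulating there from above; a
  compactness argument provides the gap.\<close>

lemma quadratic_decrease_imp_le:
  fixes f s :: "real \<Rightarrow> real"
  assumes "a \<le> b" and cont: "continuous_on {a..b} s" and sab: "s a \<le> s b"
    and incr: "\<And>t t'. a \<le> t \<Longrightarrow> t \<le> t' \<Longrightarrow> t' \<le> b \<Longrightarrow> f t - f t' \<le> C * (s t' - s t)\<^sup>2"
  shows "f a \<le> f b"
proof -
  define L where "L = s b - s a"
  have L0: "L \<ge> 0" using sab by (simp add: L_def)
  \<comment> \<open>The cuts are placed at \<open>N\<close> equally spaced levels of
    \<open>s\<close>, which the intermediate value theorem supplies; equal steps of \<open>t\<close>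
    would not control the increments of \<open>s\<close>. Each piece loses at most
    \<open>C * (L / N)\<^sup>2\<close>, so all of them together lose at most
    \<open>C * L\<^sup>2 / N\<close>.\<close>
  have bound: "f a - f b \<le> (C * L\<^sup>2) / real N" if N: "N > 0" for N :: nat
  proof -
    have "i \<le> N \<Longrightarrow> \<exists>t\<in>{a..b}. s t = s a + i * (L / N) \<and> f a - f t \<le> i * (C * (L / N)\<^sup>2)" for i :: nat
    proof (induction i)
      case 0
      then show ?case using \<open>a \<le> b\<close> by (intro bexI[of _ a]) auto
    next
      case (Suc i)
      then obtain t where t: "t \<in> {a..b}" "s t = s a + i * (L / N)" "f a - f t \<le> i * (C * (L / N)\<^sup>2)"
        by auto
      let ?y = "s a + Suc i * (L / N)"
      have "Suc i * (L / N) \<le> N * (L / N)"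
        using Suc.prems L0 by (intro mult_right_mono) auto
      then have "?y \<le> s b" using N by (simp add: L_def)
      moreover have "s t \<le> ?y" using t L0 by (auto simp: mult_right_mono divide_right_mono)
      moreover have "continuous_on {t..b} s" using t by (intro continuous_on_subset[OF cont]) auto
      ultimately obtain t' where t': "t \<le> t'" "t' \<le> b" "s t' = ?y"
        using IVT'[of s t ?y b] t by auto
      have "f t - f t' \<le> C * (s t' - s t)\<^sup>2" using incr[of t t'] t t' by auto
      also have "s t' - s t = L / N" using t t' by (simp add: distrib_right add_divide_distrib)
      finally have "f a - f t' \<le> Suc i * (C * (L / N)\<^sup>2)"
        using t(3) by (simp add: algebra_simps)
      then show ?case using t t' by (intro bexI[of _ t']) auto
    qed
    from this[of N] obtain t where t: "t \<in> {a..b}" "s t = s a + N * (L / N)" "f a - f t \<le> N * (C * (L / N)\<^sup>2)"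
      by auto
    \<comment> \<open>The last cut has the level of \<open>b\<close> but need not be
      \<open>b\<close>; as \<open>s\<close> has no increment between the two, nothing is lost
      there.\<close>
    have "s t = s b" using t(2) N by (simp add: L_def)
    then have "f t - f b \<le> 0" using incr[of t b] t(1) by auto
    then have "f a - f b \<le> N * (C * (L / N)\<^sup>2)" using t(3) by simp
    then show ?thesis using N by (simp add: power2_eq_square field_simps)
  qed
  have "(\<lambda>N. (C * L\<^sup>2) / real N) \<longlonglongrightarrow> 0"
    by (rule lim_const_over_n)
  then have "f a - f b \<le> 0"
    by (rule LIMSEQ_le_const) (use bound in \<open>auto intro!: exI[of _ 1]\<close>)
  then show ?thesis by simp
qed

lemma absolutely_integrable_bilinear_continuous:
  fixes h :: "'a::euclidean_space \<Rightarrow> 'b::euclidean_space \<Rightarrow> 'c::euclidean_space" and f :: "real \<Rightarrow> 'a"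
  assumes "bilinear h" "continuous_on {a..b} f" "g absolutely_integrable_on {a..b}"
  shows "(\<lambda>t. h (f t) (g t)) absolutely_integrable_on {a..b}"
proof (rule absolutely_integrable_bounded_measurable_product[where h=h])
  show "f \<in> borel_measurable (lebesgue_on {a..b})"
    using assms(2) by (intro continuous_imp_measurable_on_sets_lebesgue) auto
  show "bounded (f ` {a..b})"
    using assms(2) by (intro compact_imp_bounded compact_continuous_image) auto
qed (use assms in auto)

lemma integral_interval_diff:
  fixes f :: "real \<Rightarrow> 'a::banach"
  assumes "f integrable_on {a..b}" "a \<le> t" "t \<le> t'" "t' \<le> b"
  shows "integral {a..t'} f - integral {a..t} f = integral {t..t'} f"
proof -
  have "f integrable_on {a..t'}" using assms by (intro integrable_subinterval_real[OF assms(1)]) auto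
  from Henstock_Kurzweil_Integration.integral_combine[OF assms(2,3) this] show ?thesis by (metis add_diff_cancel_left')
qed

lemma norm_integral_le:
  fixes f :: "real \<Rightarrow> 'a::euclidean_space"
  assumes "f absolutely_integrable_on {a..b}"
  shows "norm (integral {a..b} f) \<le> integral {a..b} (\<lambda>t. norm (f t))"
  using assms by (intro Henstock_Kurzweil_Integration.integral_norm_bound_integral) 
     (auto simp: absolutely_integrable_on_def)

text \<open>\<open>Im (cnj z * w)\<close> is the cross product of plane vectors, so \<open>q\<close>
  is twice the signed area swept from the origin. Over a short piece it is twice the area of the
  triangle 0, \<open>\<gamma> t\<close>, \<open>\<gamma> t'\<close>, up to the square of the arc
  length.\<close>

lemma primitive_product_increment:
  fixes v :: "real \<Rightarrow> complex"
  assumes v: "v absolutely_integrable_on {a..b}" and t: "a \<le> t" "t \<le> t'" "t' \<le> b"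
  defines "\<gamma> \<equiv> \<lambda>t. integral {a..t} v" and "s \<equiv> \<lambda>t. integral {a..t} (\<lambda>\<tau>. norm (v \<tau>))"
  defines "q \<equiv> \<lambda>t. integral {a..t} (\<lambda>\<tau>. Im (cnj (\<gamma> \<tau>) * v \<tau>))"
  shows "norm (\<gamma> t' - \<gamma> t) \<le> s t' - s t"
    and "\<bar>q t' - q t - Im (cnj (\<gamma> t) * (\<gamma> t' - \<gamma> t))\<bar> \<le> (s t' - s t)\<^sup>2"
proof -
  have vi: "v integrable_on {a..b}" and ni: "(\<lambda>t. norm (v t)) integrable_on {a..b}"
    using v by (auto simp: absolutely_integrable_on_def)
  have vs: "v absolutely_integrable_on {t..t'}" if "a \<le> t" "t \<le> t'" "t' \<le> b" for t t'
    using that by (intro absolutely_integrable_on_subinterval[OF v]) auto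
  have d: "norm (\<gamma> t' - \<gamma> t) \<le> s t' - s t" if "a \<le> t" "t \<le> t'" "t' \<le> b" for t t'
    unfolding \<gamma>_def s_def using that by (simp add: integral_interval_diff[OF vi] integral_interval_diff[OF ni] norm_integral_le vs)
  show "norm (\<gamma> t' - \<gamma> t) \<le> s t' - s t" using d t by blast
  have smono: "s t1 \<le> s t2" if "a \<le> t1" "t1 \<le> t2" "t2 \<le> b" for t1 t2
    using d[OF that] norm_ge_zero order_trans by (metis diff_ge_0_iff_ge)
  have gc: "continuous_on {a..b} \<gamma>" unfolding \<gamma>_def by (rule indefinite_integral_continuous_1[OF vi])
  have bil: "bilinear (\<lambda>x y. Im (cnj x * y))"
    by (auto simp: bilinear_def linear_iff algebra_simps)
  have qi: "(\<lambda>\<tau>. Im (cnj (\<gamma> \<tau>) * v \<tau>)) absolutely_integrable_on {a..b}"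
    by (rule absolutely_integrable_bilinear_continuous[OF bil gc v])
  have c: "(\<lambda>\<tau>. Im (cnj (\<gamma> \<tau> - \<gamma> t) * v \<tau>)) absolutely_integrable_on {t..t'}"
    using t by (intro absolutely_integrable_bilinear_continuous[OF bil _ vs] continuous_intros continuous_on_subset[OF gc]) auto
  \<comment> \<open>Freezing the base point at \<open>\<gamma> t\<close> isolates the error: the
    remaining factor \<open>\<gamma> \<tau> - \<gamma> t\<close> is at most the arc length of the
    piece.\<close>
  have e: "q t' - q t - Im (cnj (\<gamma> t) * (\<gamma> t' - \<gamma> t)) = integral {t..t'} (\<lambda>\<tau>. Im (cnj (\<gamma> \<tau> - \<gamma> t) * v \<tau>))"
  proof -
    have 1: "q t' - q t = integral {t..t'} (\<lambda>\<tau>. Im (cnj (\<gamma> \<tau>) * v \<tau>))"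
      unfolding q_def using integral_interval_diff[OF set_lebesgue_integral_eq_integral(1)[OF qi] t] .
    have "((\<lambda>\<tau>. Im (cnj (\<gamma> t) * v \<tau>)) has_integral Im (cnj (\<gamma> t) * integral {t..t'} v)) {t..t'}"
      by (intro has_integral_Im has_integral_mult_right integrable_integral)
         (use vs[OF t] in \<open>auto simp: absolutely_integrable_on_def\<close>)
    moreover have "integral {t..t'} v = \<gamma> t' - \<gamma> t"
      unfolding \<gamma>_def using integral_interval_diff[OF vi t] by simp
    ultimately have 2: "((\<lambda>\<tau>. Im (cnj (\<gamma> t) * v \<tau>)) has_integral Im (cnj (\<gamma> t) * (\<gamma> t' - \<gamma> t))) {t..t'}" by simp
    have 3: "(\<lambda>\<tau>. Im (cnj (\<gamma> \<tau>) * v \<tau>)) integrable_on {t..t'}"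
      using set_lebesgue_integral_eq_integral(1)[OF qi] t by (rule_tac integrable_subinterval_real) auto
    have "integral {t..t'} (\<lambda>\<tau>. Im (cnj (\<gamma> \<tau> - \<gamma> t) * v \<tau>)) =
       integral {t..t'} (\<lambda>\<tau>. Im (cnj (\<gamma> \<tau>) * v \<tau>) - Im (cnj (\<gamma> t) * v \<tau>))"
      by (simp add: algebra_simps)
    also have "\<dots> = q t' - q t - Im (cnj (\<gamma> t) * (\<gamma> t' - \<gamma> t))"
      using Henstock_Kurzweil_Integration.integral_diff[OF 3 has_integral_integrable[OF 2]] 1 integral_unique[OF 2] by simp
    finally show ?thesis by simp
  qed
  have "norm (integral {t..t'} (\<lambda>\<tau>. Im (cnj (\<gamma> \<tau> - \<gamma> t) * v \<tau>))) \<le> integral {t..t'} (\<lambda>\<tau>. (s t' - s t) * norm (v \<tau>))"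
  proof (rule Henstock_Kurzweil_Integration.integral_norm_bound_integral)
    fix \<tau> assume "\<tau> \<in> {t..t'}"
    then have "norm (\<gamma> \<tau> - \<gamma> t) \<le> s t' - s t"
      using d[of t \<tau>] smono[of \<tau> t'] t by auto
    then have "norm (cnj (\<gamma> \<tau> - \<gamma> t) * v \<tau>) \<le> (s t' - s t) * norm (v \<tau>)"
      unfolding norm_mult complex_mod_cnj by (rule mult_right_mono) simp
    then show "norm (Im (cnj (\<gamma> \<tau> - \<gamma> t) * v \<tau>)) \<le> (s t' - s t) * norm (v \<tau>)"
      using abs_Im_le_cmod order_trans by (metis real_norm_def)
  qed (use c vs[OF t] in \<open>auto simp: absolutely_integrable_on_def intro!: integrable_on_mult_right\<close>)
  also have "\<dots> = (s t' - s t)\<^sup>2"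
    unfolding s_def using t by (simp add: integral_interval_diff[OF ni] power2_eq_square)
  finally show "\<bar>q t' - q t - Im (cnj (\<gamma> t) * (\<gamma> t' - \<gamma> t))\<bar> \<le> (s t' - s t)\<^sup>2"
    using e by simp
qed

text \<open>\<open>h\<close> solves the Riccati equation
  \<open>h' = - \<beta>\<^sup>2 - h\<^sup>2\<close>; these are the bounds of its increments with
  explicit constants. The offset \<open>\<epsilon>\<close> keeps the angle between
  \<open>\<epsilon>\<close> and \<open>pi - \<epsilon>\<close>, away from both poles of the
  cotangent, where the sine is at least \<open>sin \<epsilon>\<close>.\<close>

lemma cot_increment:
  fixes \<beta> \<epsilon> :: real
  assumes "\<beta> > 0" "\<epsilon> > 0" and st: "0 \<le> s" "s \<le> s'" "\<beta> * s' + 2 * \<epsilon> \<le> pi"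
  defines "h \<equiv> \<lambda>s. \<beta> * cot (\<beta> * s + \<epsilon>)"
  shows "sin (\<beta> * s + \<epsilon>) > 0"
    "\<bar>h s\<bar> \<le> \<beta> / sin \<epsilon>" "\<bar>h s'\<bar> \<le> \<beta> / sin \<epsilon>"
    "\<bar>h s' - h s\<bar> \<le> \<beta>\<^sup>2 / (sin \<epsilon>)\<^sup>2 * (s' - s)"
    "h s' - h s \<le> - (\<beta>\<^sup>2 / (sin (\<beta> * s + \<epsilon>))\<^sup>2) * (s' - s) + 2 * \<beta>^3 / (sin \<epsilon>)^4 * (s' - s)\<^sup>2"
proof -
  have "\<beta> * s' \<ge> 0" using assms by auto
  then have e2: "\<epsilon> \<le> pi / 2" using st by simp
  have m: "sin \<epsilon> > 0" using e2 assms by (intro sin_gt_zero) auto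
  have low: "sin \<epsilon> \<le> sin \<phi>" if "\<epsilon> \<le> \<phi>" "\<phi> \<le> pi - \<epsilon>" for \<phi>
  proof (cases "\<phi> \<le> pi / 2")
    case True
    then show ?thesis using that assms by (subst sin_mono_le_eq) auto
  next
    case False
    then have "sin \<epsilon> \<le> sin (pi - \<phi>)" using that assms by (subst sin_mono_le_eq) auto
    then show ?thesis by simp
  qed
  have rng: "\<epsilon> \<le> \<beta> * \<xi> + \<epsilon>" "\<beta> * \<xi> + \<epsilon> \<le> pi - \<epsilon>" if "0 \<le> \<xi>" "\<xi> \<le> s'" for \<xi>
  proof -
    have "\<beta> * \<xi> \<le> \<beta> * s'" "0 \<le> \<beta> * \<xi>" using that assms by auto
    then show "\<epsilon> \<le> \<beta> * \<xi> + \<epsilon>" "\<beta> * \<xi> + \<epsilon> \<le> pi - \<epsilon>" using st by auto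
  qed
  have sl: "sin \<epsilon> \<le> sin (\<beta> * \<xi> + \<epsilon>)" if "0 \<le> \<xi>" "\<xi> \<le> s'" for \<xi>
    using low rng that by blast
  show sp: "sin (\<beta> * s + \<epsilon>) > 0" using sl[of s] m st by auto
  have hb: "\<bar>h \<xi>\<bar> \<le> \<beta> / sin \<epsilon>" if "0 \<le> \<xi>" "\<xi> \<le> s'" for \<xi>
  proof -
    have "\<bar>h \<xi>\<bar> = \<beta> * \<bar>cos (\<beta> * \<xi> + \<epsilon>)\<bar> / sin (\<beta> * \<xi> + \<epsilon>)"
      using sl[OF that] m assms(1) by (simp add: h_def cot_def abs_mult)
    also have "\<dots> \<le> \<beta> * 1 / sin \<epsilon>"
      using sl[OF that] m assms(1) by (intro frac_le mult_left_mono) auto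
    finally show ?thesis by simp
  qed
  show "\<bar>h s\<bar> \<le> \<beta> / sin \<epsilon>" "\<bar>h s'\<bar> \<le> \<beta> / sin \<epsilon>" using hb st by auto
  have der: "(h has_real_derivative - (\<beta>\<^sup>2 / (sin (\<beta> * \<xi> + \<epsilon>))\<^sup>2)) (at \<xi>)" if "0 \<le> \<xi>" "\<xi> \<le> s'" for \<xi>
    unfolding h_def using sl[OF that] m
    by (auto intro!: derivative_eq_intros DERIV_chain2[OF DERIV_cot] simp: power2_eq_square field_simps)
  have "\<exists>\<xi>. s \<le> \<xi> \<and> \<xi> \<le> s' \<and> h s' - h s = - (\<beta>\<^sup>2 / (sin (\<beta> * \<xi> + \<epsilon>))\<^sup>2) * (s' - s)"
  proof (cases "s = s'")
    case False
    then have "s < s'" using st by simp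
    from MVT2[OF this, of h "\<lambda>\<xi>. - (\<beta>\<^sup>2 / (sin (\<beta> * \<xi> + \<epsilon>))\<^sup>2)"] der st obtain z where 
      "s < z" "z < s'" "h s' - h s = (s' - s) * - (\<beta>\<^sup>2 / (sin (\<beta> * z + \<epsilon>))\<^sup>2)" by auto
    then show ?thesis by (intro exI[of _ z]) auto
  qed auto
  then obtain \<xi> where xi: "s \<le> \<xi>" "\<xi> \<le> s'" "h s' - h s = - (\<beta>\<^sup>2 / (sin (\<beta> * \<xi> + \<epsilon>))\<^sup>2) * (s' - s)" by auto
  have sxi: "sin \<epsilon> \<le> sin (\<beta> * \<xi> + \<epsilon>)" "sin \<epsilon> \<le> sin (\<beta> * s + \<epsilon>)" using sl xi st by auto
  have "\<bar>h s' - h s\<bar> = \<beta>\<^sup>2 / (sin (\<beta> * \<xi> + \<epsilon>))\<^sup>2 * (s' - s)"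
    using xi st by (simp add: abs_mult)
  also have "\<dots> \<le> \<beta>\<^sup>2 / (sin \<epsilon>)\<^sup>2 * (s' - s)"
    using sxi m st by (intro mult_right_mono divide_left_mono power_mono) (auto intro!: mult_pos_pos)
  finally show "\<bar>h s' - h s\<bar> \<le> \<beta>\<^sup>2 / (sin \<epsilon>)\<^sup>2 * (s' - s)" .
  \<comment> \<open>The mean value theorem gives the derivative at an unknown \<open>\<xi>\<close>.
    Moving it to \<open>s\<close> costs one more factor \<open>s' - s\<close>, which is the source
    of the quadratic remainder.\<close>
  let ?A = "sin (\<beta> * s + \<epsilon>)" and ?B = "sin (\<beta> * \<xi> + \<epsilon>)"
  have AB: "?A > 0" "?B > 0" using sxi m by auto
  have lip: "\<bar>?A - ?B\<bar> \<le> \<beta> * (s' - s)"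
  proof -
    have sin_lip: "\<bar>sin y - sin z\<bar> \<le> \<bar>y - z\<bar>" for y z :: real
    proof -
      have "\<bar>sin y - sin z\<bar> = 2 * (\<bar>sin ((y - z) / 2)\<bar> * \<bar>cos ((y + z) / 2)\<bar>)"
        by (simp add: sin_diff_sin abs_mult)
      also have "\<dots> \<le> 2 * (\<bar>(y - z) / 2\<bar> * 1)"
        by (intro mult_left_mono mult_mono abs_sin_x_le_abs_x) auto
      finally show ?thesis by simp
    qed
    have "\<bar>?A - ?B\<bar> \<le> \<bar>(\<beta> * s + \<epsilon>) - (\<beta> * \<xi> + \<epsilon>)\<bar>" by (rule sin_lip)
    also have "\<dots> = \<beta> * (\<xi> - s)" using xi assms by (simp add: abs_if algebra_simps mult_less_cancel_left)
    also have "\<dots> \<le> \<beta> * (s' - s)" using xi assms by auto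
    finally show ?thesis .
  qed
  have "1 / ?A\<^sup>2 - 1 / ?B\<^sup>2 = (?B - ?A) * (?B + ?A) / (?A\<^sup>2 * ?B\<^sup>2)"
    using AB by (simp add: field_simps power2_eq_square)
  also have "\<dots> \<le> (\<beta> * (s' - s)) * 2 / ((sin \<epsilon>)\<^sup>2 * (sin \<epsilon>)\<^sup>2)"
  proof (rule frac_le)
    have "(?B - ?A) * (?B + ?A) \<le> \<bar>?A - ?B\<bar> * (?B + ?A)" using AB by (intro mult_right_mono) auto
    also have "\<dots> \<le> (\<beta> * (s' - s)) * 2"
    proof (rule mult_mono)
      have "?A \<le> 1" "?B \<le> 1" by auto
      then show "?B + ?A \<le> 2" by linarith
    qed (use lip assms AB in auto)
    finally show "(?B - ?A) * (?B + ?A) \<le> (\<beta> * (s' - s)) * 2" .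
    show "(sin \<epsilon>)\<^sup>2 * (sin \<epsilon>)\<^sup>2 \<le> ?A\<^sup>2 * ?B\<^sup>2" using sxi m by (intro mult_mono power_mono) auto
  qed (use m assms in auto)
  finally have "\<beta>\<^sup>2 * (s' - s) * (1 / ?A\<^sup>2 - 1 / ?B\<^sup>2) \<le> \<beta>\<^sup>2 * (s' - s) * ((\<beta> * (s' - s)) * 2 / ((sin \<epsilon>)\<^sup>2 * (sin \<epsilon>)\<^sup>2))"
    using st by (intro mult_left_mono) auto
  then show "h s' - h s \<le> - (\<beta>\<^sup>2 / ?A\<^sup>2) * (s' - s) + 2 * \<beta>^3 / (sin \<epsilon>)^4 * (s' - s)\<^sup>2"
    unfolding xi(3) by (simp add: algebra_simps power_numeral_reduce)
qed

text \<open>The function $s - 2\beta q - \beta\cot(\beta s + \varepsilon)|\gamma|^2$ is nondecreasing along every curve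
  $\gamma$, where $s$ is its arc length and $q/2$ the area that it sweeps. The increments are estimated
  directly, because the derivative of an integrable control need not exist.\<close>

lemma isoperimetric_aux:
  fixes v :: "real \<Rightarrow> complex"
  assumes "a \<le> b" and v: "v absolutely_integrable_on {a..b}" and closed: "integral {a..b} v = 0"
    and "\<beta> > 0" and "\<beta> * integral {a..b} (\<lambda>t. norm (v t)) < pi"
  shows "2 * \<beta> * integral {a..b} (\<lambda>t. Im (cnj (integral {a..t} v) * v t)) \<le> integral {a..b} (\<lambda>t. norm (v t))"
proof -
  define \<gamma> where "\<gamma> = (\<lambda>t. integral {a..t} v)"
  define s where "s = (\<lambda>t. integral {a..t} (\<lambda>\<tau>. norm (v \<tau>)))"
  define q where "q = (\<lambda>t. integral {a..t} (\<lambda>\<tau>. Im (cnj (\<gamma> \<tau>) * v \<tau>)))"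
  define L where "L = s b"
  \<comment> \<open>With this offset the angle \<open>\<beta> * s + \<epsilon>\<close> runs from
    \<open>\<epsilon>\<close> to \<open>pi - \<epsilon>\<close> along the curve.\<close>
  define \<epsilon> where "\<epsilon> = (pi - \<beta> * L) / 2"
  have \<epsilon>: "\<epsilon> > 0" "\<beta> * L + 2 * \<epsilon> \<le> pi" 
  proof -
    have "2 * \<epsilon> = pi - \<beta> * L" unfolding \<epsilon>_def by (simp only: times_divide_eq_right nonzero_mult_div_cancel_left zero_neq_numeral not_False_eq_True simp_thms)
    moreover have "\<beta> * L < pi" using assms by (simp add: L_def s_def)
    ultimately show "\<epsilon> > 0" "\<beta> * L + 2 * \<epsilon> \<le> pi" by linarith+
  qed
  define h where "h = (\<lambda>s. \<beta> * cot (\<beta> * s + \<epsilon>))"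
  have inc: "norm (\<gamma> t' - \<gamma> t) \<le> s t' - s t"
    "\<bar>q t' - q t - Im (cnj (\<gamma> t) * (\<gamma> t' - \<gamma> t))\<bar> \<le> (s t' - s t)\<^sup>2"
    if "a \<le> t" "t \<le> t'" "t' \<le> b" for t t'
    unfolding q_def s_def \<gamma>_def by (fact primitive_product_increment[OF v that])+
  have smono: "s t \<le> s t'" if "a \<le> t" "t \<le> t'" "t' \<le> b" for t t'
    using inc(1)[OF that] norm_ge_zero order_trans by (metis diff_ge_0_iff_ge)
  have a0: "\<gamma> a = 0" "s a = 0" "q a = 0" by (simp_all add: \<gamma>_def s_def q_def)
  define C where "C = 2 * \<beta> + (2 * \<beta>^3 / (sin \<epsilon>)^4) * L\<^sup>2 + 2 * (\<beta>\<^sup>2 / (sin \<epsilon>)\<^sup>2) * L + \<beta> / sin \<epsilon>"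
  define f where "f = (\<lambda>t. s t - 2 * \<beta> * q t - h (s t) * (norm (\<gamma> t))\<^sup>2)"
  have "f a \<le> f b"
  proof (rule quadratic_decrease_imp_le[where f=f and s=s and C=C and a=a and b=b])
    show "continuous_on {a..b} s"
      unfolding s_def using v by (intro indefinite_integral_continuous_1) (auto simp: absolutely_integrable_on_def)
    show "a \<le> b" "s a \<le> s b" using smono assms by auto
    fix t t' assume t: "a \<le> t" "t \<le> t'" "t' \<le> b"
    define \<delta> where "\<delta> = s t' - s t"
    define d where "d = \<gamma> t' - \<gamma> t"
    define G where "G = \<gamma> t"
    define R where "R = Re (cnj G * d)"
    define J where "J = Im (cnj G * d)"
    define S where "S = sin (\<beta> * s t + \<epsilon>)"
    define K where "K = 2 * \<beta>^3 / (sin \<epsilon>)^4"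
    define K1 where "K1 = \<beta>\<^sup>2 / (sin \<epsilon>)\<^sup>2"
    define K2 where "K2 = \<beta> / sin \<epsilon>"
    have d: "norm d \<le> \<delta>" using inc(1)[OF t] by (simp add: d_def \<delta>_def)
    have \<delta>0: "\<delta> \<ge> 0" using d norm_ge_zero order_trans by blast
    have q: "q t' - q t - J \<le> \<delta>\<^sup>2" "- \<delta>\<^sup>2 \<le> q t' - q t - J" using inc(2)[OF t] by (auto simp: \<delta>_def J_def G_def d_def)
    have sL: "0 \<le> s t" "s t \<le> s t'" "s t' \<le> L" using smono[of a t] smono[of t t'] smono[of t' b] t a0 by (auto simp: L_def)
    then have L0: "L \<ge> 0" by linarith
    have GL: "norm G \<le> L" using inc(1)[of a t] t a0 sL by (auto simp: G_def)
    have "\<beta> * s t' + 2 * \<epsilon> \<le> pi" using \<epsilon> sL assms by (smt (verit) mult_left_mono)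
    note c = cot_increment[OF \<open>\<beta> > 0\<close> \<epsilon>(1) sL(1,2) this]
    have cot: "S > 0" "\<bar>h (s t)\<bar> \<le> K2" "\<bar>h (s t')\<bar> \<le> K2" "\<bar>h (s t') - h (s t)\<bar> \<le> K1 * \<delta>"
      "h (s t') - h (s t) \<le> - (\<beta>\<^sup>2 / S\<^sup>2) * \<delta> + K * \<delta>\<^sup>2"
      unfolding h_def \<delta>_def S_def K_def K1_def K2_def by (fact c)+
    have K: "K \<ge> 0" "K1 \<ge> 0" "K2 \<ge> 0"
    proof -
      show "K2 \<ge> 0" using cot(2) by linarith
      then have "sin \<epsilon> \<ge> 0" using assms by (simp add: K2_def zero_le_divide_iff)
      then show "K \<ge> 0" "K1 \<ge> 0" using assms by (auto simp: K_def K1_def)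
    qed
    have RG: "\<bar>R\<bar> \<le> L * \<delta>"
    proof -
      have "\<bar>R\<bar> \<le> norm (cnj G * d)" unfolding R_def by (rule abs_Re_le_cmod)
      also have "\<dots> \<le> L * \<delta>" unfolding norm_mult complex_mod_cnj using GL d by (intro mult_mono) (use L0 in auto)
      finally show ?thesis .
    qed
    have nG: "(norm (\<gamma> t'))\<^sup>2 = (norm G)\<^sup>2 + 2 * R + (norm d)\<^sup>2"
    proof -
      have "\<gamma> t' = G + d" by (simp add: G_def d_def)
      then show ?thesis unfolding R_def cmod_power2 by (simp add: power2_eq_square algebra_simps)
    qed
    \<comment> \<open>The first-order part of the monotonicity of \<open>f\<close>. Up to the factor
      \<open>2 * \<beta> / S\<close> the left side is one component of the rotated number
      \<open>cnj G * d\<close>, hence at most \<open>norm G * \<delta>\<close>; then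
      \<open>2 * y \<le> 1 + y\<^sup>2\<close> produces exactly the term that the decrease of the
      cotangent compensates.\<close>
    have main: "2 * \<beta> * J + 2 * h (s t) * R \<le> \<delta> + \<beta>\<^sup>2 / S\<^sup>2 * \<delta> * (norm G)\<^sup>2"
    proof -
      let ?c = "cos (\<beta> * s t + \<epsilon>)"
      have "S * J + ?c * R = Re (Complex ?c (- S) * (cnj G * d))"
        by (simp add: R_def J_def)
      also have "\<dots> \<le> norm (Complex ?c (- S) * (cnj G * d))" by (rule complex_Re_le_cmod)
      also have "\<dots> = norm G * norm d"
      proof -
        have "norm (Complex ?c (- S)) = 1" by (simp add: S_def cmod_def)
        then show ?thesis by (simp only: norm_mult complex_mod_cnj mult_1)
      qed
      also have "\<dots> \<le> norm G * \<delta>" using d by (intro mult_left_mono) auto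
      finally have *: "S * J + ?c * R \<le> norm G * \<delta>" .
      have "2 * \<beta> * J + 2 * h (s t) * R = (2 * \<beta> / S) * (S * J + ?c * R)"
        using cot(1) by (simp add: h_def cot_def S_def field_simps)
      also have "\<dots> \<le> (2 * \<beta> / S) * (norm G * \<delta>)" using * cot(1) assms by (intro mult_left_mono) auto
      also have "\<dots> = \<delta> * (2 * (\<beta> / S * norm G))" by simp
      also have "\<dots> \<le> \<delta> * (1 + (\<beta> / S * norm G)\<^sup>2)"
        using \<delta>0 sum_squares_bound[of 1 "\<beta> / S * norm G"] by (intro mult_left_mono) (auto simp: power2_eq_square)
      finally show ?thesis by (simp add: algebra_simps power_mult_distrib power_divide)
    qed
    have "f t - f t' = - \<delta> + 2 * \<beta> * (q t' - q t) + h (s t') * ((norm G)\<^sup>2 + 2 * R + (norm d)\<^sup>2) - h (s t) * (norm G)\<^sup>2"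
      unfolding f_def nG by (simp add: \<delta>_def G_def algebra_simps)
    also have "\<dots> = - \<delta> + 2 * \<beta> * (q t' - q t - J) + (2 * \<beta> * J + 2 * h (s t) * R) + (h (s t') - h (s t)) * (norm G)\<^sup>2
        + 2 * ((h (s t') - h (s t)) * R) + h (s t') * (norm d)\<^sup>2"
      by (simp add: algebra_simps)
    also have "\<dots> \<le> - \<delta> + 2 * \<beta> * \<delta>\<^sup>2 + (\<delta> + \<beta>\<^sup>2 / S\<^sup>2 * \<delta> * (norm G)\<^sup>2)
        + (- (\<beta>\<^sup>2 / S\<^sup>2) * \<delta> * (norm G)\<^sup>2 + K * \<delta>\<^sup>2 * L\<^sup>2) + 2 * (K1 * \<delta> * (L * \<delta>)) + K2 * \<delta>\<^sup>2"
    proof (rule add_mono[OF add_mono[OF add_mono[OF add_mono[OF add_mono[OF order_refl] main]]]])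
      show "2 * \<beta> * (q t' - q t - J) \<le> 2 * \<beta> * \<delta>\<^sup>2" using q assms by auto
      have "(h (s t') - h (s t)) * (norm G)\<^sup>2 \<le> (- (\<beta>\<^sup>2 / S\<^sup>2) * \<delta> + K * \<delta>\<^sup>2) * (norm G)\<^sup>2"
        using cot(5) by (intro mult_right_mono) auto
      also have "\<dots> \<le> - (\<beta>\<^sup>2 / S\<^sup>2) * \<delta> * (norm G)\<^sup>2 + K * \<delta>\<^sup>2 * L\<^sup>2"
      proof -
        have "K * \<delta>\<^sup>2 * (norm G)\<^sup>2 \<le> K * \<delta>\<^sup>2 * L\<^sup>2"
          using K GL by (intro mult_left_mono power_mono) auto
        then show ?thesis unfolding distrib_right by linarith
      qed
      finally show "(h (s t') - h (s t)) * (norm G)\<^sup>2 \<le> - (\<beta>\<^sup>2 / S\<^sup>2) * \<delta> * (norm G)\<^sup>2 + K * \<delta>\<^sup>2 * L\<^sup>2" .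
      have "(h (s t') - h (s t)) * R \<le> \<bar>h (s t') - h (s t)\<bar> * \<bar>R\<bar>" by (metis abs_ge_self abs_mult)
      also have "\<dots> \<le> K1 * \<delta> * (L * \<delta>)" using cot(4) RG K \<delta>0 by (intro mult_mono) auto
      finally show "2 * ((h (s t') - h (s t)) * R) \<le> 2 * (K1 * \<delta> * (L * \<delta>))" by simp
      have "h (s t') * (norm d)\<^sup>2 \<le> K2 * (norm d)\<^sup>2" using cot(3) by (intro mult_right_mono) auto
      also have "\<dots> \<le> K2 * \<delta>\<^sup>2" using K d by (intro mult_left_mono power_mono) auto
      finally show "h (s t') * (norm d)\<^sup>2 \<le> K2 * \<delta>\<^sup>2" .
    qed
    also have "\<dots> = C * \<delta>\<^sup>2" by (simp add: C_def K_def K1_def K2_def algebra_simps power2_eq_square)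
    finally show "f t - f t' \<le> C * (s t' - s t)\<^sup>2" by (simp add: \<delta>_def)
  qed
  \<comment> \<open>Since \<open>\<gamma>\<close> vanishes at both ends, the cotangent term drops
    out of \<open>f a \<le> f b\<close>.\<close>
  moreover have "\<gamma> b = 0" using closed by (simp add: \<gamma>_def)
  ultimately show ?thesis using a0 by (simp add: f_def q_def s_def \<gamma>_def)
qed

text \<open>The auxiliary inequality holds for every positive \<open>\<beta>\<close> with
  \<open>\<beta> * L < pi\<close>, and its limit at \<open>pi / L\<close> is the claim. If the claim
  failed, some \<open>\<beta>\<close> strictly below \<open>pi / L\<close> would already violate the
  auxiliary inequality; for \<open>L = 0\<close> any \<open>\<beta>\<close> does.\<close>

theorem isoperimetric:
  fixes v :: "real \<Rightarrow> complex"
  assumes "a \<le> b" and v: "v absolutely_integrable_on {a..b}" and closed: "integral {a..b} v = 0"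
  shows "2 * pi * integral {a..b} (\<lambda>t. Im (cnj (integral {a..t} v) * v t)) \<le> (integral {a..b} (\<lambda>t. norm (v t)))\<^sup>2"
proof (rule ccontr)
  define q where "q = integral {a..b} (\<lambda>t. Im (cnj (integral {a..t} v) * v t))"
  define L where "L = integral {a..b} (\<lambda>t. norm (v t))"
  assume "\<not> ?thesis"
  then have qL: "2 * pi * q > L\<^sup>2" by (simp add: q_def L_def)
  have ni: "(\<lambda>t. norm (v t)) integrable_on {a..b}" using v by (auto simp: absolutely_integrable_on_def)
  then have L0: "L \<ge> 0" unfolding L_def by (intro Henstock_Kurzweil_Integration.integral_nonneg) auto
  have "2 * pi * q > 0" using qL by (smt (verit) zero_le_power2)
  then have q0: "q > 0" by (simp add: zero_less_mult_iff)
  have "\<exists>\<beta>>0. \<beta> * L < pi \<and> 2 * \<beta> * q > L"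
  proof (cases "L = 0")
    case False
    then have L: "L > 0" using L0 by simp
    have "L / (2 * q) < pi / L" using qL L q0 by (simp add: field_simps power2_eq_square)
    then obtain \<beta> where \<beta>: "L / (2 * q) < \<beta>" "\<beta> < pi / L" using dense by blast
    have "0 < L / (2 * q)" using L q0 by simp
    then have "\<beta> > 0" using \<beta> by linarith
    then show ?thesis using \<beta> L q0 by (intro exI[of _ \<beta>]) (auto simp: field_simps)
  qed (use q0 in \<open>auto intro!: exI[of _ 1]\<close>)
  then obtain \<beta> where "\<beta> > 0" "\<beta> * L < pi" "2 * \<beta> * q > L" by blast
  then show False using isoperimetric_aux[OF assms, of \<beta>] by (simp add: q_def L_def)
qed

section \<open>Wirtinger's inequality for functions that vanish at both ends\<close>

lemma integral_power2_le:
  fixes n :: "real \<Rightarrow> real"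
  assumes "continuous_on {0..1} n"
  shows "(integral {0..1} n)\<^sup>2 \<le> integral {0..1} (\<lambda>t. (n t)\<^sup>2)"
proof -
  define L where "L = integral {0..1} n"
  have n: "(n has_integral L) {0..1}" unfolding L_def using assms by (intro integrable_integral integrable_continuous_real)
  have n2: "((\<lambda>t. (n t)\<^sup>2) has_integral integral {0..1} (\<lambda>t. (n t)\<^sup>2)) {0..1}"
    using assms by (intro integrable_integral integrable_continuous_real continuous_intros)
  have "((\<lambda>t. (n t)\<^sup>2 - 2 * L * n t + L\<^sup>2) has_integral (integral {0..1} (\<lambda>t. (n t)\<^sup>2) - 2 * L * L + (1 - 0) *\<^sub>R L\<^sup>2)) {0..1}"
    by (intro has_integral_add has_integral_diff has_integral_mult_right n n2 has_integral_const_real[of _ 0 1, simplified] ) (auto intro: has_integral_const_real[of _ 0 1, simplified])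
  then have "0 \<le> integral {0..1} (\<lambda>t. (n t)\<^sup>2) - 2 * L * L + (1 - 0) *\<^sub>R L\<^sup>2"
  proof (rule Henstock_Kurzweil_Integration.has_integral_nonneg)
    fix t
    have "(n t)\<^sup>2 - 2 * L * n t + L\<^sup>2 = (n t - L)\<^sup>2" by (simp add: power2_eq_square algebra_simps)
    then show "0 \<le> (n t)\<^sup>2 - 2 * L * n t + L\<^sup>2" by simp
  qed
  then show ?thesis by (simp add: L_def power2_eq_square)
qed

text \<open>Subtracting the squared mean is what allows the constant \<open>4 * pi\<^sup>2\<close>;
  for the integral of \<open>f\<^sup>2\<close> alone these boundary values would give
  \<open>pi\<^sup>2\<close>. In the isoperimetric inequality for the curve \<open>(f, g)\<close> the
  area side is \<open>8 * pi\<^sup>2\<close> times the variance, and the energy of \<open>g\<close>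
  takes back half of it.\<close>

theorem wirtinger:
  fixes f f' :: "real \<Rightarrow> real"
  assumes der: "\<And>t. t \<in> {0..1} \<Longrightarrow> (f has_real_derivative f' t) (at t within {0..1})"
    and cont': "continuous_on {0..1} f'" and f0: "f 0 = 0" "f 1 = 0"
  shows "4 * pi\<^sup>2 * (integral {0..1} (\<lambda>t. (f t)\<^sup>2) - (integral {0..1} f)\<^sup>2) \<le> integral {0..1} (\<lambda>t. (f' t)\<^sup>2)"
proof -
  have cont: "continuous_on {0..1} f" using der DERIV_continuous_on by blast
  define m where "m = integral {0..1} f"
  define F2 where "F2 = integral {0..1} (\<lambda>t. (f t)\<^sup>2)"
  define D2 where "D2 = integral {0..1} (\<lambda>t. (f' t)\<^sup>2)"
  define g where "g = (\<lambda>t. 2 * pi * (integral {0..t} f - m * t))"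
  define v where "v = (\<lambda>t. Complex (f' t) (2 * pi * (f t - m)))"
  have fi: "(f has_integral m) {0..1}" unfolding m_def using cont by (intro integrable_integral integrable_continuous_real)
  have f2i: "((\<lambda>t. (f t)\<^sup>2) has_integral F2) {0..1}"
    unfolding F2_def using cont by (intro integrable_integral integrable_continuous_real continuous_intros)
  have d2i: "((\<lambda>t. (f' t)\<^sup>2) has_integral D2) {0..1}"
    unfolding D2_def using cont' by (intro integrable_integral integrable_continuous_real continuous_intros)
  have gd: "(g has_real_derivative 2 * pi * (f t - m)) (at t within {0..1})" if "t \<in> {0..1}" for t
    unfolding g_def using integral_has_real_derivative[OF cont that] by (auto intro!: derivative_eq_intros)
  have g01: "g 0 = 0" "g 1 = 0" by (simp_all add: g_def m_def)
  have vc: "continuous_on {0..1} v" unfolding v_def Complex_eq by (intro continuous_intros cont cont')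
  have gam: "integral {0..t} v = Complex (f t) (g t)" if t: "t \<in> {0..1}" for t
  proof -
    have "((\<lambda>t. Complex (f t) (g t)) has_vector_derivative v s) (at s within {0..t})" if "s \<in> {0..t}" for s
    proof -
      have "(f has_vector_derivative f' s) (at s within {0..t})" "(g has_vector_derivative 2 * pi * (f s - m)) (at s within {0..t})"
        unfolding has_real_derivative_iff_has_vector_derivative[symmetric]
        using that t by (auto intro!: DERIV_subset[OF der] DERIV_subset[OF gd])
      then show ?thesis unfolding v_def has_vector_derivative_complex_iff by (simp add: has_real_derivative_iff_has_vector_derivative)
    qed
    from fundamental_theorem_of_calculus[OF _ this] t have "(v has_integral Complex (f t) (g t) - Complex (f 0) (g 0)) {0..t}"
      by auto
    then show ?thesis using f0 g01 by (simp add: integral_unique zero_complex.code[symmetric])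
  qed
  have "integral {0..1} v = 0" using gam[of 1] f0 g01 by (simp add: zero_complex.code)
  note iso = isoperimetric[OF zero_le_one absolutely_integrable_continuous_real[OF vc] this]
  \<comment> \<open>By parts, the two halves of the area integrand have the same integral,
    \<open>2 * pi\<close> times the variance of \<open>f\<close>.\<close>
  have parts: "((\<lambda>t. f' t * g t + f t * (2 * pi * (f t - m))) has_integral (f 1 * g 1 - f 0 * g 0)) {0..1}"
  proof (rule fundamental_theorem_of_calculus)
    fix t :: real assume t: "t \<in> {0..1}"
    show "((\<lambda>t. f t * g t) has_vector_derivative f' t * g t + f t * (2 * pi * (f t - m))) (at t within {0..1})"
      unfolding has_real_derivative_iff_has_vector_derivative[symmetric]
      using der[OF t] gd[OF t] by (auto intro!: derivative_eq_intros)
  qed simp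
  have "((\<lambda>t. 4 * pi * ((f t)\<^sup>2 - m * f t) - (f' t * g t + f t * (2 * pi * (f t - m)))) has_integral 4 * pi * (F2 - m * m) - (f 1 * g 1 - f 0 * g 0)) {0..1}"
    by (intro has_integral_diff has_integral_mult_right fi f2i parts)
  then have "((\<lambda>t. Im (cnj (integral {0..t} v) * v t)) has_integral 4 * pi * (F2 - m * m)) {0..1}"
    using f0 gam by (subst has_integral_cong[where g="\<lambda>t. 4 * pi * ((f t)\<^sup>2 - m * f t) - (f' t * g t + f t * (2 * pi * (f t - m)))"])
       (auto simp: v_def algebra_simps power2_eq_square)
  then have A: "integral {0..1} (\<lambda>t. Im (cnj (integral {0..t} v) * v t)) = 4 * pi * (F2 - m * m)" by (rule integral_unique)
  have c1: "((\<lambda>t. m\<^sup>2) has_integral m\<^sup>2) {0..1::real}" using has_integral_const_real[of "m\<^sup>2" 0 1] by simp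
  have "((\<lambda>t. (f' t)\<^sup>2 + 4 * pi\<^sup>2 * ((f t)\<^sup>2 - 2 * m * f t + m\<^sup>2)) has_integral D2 + 4 * pi\<^sup>2 * (F2 - 2 * m * m + m\<^sup>2)) {0..1}"
    by (intro has_integral_add has_integral_diff has_integral_mult_right fi f2i d2i c1)
  moreover have "(norm (v t))\<^sup>2 = (f' t)\<^sup>2 + 4 * pi\<^sup>2 * ((f t)\<^sup>2 - 2 * m * f t + m\<^sup>2)" for t
    unfolding v_def cmod_power2 by (simp add: power2_eq_square algebra_simps)
  ultimately have "integral {0..1} (\<lambda>t. (norm (v t))\<^sup>2) = D2 + 4 * pi\<^sup>2 * (F2 - 2 * m * m + m\<^sup>2)"
    by (simp add: integral_unique)
  moreover have "(integral {0..1} (\<lambda>t. norm (v t)))\<^sup>2 \<le> integral {0..1} (\<lambda>t. (norm (v t))\<^sup>2)"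
    by (intro integral_power2_le continuous_intros vc)
  ultimately have "2 * pi * (4 * pi * (F2 - m * m)) \<le> D2 + 4 * pi\<^sup>2 * (F2 - 2 * m * m + m\<^sup>2)"
    using iso unfolding A by linarith
  then show ?thesis by (simp add: F2_def D2_def m_def power2_eq_square algebra_simps)
qed

section \<open>Extremals\<close>

lemma hor_eq: "hor (x, l, y) (a, u) = (a, u, (1/2) *\<^sub>R (a *\<^sub>R l - x *\<^sub>R u))"
proof -
  have X0: "X0 (x, l, y) = (1, 0, (1/2) *\<^sub>R l)"
    by (simp add: X0_def vec_eq_iff axis_def if_distrib cong: if_cong)
  have "(\<Sum>i\<in>UNIV. (u $ i) *\<^sub>R X i (x, l, y)) = (0, u, - (x / 2) *\<^sub>R u)"
    by (auto simp: prod_eq_iff fst_sum snd_sum X_def vec_eq_iff axis_def if_distrib cong: if_cong)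
  then show ?thesis by (simp add: hor_def X0 algebra_simps)
qed

lemma Ham_eq: "Ham (x, l, y) (px, pl, py) =
  ((px + (py \<bullet> l) / 2)\<^sup>2 + (pl - (x / 2) *\<^sub>R py) \<bullet> (pl - (x / 2) *\<^sub>R py)) / 2"
proof -
  have X0: "X0 (x, l, y) = (1, 0, (1/2) *\<^sub>R l)"
    by (simp add: X0_def vec_eq_iff axis_def if_distrib cong: if_cong)
  have "(px, pl, py) \<bullet> X i (x, l, y) = (pl - (x / 2) *\<^sub>R py) $ i" for i
    by (simp add: X_def inner_axis)
  then have "(\<Sum>i\<in>UNIV. ((px, pl, py) \<bullet> X i (x, l, y))\<^sup>2) = (pl - (x / 2) *\<^sub>R py) \<bullet> (pl - (x / 2) *\<^sub>R py)"
    by (simp add: inner_vec_def power2_eq_square)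
  then show ?thesis by (simp add: Ham_def X0)
qed

lemma gderiv_Ham_q:
  "gderiv (\<lambda>q. Ham q (px, pl, py)) (x, l, y)
     (- ((pl - (x / 2) *\<^sub>R py) \<bullet> py) / 2, ((px + (py \<bullet> l) / 2) / 2) *\<^sub>R py, 0)"
proof -
  have eq: "(\<lambda>q. Ham q (px, pl, py)) = (\<lambda>q. ((px + (py \<bullet> fst (snd q)) / 2)\<^sup>2 +
     (pl - (fst q / 2) *\<^sub>R py) \<bullet> (pl - (fst q / 2) *\<^sub>R py)) / 2)"
    by (rule ext) (metis Ham_eq prod.collapse)
  show ?thesis unfolding gderiv_def eq
    by (rule derivative_eq_intros refl | simp)+
       (auto simp: fun_eq_iff inner_prod_def inner_commute algebra_simps power2_eq_square add_divide_distrib diff_divide_distrib)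
qed

lemma gderiv_Ham_p:
  "gderiv (\<lambda>p. Ham (x, l, y) p) (px, pl, py)
     (px + (py \<bullet> l) / 2, pl - (x / 2) *\<^sub>R py,
      (1/2) *\<^sub>R ((px + (py \<bullet> l) / 2) *\<^sub>R l - x *\<^sub>R (pl - (x / 2) *\<^sub>R py)))"
proof -
  have eq: "(\<lambda>p. Ham (x, l, y) p) = (\<lambda>p. ((fst p + (snd (snd p) \<bullet> l) / 2)\<^sup>2 +
     (fst (snd p) - (x / 2) *\<^sub>R snd (snd p)) \<bullet> (fst (snd p) - (x / 2) *\<^sub>R snd (snd p))) / 2)"
    by (rule ext) (metis Ham_eq prod.collapse)
  show ?thesis unfolding gderiv_def eq
    by (rule derivative_eq_intros refl | simp)+
       (auto simp: fun_eq_iff inner_prod_def inner_commute algebra_simps power2_eq_square add_divide_distrib diff_divide_distrib)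
qed

lemma gderiv_unique: "gderiv f x D \<Longrightarrow> gderiv f x D' \<Longrightarrow> D = D'"
proof -
  assume "gderiv f x D" "gderiv f x D'"
  then have "(\<lambda>h. h \<bullet> D) = (\<lambda>h. h \<bullet> D')" unfolding gderiv_def by (rule has_derivative_unique)
  then have "(D - D') \<bullet> D = (D - D') \<bullet> D'" by meson
  then have "(D - D') \<bullet> (D - D') = 0" by (simp add: inner_diff_right)
  then show ?thesis by simp
qed

text \<open>\<open>u0\<close> and \<open>u\<close> are the pairings of the covector with the frame,
  so they are the controls of the projected curve. Uniqueness of gradients removes the existential
  quantifiers of \<open>extremal\<close>.\<close>

lemma extremal_iff:
  fixes x px :: "real \<Rightarrow> real" and l y pl py :: "real \<Rightarrow> real^'n::finite"
  defines "u0 \<equiv> \<lambda>t. px t + (py t \<bullet> l t) / 2" and "u \<equiv> \<lambda>t. pl t - (x t / 2) *\<^sub>R py t"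
  shows "extremal (\<lambda>t. ((x t, l t, y t), (px t, pl t, py t))) \<longleftrightarrow>
    (\<forall>t. (x has_real_derivative u0 t) (at t) \<and> (l has_vector_derivative u t) (at t) \<and>
      (y has_vector_derivative (1/2) *\<^sub>R (u0 t *\<^sub>R l t - x t *\<^sub>R u t)) (at t) \<and>
      (px has_real_derivative (u t \<bullet> py t) / 2) (at t) \<and>
      (pl has_vector_derivative - (u0 t / 2) *\<^sub>R py t) (at t) \<and>
      (py has_vector_derivative 0) (at t))" (is "?L \<longleftrightarrow> (\<forall>t. ?R t)")
proof -
  have pair: "((\<lambda>t. (f t, g t)) has_vector_derivative (f', g')) (at t) \<longleftrightarrow>
    (f has_vector_derivative f') (at t) \<and> (g has_vector_derivative g') (at t)"
    for f :: "real \<Rightarrow> 'c::real_normed_vector" and g :: "real \<Rightarrow> 'd::real_normed_vector" and f' g' t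
    using bounded_linear.has_vector_derivative[OF bounded_linear_fst, of "\<lambda>t. (f t, g t)" "(f', g')" "at t"]
      bounded_linear.has_vector_derivative[OF bounded_linear_snd, of "\<lambda>t. (f t, g t)" "(f', g')" "at t"]
      has_vector_derivative_Pair by auto
  have "(\<exists>Hq Hp. gderiv (\<lambda>q. Ham q (px t, pl t, py t)) (x t, l t, y t) Hq \<and>
     gderiv (\<lambda>p. Ham (x t, l t, y t) p) (px t, pl t, py t) Hp \<and>
     ((\<lambda>t. ((x t, l t, y t), (px t, pl t, py t))) has_vector_derivative (Hp, - Hq)) (at t)) \<longleftrightarrow> ?R t" (is "?E \<longleftrightarrow> _") for t
  proof -
    let ?Hq = "(- ((pl t - (x t / 2) *\<^sub>R py t) \<bullet> py t) / 2, ((px t + (py t \<bullet> l t) / 2) / 2) *\<^sub>R py t, 0)"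
    let ?Hp = "(px t + (py t \<bullet> l t) / 2, pl t - (x t / 2) *\<^sub>R py t,
      (1/2) *\<^sub>R ((px t + (py t \<bullet> l t) / 2) *\<^sub>R l t - x t *\<^sub>R (pl t - (x t / 2) *\<^sub>R py t)))"
    have "?E \<longleftrightarrow> ((\<lambda>t. ((x t, l t, y t), (px t, pl t, py t))) has_vector_derivative (?Hp, - ?Hq)) (at t)"
    proof
      assume ?E
      then obtain Hq Hp where h: "gderiv (\<lambda>q. Ham q (px t, pl t, py t)) (x t, l t, y t) Hq"
        "gderiv (\<lambda>p. Ham (x t, l t, y t) p) (px t, pl t, py t) Hp"
        "((\<lambda>t. ((x t, l t, y t), (px t, pl t, py t))) has_vector_derivative (Hp, - Hq)) (at t)" by blast
      have "Hq = ?Hq" "Hp = ?Hp"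
        by (rule gderiv_unique[OF h(1) gderiv_Ham_q], rule gderiv_unique[OF h(2) gderiv_Ham_p])
      with h(3) show "((\<lambda>t. ((x t, l t, y t), (px t, pl t, py t))) has_vector_derivative (?Hp, - ?Hq)) (at t)"
        by (simp only:)
    qed (rule exI, rule exI, rule conjI[OF gderiv_Ham_q conjI[OF gderiv_Ham_p]])
    also have "\<dots> \<longleftrightarrow> ?R t"
      by (simp add: pair u0_def u_def has_real_derivative_iff_has_vector_derivative)
    finally show ?thesis .
  qed
  then show ?thesis unfolding extremal_def by simp
qed

lemma zero_vector_derivative_imp_eq:
  fixes f :: "real \<Rightarrow> 'a::real_normed_vector"
  assumes "\<And>t. (f has_vector_derivative 0) (at t)"
  shows "f s = f t"
  using has_vector_derivative_zero_constant[of UNIV f] assms by (metis UNIV_I convex_UNIV)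

text \<open>The solution of $x'' = c - r^2 x$ with $x(0) = 0$, $x'(0) = a$, its velocity, and the
  integrals of $x$ and $x^2$ from $0$ to $t$. All of them are meaningless for $r = 0$.\<close>

definition flow_x :: "real \<Rightarrow> real \<Rightarrow> real \<Rightarrow> real \<Rightarrow> real" where
  "flow_x a c r t = a * sin (r * t) / r + c * (1 - cos (r * t)) / r\<^sup>2"

definition flow_v :: "real \<Rightarrow> real \<Rightarrow> real \<Rightarrow> real \<Rightarrow> real" where
  "flow_v a c r t = a * cos (r * t) + c * sin (r * t) / r"

definition flow_I1 :: "real \<Rightarrow> real \<Rightarrow> real \<Rightarrow> real \<Rightarrow> real" where
  "flow_I1 a c r t = a * (1 - cos (r * t)) / r\<^sup>2 + c * (r * t - sin (r * t)) / r ^ 3"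

definition flow_I2 :: "real \<Rightarrow> real \<Rightarrow> real \<Rightarrow> real \<Rightarrow> real" where
  "flow_I2 a c r t =
     (a / r)\<^sup>2 * (t / 2 - sin (r * t) * cos (r * t) / (2 * r)) +
     (a / r) * (c / r\<^sup>2) * (1 - cos (r * t))\<^sup>2 / r +
     (c / r\<^sup>2)\<^sup>2 * (3 * t / 2 - 2 * sin (r * t) / r + sin (r * t) * cos (r * t) / (2 * r))"

lemma flow_0 [simp]: "flow_x a c r 0 = 0" "flow_v a c r 0 = a" "flow_I1 a c r 0 = 0" "flow_I2 a c r 0 = 0"
  by (simp_all add: flow_x_def flow_v_def flow_I1_def flow_I2_def)

lemma flow_derivs:
  assumes "r \<noteq> 0"
  shows "(flow_x a c r has_real_derivative flow_v a c r t) (at t within S)"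
    and "(flow_v a c r has_real_derivative c - r\<^sup>2 * flow_x a c r t) (at t within S)"
    and "(flow_I1 a c r has_real_derivative flow_x a c r t) (at t within S)"
    and "(flow_I2 a c r has_real_derivative (flow_x a c r t)\<^sup>2) (at t within S)"
proof -
  show "(flow_x a c r has_real_derivative flow_v a c r t) (at t within S)"
    unfolding flow_x_def flow_v_def using assms
    by (auto intro!: derivative_eq_intros simp: field_simps power2_eq_square)
  show "(flow_v a c r has_real_derivative c - r\<^sup>2 * flow_x a c r t) (at t within S)"
    unfolding flow_x_def flow_v_def using assms
    by (auto intro!: derivative_eq_intros simp: field_simps power2_eq_square)
  show "(flow_I1 a c r has_real_derivative flow_x a c r t) (at t within S)"
    unfolding flow_x_def flow_I1_def using assms
    by (auto intro!: derivative_eq_intros simp: field_simps power2_eq_square power3_eq_cube)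
  have s: "sin (r * t) * sin (r * t) = 1 - cos (r * t) * cos (r * t)"
    using sin_squared_eq[of "r * t"] by (simp only: power2_eq_square)
  have "((\<lambda>t. t / 2 - sin (r * t) * cos (r * t) / (2 * r)) has_real_derivative (sin (r * t))\<^sup>2) (at t within S)"
    using assms by (auto intro!: derivative_eq_intros simp: field_simps s power2_eq_square)
  moreover have "((\<lambda>t. (1 - cos (r * t))\<^sup>2 / r) has_real_derivative 2 * (1 - cos (r * t)) * sin (r * t)) (at t within S)"
    using assms by (auto intro!: derivative_eq_intros simp: field_simps)
  moreover have "((\<lambda>t. 3 * t / 2 - 2 * sin (r * t) / r + sin (r * t) * cos (r * t) / (2 * r)) has_real_derivative (1 - cos (r * t))\<^sup>2) (at t within S)"
    using assms by (auto intro!: derivative_eq_intros simp: field_simps s power2_eq_square)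
  ultimately have "(flow_I2 a c r has_real_derivative (a / r)\<^sup>2 * (sin (r * t))\<^sup>2 +
     (a / r) * (c / r\<^sup>2) * (2 * (1 - cos (r * t)) * sin (r * t)) + (c / r\<^sup>2)\<^sup>2 * (1 - cos (r * t))\<^sup>2) (at t within S)"
    unfolding flow_I2_def times_divide_eq_right[of "_ * _" "(1 - cos _)\<^sup>2", symmetric]
    by (intro DERIV_add DERIV_cmult)
  moreover have "(a / r)\<^sup>2 * (sin (r * t))\<^sup>2 +
     (a / r) * (c / r\<^sup>2) * (2 * (1 - cos (r * t)) * sin (r * t)) + (c / r\<^sup>2)\<^sup>2 * (1 - cos (r * t))\<^sup>2 = (flow_x a c r t)\<^sup>2"
  proof -
    have "A\<^sup>2 * S\<^sup>2 + A * B * (2 * D * S) + B\<^sup>2 * D\<^sup>2 = (A * S + B * D)\<^sup>2" for A B D S :: real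
      by (simp add: power2_eq_square algebra_simps)
    from this[of "a / r" "sin (r * t)" "c / r\<^sup>2" "1 - cos (r * t)"] show ?thesis
      unfolding flow_x_def by simp
  qed
  ultimately show "(flow_I2 a c r has_real_derivative (flow_x a c r t)\<^sup>2) (at t within S)" by simp
qed

lemma flow_continuous:
  assumes "r \<noteq> 0"
  shows "continuous_on S (flow_x a c r)" "continuous_on S (flow_v a c r)"
  by (rule DERIV_continuous_on, rule flow_derivs[OF assms])+

text \<open>\<open>geo_l\<close> integrates \<open>l' = u - x w\<close>, and \<open>geo_y\<close> is
  \<open>x l / 2 - z\<close> with \<open>z\<close> the integral of \<open>x l'\<close>. Only the
  first two moments of \<open>x\<close> enter.\<close>

definition geo_l :: "real \<Rightarrow> real^'n::finite \<Rightarrow> real^'n \<Rightarrow> real \<Rightarrow> real^'n" where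
  "geo_l a u w t = t *\<^sub>R u - flow_I1 a (u \<bullet> w) (norm w) t *\<^sub>R w"

definition geo_y :: "real \<Rightarrow> real^'n::finite \<Rightarrow> real^'n \<Rightarrow> real \<Rightarrow> real^'n" where
  "geo_y a u w t = (flow_x a (u \<bullet> w) (norm w) t / 2) *\<^sub>R geo_l a u w t -
     (flow_I1 a (u \<bullet> w) (norm w) t *\<^sub>R u - flow_I2 a (u \<bullet> w) (norm w) t *\<^sub>R w)"

lemma geo_derivs:
  fixes a :: real and u w :: "real^'n::finite"
  assumes "w \<noteq> 0"
  defines "x \<equiv> flow_x a (u \<bullet> w) (norm w)" and "v \<equiv> flow_v a (u \<bullet> w) (norm w)"
  shows "(geo_l a u w has_vector_derivative u - x t *\<^sub>R w) (at t within S)"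
    and "(geo_y a u w has_vector_derivative (1/2) *\<^sub>R (v t *\<^sub>R geo_l a u w t - x t *\<^sub>R (u - x t *\<^sub>R w))) (at t within S)"
proof -
  have r: "norm w \<noteq> 0" using assms by simp
  note d = flow_derivs[OF r, of a "u \<bullet> w" t S]
  show l: "(geo_l a u w has_vector_derivative u - x t *\<^sub>R w) (at t within S)"
    unfolding geo_l_def x_def by (auto intro!: derivative_eq_intros d)
  show "(geo_y a u w has_vector_derivative (1/2) *\<^sub>R (v t *\<^sub>R geo_l a u w t - x t *\<^sub>R (u - x t *\<^sub>R w))) (at t within S)"
    unfolding geo_y_def using l d unfolding x_def v_def
    by (auto intro!: derivative_eq_intros simp: vec_eq_iff field_simps power2_eq_square)
qed

lemma extremal_geo:
  fixes a :: real and u w :: "real^'n::finite"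
  assumes w: "w \<noteq> 0"
  defines "x \<equiv> flow_x a (u \<bullet> w) (norm w)" and "v \<equiv> flow_v a (u \<bullet> w) (norm w)"
  shows "extremal (\<lambda>t. ((x t, geo_l a u w t, geo_y a u w t),
    (v t - (w \<bullet> geo_l a u w t) / 2, u - (x t / 2) *\<^sub>R w, w)))"
proof -
  have r: "norm w \<noteq> 0" using w by simp
  note d = flow_derivs[OF r, of a "u \<bullet> w" _ UNIV, folded x_def v_def]
  note g = geo_derivs[OF w, of a u _ UNIV, folded x_def v_def]
  have e: "u - (x t / 2) *\<^sub>R w - (x t / 2) *\<^sub>R w = u - x t *\<^sub>R w" for t
    by (simp add: algebra_simps flip: scaleR_add_left)
  have wd: "((\<lambda>t. w \<bullet> geo_l a u w t) has_real_derivative w \<bullet> (u - x t *\<^sub>R w)) (at t)" for t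
    using bounded_linear.has_vector_derivative[OF bounded_linear_inner_right g(1)]
    by (simp add: has_real_derivative_iff_has_vector_derivative)
  have "((\<lambda>t. v t - (w \<bullet> geo_l a u w t) / 2) has_real_derivative ((u - x t *\<^sub>R w) \<bullet> w) / 2) (at t)" for t
    by (rule DERIV_cong[OF DERIV_diff[OF d(2) DERIV_cdivide[OF wd]]])
       (simp add: inner_diff inner_commute dot_square_norm field_simps)
  moreover have "((\<lambda>t. u - (x t / 2) *\<^sub>R w) has_vector_derivative - (v t / 2) *\<^sub>R w) (at t)" for t
    using d(1)[of t] by (auto intro!: derivative_eq_intros)
  ultimately show ?thesis
    unfolding extremal_iff e using d g by (auto simp: inner_commute)
qed

text \<open>Left invariance makes \<open>py\<close> and \<open>pl + (x / 2) *\<^sub>R py\<close>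
  constant, which leaves a linear oscillator for \<open>x\<close> and \<open>u0\<close>. The
  oscillator energy of the difference to the explicit solution is constant and starts at zero. This
  uniqueness is what evaluates the \<open>THE\<close> in \<open>sr_geodesic\<close>.\<close>

lemma extremal_unique:
  fixes a :: real and u w :: "real^'n::finite"
  assumes w: "w \<noteq> 0" and z: "extremal z" "z 0 = (0, (a, u, w))"
  defines "xf \<equiv> flow_x a (u \<bullet> w) (norm w)" and "vf \<equiv> flow_v a (u \<bullet> w) (norm w)"
  shows "z t = ((xf t, geo_l a u w t, geo_y a u w t),
    (vf t - (w \<bullet> geo_l a u w t) / 2, u - (xf t / 2) *\<^sub>R w, w))"
proof -
  define x where "x = (\<lambda>t. fst (fst (z t)))"
  define l where "l = (\<lambda>t. fst (snd (fst (z t))))"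
  define y where "y = (\<lambda>t. snd (snd (fst (z t))))"
  define px where "px = (\<lambda>t. fst (snd (z t)))"
  define pl where "pl = (\<lambda>t. fst (snd (snd (z t))))"
  define py where "py = (\<lambda>t. snd (snd (snd (z t))))"
  have zeq: "z = (\<lambda>t. ((x t, l t, y t), (px t, pl t, py t)))"
    by (simp add: x_def l_def y_def px_def pl_def py_def)
  define u0 where "u0 = (\<lambda>t. px t + (py t \<bullet> l t) / 2)"
  define ul where "ul = (\<lambda>t. pl t - (x t / 2) *\<^sub>R py t)"
  have init: "x 0 = 0" "l 0 = 0" "y 0 = 0" "px 0 = a" "pl 0 = u" "py 0 = w"
    using z(2) by (auto simp: x_def l_def y_def px_def pl_def py_def zero_prod_def)
  have D: "(x has_real_derivative u0 t) (at t)" "(l has_vector_derivative ul t) (at t)"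
      "(y has_vector_derivative (1/2) *\<^sub>R (u0 t *\<^sub>R l t - x t *\<^sub>R ul t)) (at t)"
      "(px has_real_derivative (ul t \<bullet> py t) / 2) (at t)"
      "(pl has_vector_derivative - (u0 t / 2) *\<^sub>R py t) (at t)"
      "(py has_vector_derivative 0) (at t)" for t
    using z(1)[unfolded zeq extremal_iff] by (auto simp: u0_def ul_def)
  have pyw: "py t = w" for t using zero_vector_derivative_imp_eq[of py t 0] D init by simp
  have plx: "pl t + (x t / 2) *\<^sub>R w = u" for t
  proof -
    have "((\<lambda>t. pl t + (x t / 2) *\<^sub>R w) has_vector_derivative 0) (at t)" for t
      using D(1,5)[of t] by (auto intro!: derivative_eq_intros simp: pyw)
    from zero_vector_derivative_imp_eq[OF this, of t 0] show ?thesis by (simp add: init)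
  qed
  have pleq: "pl t = u - (x t / 2) *\<^sub>R w" for t using plx[of t] by (metis add_diff_cancel_right')
  have uleq: "ul t = u - x t *\<^sub>R w" for t
    unfolding ul_def pyw pleq by (simp add: algebra_simps flip: scaleR_add_left)
  define r where "r = norm w"
  have r: "r \<noteq> 0" "r\<^sup>2 = w \<bullet> w" using w by (auto simp: r_def dot_square_norm)
  have u0d: "(u0 has_real_derivative u \<bullet> w - r\<^sup>2 * x t) (at t)" for t
  proof -
    have "((\<lambda>t. w \<bullet> l t) has_real_derivative w \<bullet> ul t) (at t)"
      using bounded_linear.has_vector_derivative[OF bounded_linear_inner_right D(2)]
      by (simp add: has_real_derivative_iff_has_vector_derivative)
    then show ?thesis
      unfolding u0_def pyw using D(4)[of t]
      by (auto intro!: derivative_eq_intros simp: pyw uleq r inner_diff inner_commute field_simps)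
  qed
  note d = flow_derivs[OF r(1), of a "u \<bullet> w" _ UNIV, unfolded r_def, folded xf_def vf_def]
  have energy: "r\<^sup>2 * (x t - xf t)\<^sup>2 + (u0 t - vf t)\<^sup>2 = 0" for t
  proof -
    have "((\<lambda>t. r\<^sup>2 * (x t - xf t)\<^sup>2 + (u0 t - vf t)\<^sup>2) has_real_derivative 0) (at t)" for t
      by (rule derivative_eq_intros D(1) d u0d refl)+ (simp add: r_def algebra_simps)
    then have "r\<^sup>2 * (x t - xf t)\<^sup>2 + (u0 t - vf t)\<^sup>2 = r\<^sup>2 * (x 0 - xf 0)\<^sup>2 + (u0 0 - vf 0)\<^sup>2"
      by (intro zero_vector_derivative_imp_eq[where f="\<lambda>t. r\<^sup>2 * (x t - xf t)\<^sup>2 + (u0 t - vf t)\<^sup>2"])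
         (simp add: has_real_derivative_iff_has_vector_derivative)
    then show ?thesis by (simp add: init xf_def vf_def u0_def)
  qed
  have "x t = xf t \<and> u0 t = vf t" for t
  proof -
    have "r\<^sup>2 * (x t - xf t)\<^sup>2 = 0 \<and> (u0 t - vf t)\<^sup>2 = 0"
      using energy[of t] by (subst add_nonneg_eq_0_iff[symmetric]) auto
    then show ?thesis using r(1) by simp
  qed
  then have xeq: "x = xf" and ueq: "u0 = vf" by auto
  note g = geo_derivs[OF w, of a u _ UNIV, folded xf_def vf_def]
  have lgeo: "l t = geo_l a u w t" for t
  proof -
    have "((\<lambda>t. l t - geo_l a u w t) has_vector_derivative 0) (at t)" for t
      using D(2)[of t] g(1)[of t] by (auto intro!: derivative_eq_intros simp: uleq xeq)
    from zero_vector_derivative_imp_eq[OF this, of t 0] show ?thesis by (simp add: init geo_l_def)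
  qed
  have ygeo: "y t = geo_y a u w t" for t
  proof -
    have "((\<lambda>t. y t - geo_y a u w t) has_vector_derivative 0) (at t)" for t
      using D(3)[of t] g(2)[of t] by (auto intro!: derivative_eq_intros simp: uleq xeq lgeo ueq)
    from zero_vector_derivative_imp_eq[OF this, of t 0] show ?thesis by (simp add: init geo_y_def)
  qed
  have "px t = vf t - (w \<bullet> geo_l a u w t) / 2"
    using ueq by (auto simp: u0_def pyw lgeo fun_eq_iff algebra_simps)
  then show ?thesis unfolding zeq by (simp add: xeq lgeo ygeo pleq pyw)
qed

lemma sr_geodesic_eq:
  assumes w: "w \<noteq> 0"
  shows "sr_geodesic (a, u, w) t = (flow_x a (u \<bullet> w) (norm w) t, geo_l a u w t, geo_y a u w t)"
proof -
  let ?z = "\<lambda>t. ((flow_x a (u \<bullet> w) (norm w) t, geo_l a u w t, geo_y a u w t),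
    (flow_v a (u \<bullet> w) (norm w) t - (w \<bullet> geo_l a u w t) / 2, u - (flow_x a (u \<bullet> w) (norm w) t / 2) *\<^sub>R w, w))"
  have "(THE z. extremal z \<and> z 0 = (0, (a, u, w))) = ?z"
  proof (rule the_equality)
    show "extremal ?z \<and> ?z 0 = (0, (a, u, w))"
      using extremal_geo[OF w] by (simp add: geo_l_def geo_y_def zero_prod_def)
    show "z = ?z" if "extremal z \<and> z 0 = (0, (a, u, w))" for z
      using extremal_unique[OF w] that by blast
  qed
  then show ?thesis by (simp add: sr_geodesic_def)
qed

section \<open>Lower bounds for the length\<close>

lemma horizontal_on_C1:
  fixes l y u :: "real \<Rightarrow> real^'n::finite"
  assumes "\<And>t. t \<in> {a..b} \<Longrightarrow> (x has_real_derivative v t) (at t within {a..b})"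
    and "\<And>t. t \<in> {a..b} \<Longrightarrow> (l has_vector_derivative u t) (at t within {a..b})"
    and "\<And>t. t \<in> {a..b} \<Longrightarrow> (y has_vector_derivative (1/2) *\<^sub>R (v t *\<^sub>R l t - x t *\<^sub>R u t)) (at t within {a..b})"
    and "continuous_on {a..b} v" "continuous_on {a..b} u"
  shows "horizontal_on a b (\<lambda>t. (x t, l t, y t)) (\<lambda>t. (v t, u t))"
  unfolding horizontal_on_def
proof (intro conjI ballI)
  show "(\<lambda>t. (v t, u t)) absolutely_integrable_on {a..b}"
    by (intro absolutely_integrable_continuous_real continuous_intros assms)
  fix t assume t: "t \<in> {a..b}"
  show "((\<lambda>s. hor (x s, l s, y s) (v s, u s)) has_integral (x t, l t, y t) - (x a, l a, y a)) {a..t}"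
  proof (rule fundamental_theorem_of_calculus)
    fix s assume "s \<in> {a..t}"
    then have s: "s \<in> {a..b}" and sub: "{a..t} \<subseteq> {a..b}" using t by auto
    show "((\<lambda>t. (x t, l t, y t)) has_vector_derivative hor (x s, l s, y s) (v s, u s)) (at s within {a..t})"
      unfolding hor_eq using assms(1-3)[OF s]
      by (intro has_vector_derivative_within_subset[OF _ sub] has_vector_derivative_Pair)
         (auto simp: has_real_derivative_iff_has_vector_derivative)
  qed (use t in auto)
qed

text \<open>A curve with an integrable control need not be differentiable everywhere, so its
  coordinates are extracted from the integral equation by bounded linear maps. The third integral is
  the area swept in the plane \<open>(l \<bullet> k, x)\<close>; the fourth describes that plane by
  complex numbers.\<close>

lemma horizontal_on_integrals:
  fixes h :: "real \<Rightarrow> 'n::finite path_group"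
  assumes "horizontal_on c d h w" and t: "t \<in> {c..d}"
  shows "((\<lambda>s. fst (w s)) has_integral fst (h t) - fst (h c)) {c..t}"
    and "((\<lambda>s. snd (w s) \<bullet> k) has_integral fst (snd (h t)) \<bullet> k - fst (snd (h c)) \<bullet> k) {c..t}"
    and "((\<lambda>s. ((fst (snd (h s)) \<bullet> k) * fst (w s) - fst (h s) * (snd (w s) \<bullet> k)) / 2)
           has_integral snd (snd (h t)) \<bullet> k - snd (snd (h c)) \<bullet> k) {c..t}"
    and "((\<lambda>s. Complex (snd (w s) \<bullet> k) (fst (w s))) has_integral
           Complex (fst (snd (h t)) \<bullet> k) (fst (h t)) - Complex (fst (snd (h c)) \<bullet> k) (fst (h c))) {c..t}"
proof -
  have h: "((\<lambda>s. hor (h s) (w s)) has_integral h t - h c) {c..t}"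
    using assms by (auto simp: horizontal_on_def)
  have eq: "hor (h s) (w s) = (fst (w s), snd (w s), (1/2) *\<^sub>R (fst (w s) *\<^sub>R fst (snd (h s)) - fst (h s) *\<^sub>R snd (w s)))" for s
    using hor_eq[of "fst (h s)" "fst (snd (h s))" "snd (snd (h s))" "fst (w s)" "snd (w s)"] by simp
  have 1: "bounded_linear (fst :: 'n path_group \<Rightarrow> real)" by (rule bounded_linear_fst)
  have 2: "bounded_linear (\<lambda>q :: 'n path_group. fst (snd q) \<bullet> k)"
    by (intro bounded_linear_intros)
  have 3: "bounded_linear (\<lambda>q :: 'n path_group. snd (snd q) \<bullet> k)"
    by (intro bounded_linear_intros)
  show "((\<lambda>s. fst (w s)) has_integral fst (h t) - fst (h c)) {c..t}"
    using has_integral_linear[OF h 1] by (simp add: o_def eq)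
  show "((\<lambda>s. snd (w s) \<bullet> k) has_integral fst (snd (h t)) \<bullet> k - fst (snd (h c)) \<bullet> k) {c..t}"
    using has_integral_linear[OF h 2] by (simp add: o_def eq inner_diff_left)
  show "((\<lambda>s. ((fst (snd (h s)) \<bullet> k) * fst (w s) - fst (h s) * (snd (w s) \<bullet> k)) / 2)
           has_integral snd (snd (h t)) \<bullet> k - snd (snd (h c)) \<bullet> k) {c..t}"
    using has_integral_linear[OF h 3] by (simp add: o_def eq inner_diff_left algebra_simps diff_divide_distrib)
  have 4: "bounded_linear (\<lambda>q :: 'n path_group. Complex (fst (snd q) \<bullet> k) (fst q))"
    unfolding Complex_eq
    by (intro bounded_linear_add bounded_linear_compose[OF bounded_linear_of_real]
        bounded_linear_const_mult bounded_linear_intros)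
  show "((\<lambda>s. Complex (snd (w s) \<bullet> k) (fst (w s))) has_integral
           Complex (fst (snd (h t)) \<bullet> k) (fst (h t)) - Complex (fst (snd (h c)) \<bullet> k) (fst (h c))) {c..t}"
    using has_integral_linear[OF h 4] by (simp add: o_def eq inner_diff_left complex_diff)
qed

text \<open>Removing the component along \<open>k\<close> from \<open>u\<close> does not change the
  product with \<open>k'\<close>, and Cauchy-Schwarz bounds what is left. The form
  \<open>norm k' \<le> 1\<close> admits a normalized vector \<open>sgn z\<close> even when
  \<open>z = 0\<close>.\<close>

lemma bessel_two:
  fixes u k k' :: "'a::real_inner"
  assumes "norm k = 1" "norm k' \<le> 1" "k \<bullet> k' = 0"
  shows "(u \<bullet> k)\<^sup>2 + (u \<bullet> k')\<^sup>2 \<le> u \<bullet> u"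
proof -
  define u' where "u' = u - (u \<bullet> k) *\<^sub>R k"
  have kk: "k \<bullet> k = 1" using assms by (simp add: norm_eq_1)
  have "u \<bullet> k' = u' \<bullet> k'" using assms by (simp add: u'_def inner_diff_left)
  moreover have "(u' \<bullet> k')\<^sup>2 \<le> (norm u' * 1)\<^sup>2"
    using Cauchy_Schwarz_ineq2[of u' k'] assms
    by (metis abs_ge_zero abs_le_square_iff abs_mult abs_norm_cancel abs_one mult_left_mono norm_ge_zero order_trans)
  moreover have "(norm u')\<^sup>2 = u \<bullet> u - (u \<bullet> k)\<^sup>2"
    unfolding power2_norm_eq_inner u'_def by (simp add: inner_diff kk inner_commute[of k u] power2_eq_square)
  ultimately show ?thesis by simp
qed

text \<open>The projection to the plane \<open>(l \<bullet> k, x)\<close> closes up, and because the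
  curve starts at the identity, \<open>y \<bullet> k\<close> is the area it encloses. The
  isoperimetric inequality thus bounds the planar length from below; the displacement along
  \<open>k'\<close> is orthogonal to that plane, so the two contributions add in squares.\<close>

lemma horizontal_length_lower_bound:
  fixes h :: "real \<Rightarrow> 'n::finite path_group"
  assumes hor: "horizontal_on c d h w" and "c \<le> d" and hc: "h c = 0"
    and x: "fst (h d) = 0" and l: "fst (snd (h d)) \<bullet> k = 0"
    and k: "norm k = 1" "norm k' \<le> 1" "k \<bullet> k' = 0"
  shows "4 * pi * (snd (snd (h d)) \<bullet> k) + (fst (snd (h d)) \<bullet> k')\<^sup>2 \<le> (sr_length c d w)\<^sup>2"
proof -
  define v where "v = (\<lambda>s. Complex (snd (w s) \<bullet> k) (fst (w s)))"
  have wa: "w absolutely_integrable_on {c..d}" using hor by (simp add: horizontal_on_def)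
  have bl: "bounded_linear (\<lambda>q :: real \<times> (real^'n). Complex (snd q \<bullet> k) (fst q))"
    unfolding Complex_eq
    by (intro bounded_linear_add bounded_linear_compose[OF bounded_linear_of_real]
        bounded_linear_const_mult bounded_linear_intros)
  have va: "v absolutely_integrable_on {c..d}"
    using absolutely_integrable_linear[OF wa bl] by (simp add: o_def v_def)
  have vi: "(v has_integral Complex (fst (snd (h t)) \<bullet> k) (fst (h t))) {c..t}" if t: "t \<in> {c..d}" for t
    unfolding v_def using horizontal_on_integrals(4)[OF hor t, of k] hc by (simp add: zero_complex.code[symmetric])
  have vd: "integral {c..d} v = 0"
    using vi[of d] \<open>c \<le> d\<close> x l by (simp add: integral_unique zero_complex.code)
  have "((\<lambda>t. Im (cnj (integral {c..t} v) * v t)) has_integral 2 * (snd (snd (h d)) \<bullet> k)) {c..d}"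
  proof (rule has_integral_eq)
    show "((\<lambda>s. 2 * (((fst (snd (h s)) \<bullet> k) * fst (w s) - fst (h s) * (snd (w s) \<bullet> k)) / 2)) has_integral 2 * (snd (snd (h d)) \<bullet> k)) {c..d}"
      using has_integral_mult_right[OF horizontal_on_integrals(3)[OF hor, of d k], of 2] \<open>c \<le> d\<close> hc by simp
    fix t assume "t \<in> {c..d}"
    then have "integral {c..t} v = Complex (fst (snd (h t)) \<bullet> k) (fst (h t))" using vi by (simp add: integral_unique)
    then show "2 * (((fst (snd (h t)) \<bullet> k) * fst (w t) - fst (h t) * (snd (w t) \<bullet> k)) / 2) = Im (cnj (integral {c..t} v) * v t)"
      by (simp add: v_def)
  qed
  then have iso: "2 * pi * (2 * (snd (snd (h d)) \<bullet> k)) \<le> (integral {c..d} (\<lambda>t. norm (v t)))\<^sup>2"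
    using isoperimetric[OF \<open>c \<le> d\<close> va vd] by (simp add: integral_unique)
  define P where "P = integral {c..d} (\<lambda>t. norm (v t))"
  define Q where "Q = fst (snd (h d)) \<bullet> k'"
  define N where "N = sqrt (P\<^sup>2 + Q\<^sup>2)"
  define L where "L = sr_length c d w"
  have Pi: "((\<lambda>t. norm (v t)) has_integral P) {c..d}"
    unfolding P_def using va by (intro integrable_integral) (simp add: absolutely_integrable_on_def)
  have Qi: "((\<lambda>s. snd (w s) \<bullet> k') has_integral Q) {c..d}"
    unfolding Q_def using horizontal_on_integrals(2)[OF hor, of d k'] \<open>c \<le> d\<close> hc by simp
  have Li: "((\<lambda>s. norm (w s)) has_integral L) {c..d}"
    unfolding L_def sr_length_def using wa by (intro integrable_integral) (simp add: absolutely_integrable_on_def)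
  \<comment> \<open>Minkowski: pair the planar speed and the speed along k' with the constant vector (P, Q)\<close>
  have "P * P + Q * Q \<le> N * L"
  proof (rule has_integral_le)
    show "((\<lambda>s. P * norm (v s) + Q * (snd (w s) \<bullet> k')) has_integral P * P + Q * Q) {c..d}"
      by (intro has_integral_add has_integral_mult_right Pi Qi)
    show "((\<lambda>s. N * norm (w s)) has_integral N * L) {c..d}"
      by (intro has_integral_mult_right Li)
    fix s
    have "(norm (v s))\<^sup>2 + (snd (w s) \<bullet> k')\<^sup>2 \<le> (norm (w s))\<^sup>2"
      using bessel_two[OF k, of "snd (w s)"]
      by (simp add: v_def cmod_power2 norm_prod_def power2_norm_eq_inner)
    then have "norm (norm (v s), snd (w s) \<bullet> k') \<le> norm (w s)"
      unfolding norm_Pair by (intro real_le_lsqrt) simp_all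
    moreover have "norm (P, Q) = N" by (simp add: N_def norm_Pair)
    moreover have "P * norm (v s) + Q * (snd (w s) \<bullet> k') \<le> norm (P, Q) * norm (norm (v s), snd (w s) \<bullet> k')"
      using norm_cauchy_schwarz[of "(P, Q)" "(norm (v s), snd (w s) \<bullet> k')"] by simp
    ultimately show "P * norm (v s) + Q * (snd (w s) \<bullet> k') \<le> N * norm (w s)"
      using mult_left_mono[OF _ norm_ge_zero, of "norm (norm (v s), snd (w s) \<bullet> k')" "norm (w s)" "(P, Q)"] by simp
  qed
  moreover have "P * P + Q * Q = N * N" by (simp add: N_def power2_eq_square)
  ultimately have "N * N \<le> N * L" by simp
  moreover have N0: "N \<ge> 0" by (simp add: N_def)
  moreover have "L \<ge> 0" using Li by (rule Henstock_Kurzweil_Integration.has_integral_nonneg) simp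
  ultimately have "N \<le> L" by (cases "N = 0") auto
  then have "N\<^sup>2 \<le> L\<^sup>2" using N0 by (rule power_mono)
  then have "P\<^sup>2 + Q\<^sup>2 \<le> L\<^sup>2" by (simp add: N_def)
  then show ?thesis using iso by (simp add: P_def Q_def L_def)
qed

section \<open>The controls of the geodesic and its minimality over a full period\<close>

definition geo_ctrl :: "real \<Rightarrow> real^'n::finite \<Rightarrow> real^'n \<Rightarrow> real \<Rightarrow> real \<times> (real^'n)" where
  "geo_ctrl a u w t = (flow_v a (u \<bullet> w) (norm w) t, u - flow_x a (u \<bullet> w) (norm w) t *\<^sub>R w)"

lemma horizontal_on_geodesic:
  assumes "w \<noteq> 0"
  shows "horizontal_on 0 T (sr_geodesic (a, u, w)) (geo_ctrl a u w)"
proof -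
  have r: "norm w \<noteq> 0" using assms by simp
  show ?thesis
    unfolding sr_geodesic_eq[OF assms, abs_def] geo_ctrl_def
    by (intro horizontal_on_C1 flow_derivs[OF r] geo_derivs[OF assms] continuous_intros flow_continuous[OF r])
qed

text \<open>Conservation of the Hamiltonian along the extremal; for a normalized covector it gives
  unit speed.\<close>

lemma geo_ctrl_energy:
  assumes "w \<noteq> 0"
  shows "(flow_v a (u \<bullet> w) (norm w) t)\<^sup>2 +
     (u - flow_x a (u \<bullet> w) (norm w) t *\<^sub>R w) \<bullet> (u - flow_x a (u \<bullet> w) (norm w) t *\<^sub>R w) = a\<^sup>2 + u \<bullet> u"
proof -
  let ?v = "flow_v a (u \<bullet> w) (norm w)" and ?x = "flow_x a (u \<bullet> w) (norm w)"
  have r: "norm w \<noteq> 0" using assms by simp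
  have ex: "(u - ?x t *\<^sub>R w) \<bullet> (u - ?x t *\<^sub>R w) = u \<bullet> u - 2 * ?x t * (u \<bullet> w) + (?x t)\<^sup>2 * (norm w)\<^sup>2" for t
    unfolding power2_norm_eq_inner by (simp add: inner_diff inner_commute[of w u] power2_eq_square algebra_simps)
  have "((\<lambda>t. (?v t)\<^sup>2 + (u \<bullet> u - 2 * ?x t * (u \<bullet> w) + (?x t)\<^sup>2 * (norm w)\<^sup>2)) has_real_derivative 0) (at t)" for t
    by (rule derivative_eq_intros flow_derivs[OF r] refl)+ (simp add: algebra_simps)
  then have "(?v t)\<^sup>2 + (u \<bullet> u - 2 * ?x t * (u \<bullet> w) + (?x t)\<^sup>2 * (norm w)\<^sup>2) =
      (?v 0)\<^sup>2 + (u \<bullet> u - 2 * ?x 0 * (u \<bullet> w) + (?x 0)\<^sup>2 * (norm w)\<^sup>2)"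
    by (intro zero_vector_derivative_imp_eq[where f="\<lambda>t. (?v t)\<^sup>2 + (u \<bullet> u - 2 * ?x t * (u \<bullet> w) + (?x t)\<^sup>2 * (norm w)\<^sup>2)"])
       (simp add: has_real_derivative_iff_has_vector_derivative)
  then show ?thesis by (simp add: ex)
qed

lemma norm_geo_ctrl:
  assumes "w \<noteq> 0" "a\<^sup>2 + u \<bullet> u = 1"
  shows "norm (geo_ctrl a u w t) = 1"
  using geo_ctrl_energy[OF assms(1), of a u t] assms(2)
  by (simp add: geo_ctrl_def norm_prod_def power2_norm_eq_inner)

lemma geodesic_period_endpoint:
  fixes a :: real and u w :: "real^'n::finite"
  assumes w: "w \<noteq> 0"
  defines "r \<equiv> norm w" and "T \<equiv> 2 * pi / norm w" and "c \<equiv> u \<bullet> w"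
  shows "sr_geodesic (a, u, w) T =
     (0, T *\<^sub>R (u - (c / r\<^sup>2) *\<^sub>R w), - (((2 * pi * c / r ^ 3)) *\<^sub>R u - ((pi / r) * ((a / r)\<^sup>2 + 3 * (c / r\<^sup>2)\<^sup>2)) *\<^sub>R w))"
proof -
  have r: "r \<noteq> 0" using w by (simp add: r_def)
  have rT: "norm w * T = 2 * pi" using r by (simp add: T_def r_def)
  have x: "flow_x a c (norm w) T = 0" by (simp add: flow_x_def rT)
  have I1: "flow_I1 a c (norm w) T = 2 * pi * c / r ^ 3" by (simp add: flow_I1_def rT r_def)
  have "flow_I2 a c (norm w) T = (a / r)\<^sup>2 * (T / 2) + (c / r\<^sup>2)\<^sup>2 * (3 * T / 2)"
    by (simp add: flow_I2_def rT r_def)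
  also have "\<dots> = (pi / r) * ((a / r)\<^sup>2 + 3 * (c / r\<^sup>2)\<^sup>2)"
    by (simp add: T_def r_def[symmetric] algebra_simps)
  finally have I2: "flow_I2 a c (norm w) T = (pi / r) * ((a / r)\<^sup>2 + 3 * (c / r\<^sup>2)\<^sup>2)" .
  have "geo_l a u w T = T *\<^sub>R (u - (c / r\<^sup>2) *\<^sub>R w)"
    unfolding geo_l_def c_def[symmetric] I1 using r
    by (simp add: T_def r_def[symmetric] scaleR_diff_right power2_eq_square power3_eq_cube)
  then show ?thesis
    unfolding sr_geodesic_eq[OF w] geo_y_def c_def[symmetric] x I1 I2 by simp
qed

text \<open>Both inequalities behind the lower bound are equalities here: over a period the planar
  projection is one full circle at constant speed, and the component of \<open>l\<close> orthogonal
  to \<open>w\<close> moves uniformly.\<close>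

lemma geodesic_minimizing_period:
  fixes a :: real and u w :: "real^'n::finite"
  assumes w: "w \<noteq> 0" and unit: "a\<^sup>2 + u \<bullet> u = 1"
  shows "length_minimizing_on 0 (2 * pi / norm w) (sr_geodesic (a, u, w))"
  unfolding length_minimizing_on_def
proof (intro exI conjI allI impI)
  define r where "r = norm w"
  define T where "T = 2 * pi / norm w"
  define c where "c = u \<bullet> w"
  show "horizontal_on 0 (2 * pi / norm w) (sr_geodesic (a, u, w)) (geo_ctrl a u w)"
    by (rule horizontal_on_geodesic[OF w])
  fix s d h v
  assume sd: "s \<le> d" and h: "horizontal_on s d h v" "h s = sr_geodesic (a, u, w) 0" "h d = sr_geodesic (a, u, w) (2 * pi / norm w)"
  have r: "r > 0" using w by (simp add: r_def)
  have T0: "T > 0" using w by (simp add: T_def)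
  \<comment> \<open>The part of \<open>u\<close> orthogonal to \<open>w\<close>. If it is zero,
    \<open>sgn uu\<close> is zero as well and only the planar estimate contributes.\<close>
  define uu where "uu = u - (c / r\<^sup>2) *\<^sub>R w"
  define k where "k = (1 / r) *\<^sub>R w"
  have ww: "w \<bullet> w = r\<^sup>2" by (simp add: r_def dot_square_norm)
  have uuw: "uu \<bullet> w = 0" using r by (simp add: uu_def inner_diff_left ww c_def)
  have k1: "norm k = 1" using r by (simp add: k_def r_def)
  have k3: "k \<bullet> sgn uu = 0" using uuw by (simp add: k_def sgn_div_norm inner_commute)
  have k2: "norm (sgn uu) \<le> 1" by (simp add: norm_sgn)
  have h0: "h s = 0" using h(2) by (simp add: sr_geodesic_eq[OF w] geo_l_def geo_y_def zero_prod_def)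
  have hd: "h d = (0, T *\<^sub>R uu, - (((2 * pi * c / r ^ 3)) *\<^sub>R u - ((pi / r) * ((a / r)\<^sup>2 + 3 * (c / r\<^sup>2)\<^sup>2)) *\<^sub>R w))"
    unfolding h(3) T_def r_def c_def uu_def by (rule geodesic_period_endpoint[OF w])
  have yk: "snd (snd (h d)) \<bullet> k = pi * ((a / r)\<^sup>2 + (c / r\<^sup>2)\<^sup>2)"
  proof -
    have "snd (snd (h d)) \<bullet> k = - ((2 * pi * c / r ^ 3) * (c / r) - ((pi / r) * ((a / r)\<^sup>2 + 3 * (c / r\<^sup>2)\<^sup>2)) * (r\<^sup>2 / r))"
      by (simp add: hd k_def ww c_def inner_diff_left diff_divide_distrib)
    also have "\<dots> = pi * ((a / r)\<^sup>2 + (c / r\<^sup>2)\<^sup>2)"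
    proof -
      have "(pi / r) * ((a / r)\<^sup>2 + 3 * (c / r\<^sup>2)\<^sup>2) * (r\<^sup>2 / r) = pi * ((a / r)\<^sup>2 + 3 * (c / r\<^sup>2)\<^sup>2)"
        using r by (simp add: power2_eq_square)
      moreover have "(2 * pi * c / r ^ 3) * (c / r) = 2 * pi * (c / r\<^sup>2)\<^sup>2"
        by (simp add: power2_eq_square power3_eq_cube)
      ultimately show ?thesis by (simp add: algebra_simps)
    qed
    finally show ?thesis .
  qed
  have lk: "fst (snd (h d)) \<bullet> sgn uu = T * norm uu"
    by (cases "uu = 0") (simp_all add: hd sgn_div_norm dot_square_norm power2_eq_square)
  have uu2: "(norm uu)\<^sup>2 = u \<bullet> u - c\<^sup>2 / r\<^sup>2"
    using r by (simp add: uu_def power2_norm_eq_inner inner_diff inner_commute[of w u] ww flip: c_def) (simp add: power2_eq_square field_simps)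
  \<comment> \<open>\<open>a\<^sup>2 + c\<^sup>2 / r\<^sup>2\<close> is the squared planar speed and
    \<open>(norm uu)\<^sup>2\<close> the squared speed across the plane; together they are
    1.\<close>
  have "T\<^sup>2 = 4 * pi * (pi * ((a / r)\<^sup>2 + (c / r\<^sup>2)\<^sup>2)) + (T * norm uu)\<^sup>2"
  proof -
    have "4 * pi * (pi * ((a / r)\<^sup>2 + (c / r\<^sup>2)\<^sup>2)) = T\<^sup>2 * (a\<^sup>2 + c\<^sup>2 / r\<^sup>2)"
    proof -
      have "T\<^sup>2 = 4 * pi * pi / r\<^sup>2" by (simp add: T_def r_def[symmetric] power_divide power_mult_distrib power2_eq_square)
      moreover have "(a / r)\<^sup>2 + (c / r\<^sup>2)\<^sup>2 = (a\<^sup>2 + c\<^sup>2 / r\<^sup>2) / r\<^sup>2"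
        by (simp add: power_divide add_divide_distrib power2_eq_square)
      ultimately show ?thesis by simp
    qed
    then have "4 * pi * (pi * ((a / r)\<^sup>2 + (c / r\<^sup>2)\<^sup>2)) + (T * norm uu)\<^sup>2 = T\<^sup>2 * (a\<^sup>2 + u \<bullet> u)"
      by (simp add: power_mult_distrib uu2 algebra_simps)
    then show ?thesis by (simp add: unit)
  qed
  also have "\<dots> \<le> (sr_length s d v)\<^sup>2"
    using horizontal_length_lower_bound[OF h(1) sd h0 _ _ k1 k2 k3] 
    by (simp add: yk lk) (simp add: hd k_def uuw)
  finally have "T\<^sup>2 \<le> (sr_length s d v)\<^sup>2" .
  moreover have "sr_length s d v \<ge> 0"
    unfolding sr_length_def using h(1)
    by (intro Henstock_Kurzweil_Integration.integral_nonneg) (auto simp: horizontal_on_def absolutely_integrable_on_def)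
  ultimately have "T \<le> sr_length s d v" by (rule power2_le_imp_le)
  moreover have "sr_length 0 T (geo_ctrl a u w) = T"
    using T0 by (simp add: sr_length_def norm_geo_ctrl[OF w unit])
  ultimately show "sr_length 0 (2 * pi / norm w) (geo_ctrl a u w) \<le> sr_length s d v"
    by (simp add: T_def)
qed

section \<open>Cut time\<close>

lemma flow_has_integrals:
  assumes "r \<noteq> 0" "0 \<le> T"
  shows "(flow_x a c r has_integral flow_I1 a c r T) {0..T}"
    and "((\<lambda>t. (flow_x a c r t)\<^sup>2) has_integral flow_I2 a c r T) {0..T}"
  using fundamental_theorem_of_calculus[OF assms(2), of "flow_I1 a c r" "flow_x a c r"]
    fundamental_theorem_of_calculus[OF assms(2), of "flow_I2 a c r" "\<lambda>t. (flow_x a c r t)\<^sup>2"]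
    flow_derivs(3,4)[OF assms(1)]
  by (simp_all add: has_real_derivative_iff_has_vector_derivative)

text \<open>Zero variance would make \<open>x\<close> constant, hence zero; the oscillator equation
  then forces \<open>c = 0\<close>, and finally \<open>a = 0\<close>. That is the case of a straight
  line, which \<open>ac\<close> excludes.\<close>

lemma flow_variance_pos:
  assumes r: "r \<noteq> 0" and T: "0 < T" and ac: "a \<noteq> 0 \<or> c \<noteq> 0"
  shows "(flow_I1 a c r T)\<^sup>2 / T < flow_I2 a c r T"
proof -
  define m where "m = flow_I1 a c r T / T"
  note I = flow_has_integrals[OF r less_imp_le[OF T], of a c]
  have sq: "(flow_x a c r t - m)\<^sup>2 = (flow_x a c r t)\<^sup>2 - 2 * m * flow_x a c r t + m\<^sup>2" for t
    by (simp add: power2_eq_square algebra_simps)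
  have c1: "((\<lambda>t. m\<^sup>2) has_integral T * m\<^sup>2) {0..T}" using has_integral_const_real[of "m\<^sup>2" 0 T] T by simp
  have "((\<lambda>t. (flow_x a c r t - m)\<^sup>2) has_integral (flow_I2 a c r T - 2 * m * flow_I1 a c r T + T * m\<^sup>2)) {0..T}"
    unfolding sq by (intro has_integral_add has_integral_diff has_integral_mult_right I c1)
  also have "flow_I2 a c r T - 2 * m * flow_I1 a c r T + T * m\<^sup>2 = flow_I2 a c r T - (flow_I1 a c r T)\<^sup>2 / T"
    using T by (simp add: m_def power2_eq_square field_simps)
  finally have J: "((\<lambda>t. (flow_x a c r t - m)\<^sup>2) has_integral (flow_I2 a c r T - (flow_I1 a c r T)\<^sup>2 / T)) {0..T}" .
  have "flow_I2 a c r T - (flow_I1 a c r T)\<^sup>2 / T \<noteq> 0"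
  proof
    assume 0: "flow_I2 a c r T - (flow_I1 a c r T)\<^sup>2 / T = 0"
    have "\<forall>t\<in>{0..T}. (flow_x a c r t - m)\<^sup>2 = 0"
      using integral_eq_0_iff[of 0 T "\<lambda>t. (flow_x a c r t - m)\<^sup>2"] T J 0 flow_continuous[OF r]
      by (simp add: integral_unique continuous_intros)
    then have xm: "flow_x a c r t = m" if "t \<in> {0..T}" for t using that by auto
    have v0: "flow_v a c r t = 0" if "t \<in> {0<..<T}" for t
    proof (rule DERIV_unique)
      show "(flow_x a c r has_real_derivative flow_v a c r t) (at t)" by (rule flow_derivs[OF r])
      show "(flow_x a c r has_real_derivative 0) (at t)"
      proof (rule has_field_derivative_transform_within_open[of "\<lambda>_. m"])
        show "open {0<..<T}" by simp
      qed (use that xm in auto)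
    qed
    have "c - r\<^sup>2 * flow_x a c r (T / 2) = 0"
    proof (rule DERIV_unique)
      show "(flow_v a c r has_real_derivative c - r\<^sup>2 * flow_x a c r (T / 2)) (at (T / 2))" by (rule flow_derivs[OF r])
      show "(flow_v a c r has_real_derivative 0) (at (T / 2))"
      proof (rule has_field_derivative_transform_within_open[of "\<lambda>_. 0"])
        show "open {0<..<T}" by simp
      qed (use T v0 in auto)
    qed
    moreover have "flow_x a c r (T / 2) = 0" using xm[of 0] xm[of "T / 2"] T by simp
    ultimately have c0: "c = 0" by simp
    have "a * cos (r * (T / 2)) = 0" using v0[of "T / 2"] T c0 by (simp add: flow_v_def)
    moreover have "a * sin (r * (T / 2)) = 0" using \<open>flow_x a c r (T / 2) = 0\<close> c0 r by (simp add: flow_x_def)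
    ultimately have "a = 0" by (metis mult_eq_0_iff sin_zero_abs_cos_one abs_zero zero_neq_one)
    then show False using c0 ac by simp
  qed
  moreover have "0 \<le> flow_I2 a c r T - (flow_I1 a c r T)\<^sup>2 / T"
    using J by (rule Henstock_Kurzweil_Integration.has_integral_nonneg) simp
  ultimately show ?thesis by linarith
qed

section \<open>The length of an arbitrary control of the geodesic\<close>

lemma quadratic_remainder_bound:
  fixes f f' f'' :: "real \<Rightarrow> 'a::real_normed_vector"
  assumes f: "\<And>s. (f has_vector_derivative f' s) (at s)"
    and f': "\<And>s. (f' has_vector_derivative f'' s) (at s)"
    and C: "\<And>s. norm (f'' s) \<le> C" and t: "t \<le> t'"
  shows "norm (f t' - f t - (t' - t) *\<^sub>R f' t) \<le> C * (t' - t)\<^sup>2"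
proof -
  have bound: "norm (g x - g y) \<le> B * norm (x - y)"
    if "\<And>s. (g has_vector_derivative g' s) (at s)" "\<And>s. s \<in> {t..t'} \<Longrightarrow> norm (g' s) \<le> B" "x \<in> {t..t'}" "y \<in> {t..t'}"
    for g g' :: "real \<Rightarrow> 'a" and B x y
  proof (rule differentiable_bound[where S="{t..t'}" and f'="\<lambda>s h. h *\<^sub>R g' s"])
    fix s assume s: "s \<in> {t..t'}"
    show "(g has_derivative (\<lambda>h. h *\<^sub>R g' s)) (at s within {t..t'})"
      using that(1)[of s] has_derivative_at_withinI unfolding has_vector_derivative_def by blast
    show "onorm (\<lambda>h. h *\<^sub>R g' s) \<le> B"
      using mult_left_mono[OF that(2)[OF s] abs_ge_zero] by (intro onorm_le) (simp add: mult.commute[of B])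
  qed (use that in auto)
  have C0: "C \<ge> 0" using C[of t] norm_ge_zero order_trans by blast
  have lip: "norm (f' s - f' t) \<le> C * (t' - t)" if "s \<in> {t..t'}" for s
  proof -
    have "norm (f' s - f' t) \<le> C * norm (s - t)" by (rule bound[OF f']) (use C t that in auto)
    also have "\<dots> \<le> C * (t' - t)" using C0 that by (intro mult_left_mono) auto
    finally show ?thesis .
  qed
  have "norm ((f t' - (t' - t) *\<^sub>R f' t) - (f t - (t - t) *\<^sub>R f' t)) \<le> (C * (t' - t)) * norm (t' - t)"
  proof (rule bound[where g="\<lambda>s. f s - (s - t) *\<^sub>R f' t" and g'="\<lambda>s. f' s - f' t"])
    show "((\<lambda>s. f s - (s - t) *\<^sub>R f' t) has_vector_derivative f' s - f' t) (at s)" for s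
      by (auto intro!: derivative_eq_intros f)
  qed (use lip t in auto)
  then show ?thesis using t by (simp add: power2_eq_square algebra_simps)
qed

text \<open>Minimality may be witnessed by a control other than \<open>geo_ctrl\<close>. Its length
  dominates the chords of the projection to \<open>(x, l)\<close>, and since that projection has
  unit speed, the chord over a short time equals this time up to a quadratic error. Refinement then
  avoids any argument about derivatives almost everywhere.\<close>

lemma horizontal_length_ge_time:
  fixes a :: real and u w :: "real^'n::finite"
  assumes w: "w \<noteq> 0" and unit: "a\<^sup>2 + u \<bullet> u = 1" and "0 \<le> T"
    and hor: "horizontal_on 0 T (sr_geodesic (a, u, w)) \<nu>"
  shows "T \<le> sr_length 0 T \<nu>"
proof -
  define ctrl where "ctrl = geo_ctrl a u w"
  define P where "P = (\<lambda>t. (flow_x a (u \<bullet> w) (norm w) t, geo_l a u w t))"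
  \<comment> \<open>The acceleration of \<open>(x, l)\<close> has two components, and at unit speed
    each is bounded by \<open>norm w\<close>.\<close>
  define C where "C = 2 * norm w"
  have r: "norm w \<noteq> 0" using w by simp
  have nu: "\<nu> absolutely_integrable_on {0..T}" using hor by (simp add: horizontal_on_def)
  have ni: "(\<lambda>s. norm (\<nu> s)) integrable_on {0..T}" using nu by (simp add: absolutely_integrable_on_def)
  have Pd: "(P has_vector_derivative ctrl t) (at t within S)" for t S
    unfolding P_def ctrl_def geo_ctrl_def using flow_derivs(1)[OF r] geo_derivs(1)[OF w]
    by (intro has_vector_derivative_Pair) (auto simp: has_real_derivative_iff_has_vector_derivative)
  have nc: "norm (ctrl t) = 1" for t unfolding ctrl_def by (rule norm_geo_ctrl[OF w unit])
  have cd: "(ctrl has_vector_derivative (u \<bullet> w - (norm w)\<^sup>2 * flow_x a (u \<bullet> w) (norm w) t, - flow_v a (u \<bullet> w) (norm w) t *\<^sub>R w)) (at t within S)" for t S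
    unfolding ctrl_def geo_ctrl_def
    by (intro has_vector_derivative_Pair)
       (auto intro!: derivative_eq_intros flow_derivs[OF r] simp: has_real_derivative_iff_has_vector_derivative[symmetric])
  have cdn: "norm (u \<bullet> w - (norm w)\<^sup>2 * flow_x a (u \<bullet> w) (norm w) t, - flow_v a (u \<bullet> w) (norm w) t *\<^sub>R w) \<le> C" for t
  proof -
    let ?x = "flow_x a (u \<bullet> w) (norm w) t"
    have "\<bar>flow_v a (u \<bullet> w) (norm w) t\<bar> \<le> 1" "norm (u - ?x *\<^sub>R w) \<le> 1"
      using nc[of t] norm_fst_le[of "flow_v a (u \<bullet> w) (norm w) t" "u - ?x *\<^sub>R w"] norm_snd_le[of "u - ?x *\<^sub>R w" "flow_v a (u \<bullet> w) (norm w) t"]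
      by (auto simp: ctrl_def geo_ctrl_def)
    note b = this
    have "u \<bullet> w - (norm w)\<^sup>2 * ?x = (u - ?x *\<^sub>R w) \<bullet> w"
      by (simp add: inner_diff_left dot_square_norm)
    then have "\<bar>u \<bullet> w - (norm w)\<^sup>2 * ?x\<bar> \<le> norm (u - ?x *\<^sub>R w) * norm w"
      using Cauchy_Schwarz_ineq2[of "u - ?x *\<^sub>R w" w] by simp
    also have "\<dots> \<le> 1 * norm w" using b(2) by (rule mult_right_mono) simp
    finally have "\<bar>u \<bullet> w - (norm w)\<^sup>2 * ?x\<bar> \<le> norm w" by simp
    moreover have "\<bar>flow_v a (u \<bullet> w) (norm w) t\<bar> * norm w \<le> 1 * norm w" using b(1) by (rule mult_right_mono) simp
    ultimately have "\<bar>u \<bullet> w - (norm w)\<^sup>2 * ?x\<bar> \<le> norm w" "\<bar>flow_v a (u \<bullet> w) (norm w) t\<bar> * norm w \<le> norm w" by simp_all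
    then show ?thesis
      using norm_Pair_le[of "u \<bullet> w - (norm w)\<^sup>2 * ?x" "- flow_v a (u \<bullet> w) (norm w) t *\<^sub>R w"] by (simp add: C_def)
  qed
  have quad: "norm (P t' - P t - (t' - t) *\<^sub>R ctrl t) \<le> C * (t' - t)\<^sup>2" if "t \<le> t'" for t t'
    by (rule quadratic_remainder_bound[OF Pd cd cdn that])
  define f where "f = (\<lambda>t. integral {0..t} (\<lambda>s. norm (\<nu> s)) - t)"
  have "f 0 \<le> f T"
  proof (rule quadratic_decrease_imp_le[where f=f and s="\<lambda>t. t" and C=C and a=0 and b=T])
    fix t t' assume t: "0 \<le> t" "t \<le> t'" "t' \<le> T"
    have in0: "(\<nu> has_integral P s) {0..s}" if "s \<in> {0..T}" for s
    proof -
      have h: "((\<lambda>s. hor (sr_geodesic (a, u, w) s) (\<nu> s)) has_integral sr_geodesic (a, u, w) s - sr_geodesic (a, u, w) 0) {0..s}"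
        using hor that by (auto simp: horizontal_on_def)
      have bl: "bounded_linear (\<lambda>q :: 'n path_group. (fst q, fst (snd q)))" by (intro bounded_linear_intros)
      have "fst (hor q v) = fst v" "fst (snd (hor q v)) = snd v" for q :: "'n path_group" and v
        using hor_eq[of "fst q" "fst (snd q)" "snd (snd q)" "fst v" "snd v"] by simp_all
      then show ?thesis
        using has_integral_linear[OF h bl] by (simp add: o_def P_def sr_geodesic_eq[OF w] geo_l_def)
    qed
    have "integral {t..t'} \<nu> = P t' - P t"
      using integral_interval_diff[OF set_lebesgue_integral_eq_integral(1)[OF nu] t] in0[of t] in0[of t'] t
      by (simp add: integral_unique)
    then have "norm (P t' - P t) \<le> integral {t..t'} (\<lambda>s. norm (\<nu> s))"
      using norm_integral_le[OF absolutely_integrable_on_subinterval[OF nu], of t t'] t by auto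
    moreover have "norm ((t' - t) *\<^sub>R ctrl t) = t' - t" using t nc[of t] by simp
    ultimately have "(t' - t) - integral {t..t'} (\<lambda>s. norm (\<nu> s)) \<le> C * (t' - t)\<^sup>2"
      using quad[OF t(2)] norm_triangle_ineq2[of "(t' - t) *\<^sub>R ctrl t" "P t' - P t"] by (simp add: norm_minus_commute)
    then show "f t - f t' \<le> C * (t' - t)\<^sup>2"
      unfolding f_def using integral_interval_diff[OF ni t] by simp
  qed (use \<open>0 \<le> T\<close> in auto)
  then show ?thesis by (simp add: f_def sr_length_def)
qed

text \<open>The energy balance of the perturbed curve: $V$ is the variance of $x$, $p = \int x\sin(\mu t)$, and
  the first condition is that the perturbed variance is positive.\<close>

lemma variance_perturbation:
  fixes p r V T \<mu> :: real
  assumes "V > 0" "T > 0" "0 < \<mu>" "\<mu> < r"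
  obtains \<epsilon> where "V + 2 * \<epsilon> * p + \<epsilon>\<^sup>2 * T / 2 > 0"
    "2 * \<epsilon> * r\<^sup>2 * p + \<epsilon>\<^sup>2 * \<mu>\<^sup>2 * T / 2 + r\<^sup>2 * (V\<^sup>2 / (V + 2 * \<epsilon> * p + \<epsilon>\<^sup>2 * T / 2) - V) < 0"
proof -
  have mr: "\<mu>\<^sup>2 < r\<^sup>2" using assms by (intro power_strict_mono) auto
  show ?thesis
  proof (cases "p = 0")
    case False
    \<comment> \<open>The nonzero root of
      \<open>2 * \<epsilon> * p + \<epsilon>\<^sup>2 * T / 2 = 0\<close>. As the sine has squared
      norm \<open>T / 2\<close>, this reflects \<open>x\<close> in the orthogonal complement of the
      sine. The variance is kept, and the energy changes by
      \<open>\<epsilon>\<^sup>2 * T / 2\<close> times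
      \<open>\<mu>\<^sup>2 - r\<^sup>2\<close>.\<close>
    define \<epsilon> where "\<epsilon> = - 4 * p / T"
    have e: "2 * \<epsilon> * p + \<epsilon>\<^sup>2 * T / 2 = 0"
      using assms by (simp add: \<epsilon>_def power2_eq_square field_simps)
    then have Vt: "V + 2 * \<epsilon> * p + \<epsilon>\<^sup>2 * T / 2 = V" by linarith
    have "2 * \<epsilon> * r\<^sup>2 * p + \<epsilon>\<^sup>2 * \<mu>\<^sup>2 * T / 2 = (\<epsilon>\<^sup>2 * T / 2) * (\<mu>\<^sup>2 - r\<^sup>2)"
    proof -
      have "2 * \<epsilon> * p = - (\<epsilon>\<^sup>2 * T / 2)" using e by linarith
      then have "(2 * \<epsilon> * p) * r\<^sup>2 = - (\<epsilon>\<^sup>2 * T / 2) * r\<^sup>2" by simp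
      then show ?thesis by (simp add: algebra_simps)
    qed
    also have "\<dots> < 0" using mr assms False by (intro mult_pos_neg) (auto simp: \<epsilon>_def)
    finally have "2 * \<epsilon> * r\<^sup>2 * p + \<epsilon>\<^sup>2 * \<mu>\<^sup>2 * T / 2 < 0" .
    moreover have "r\<^sup>2 * (V\<^sup>2 / V - V) = 0" using assms by (simp add: power2_eq_square)
    ultimately show ?thesis using assms by (intro that[of \<epsilon>]; unfold Vt) linarith+
  next
    case True
    \<comment> \<open>For \<open>p = 0\<close> and \<open>e > 0\<close> the balance is
      \<open>e * (\<mu>\<^sup>2 - r\<^sup>2 * V / (V + e))\<close>, which is negative exactly for
      \<open>e\<close> below \<open>V * (r\<^sup>2 - \<mu>\<^sup>2) / \<mu>\<^sup>2\<close>; half of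
      that bound is taken.\<close>
    define e where "e = V * (r\<^sup>2 - \<mu>\<^sup>2) / (2 * \<mu>\<^sup>2)"
    have e0: "e > 0" using assms mr by (simp add: e_def)
    define \<epsilon> where "\<epsilon> = sqrt (2 * e / T)"
    have ee: "\<epsilon>\<^sup>2 * T / 2 = e" using e0 assms by (simp add: \<epsilon>_def)
    have "\<mu>\<^sup>2 * (V + e) < r\<^sup>2 * V"
    proof -
      have "\<mu>\<^sup>2 * e = V * (r\<^sup>2 - \<mu>\<^sup>2) / 2" using assms by (simp add: e_def)
      moreover have "V * (r\<^sup>2 - \<mu>\<^sup>2) / 2 < V * (r\<^sup>2 - \<mu>\<^sup>2)" using assms mr by simp
      ultimately have "\<mu>\<^sup>2 * e < V * (r\<^sup>2 - \<mu>\<^sup>2)" by linarith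
      then show ?thesis by (simp add: algebra_simps)
    qed
    then have "e * (\<mu>\<^sup>2 * (V + e)) < e * (r\<^sup>2 * V)" using e0 by (rule mult_strict_left_mono)
    then have "e * \<mu>\<^sup>2 + r\<^sup>2 * (V\<^sup>2 / (V + e) - V) < 0"
      using assms e0 by (simp add: field_simps power2_eq_square)
    moreover have "\<epsilon>\<^sup>2 * \<mu>\<^sup>2 * T / 2 = e * \<mu>\<^sup>2" using ee by (simp add: algebra_simps)
    moreover have z: "2 * \<epsilon> * r\<^sup>2 * p = 0" using True by simp
    ultimately have g2: "2 * \<epsilon> * r\<^sup>2 * p + \<epsilon>\<^sup>2 * \<mu>\<^sup>2 * T / 2 + r\<^sup>2 * (V\<^sup>2 / (V + e) - V) < 0" by linarith
    have Vt: "V + 2 * \<epsilon> * p + \<epsilon>\<^sup>2 * T / 2 = V + e" using ee True by simp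
    have g1: "V + e > 0" using assms e0 by simp
    show ?thesis by (rule that[of \<epsilon>]; unfold Vt; fact)
  qed
qed

text \<open>For a given \<open>x\<close>, the end point sees the control \<open>b\<close> only
  through its integral and its integral against \<open>x\<close>. These two vector conditions are
  all that a competitor has to meet besides the value \<open>x T\<close>.\<close>

lemma horizontal_curve_ex:
  fixes b :: "real \<Rightarrow> real^'n::finite"
  assumes T: "0 \<le> T" and x: "\<And>t. (x has_real_derivative v t) (at t)" "x 0 = 0"
    and v: "continuous_on {0..T} v" and b: "continuous_on {0..T} b"
  obtains h where "horizontal_on 0 T h (\<lambda>t. (v t, b t))" "h 0 = 0"
    "h T = (x T, integral {0..T} b, (x T / 2) *\<^sub>R integral {0..T} b - integral {0..T} (\<lambda>t. x t *\<^sub>R b t))"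
proof -
  define l where "l = (\<lambda>t. integral {0..t} b)"
  define z where "z = (\<lambda>t. integral {0..t} (\<lambda>s. x s *\<^sub>R b s))"
  have xc: "continuous_on S x" for S using x(1) DERIV_continuous_on has_field_derivative_at_within by blast
  have ld: "(l has_vector_derivative b t) (at t within {0..T})" if "t \<in> {0..T}" for t
    unfolding l_def using integral_has_vector_derivative[OF b that] .
  have zd: "(z has_vector_derivative x t *\<^sub>R b t) (at t within {0..T})" if "t \<in> {0..T}" for t
    unfolding z_def using that by (intro integral_has_vector_derivative continuous_intros xc b)
  have yd: "((\<lambda>t. (x t / 2) *\<^sub>R l t - z t) has_vector_derivative (1/2) *\<^sub>R (v t *\<^sub>R l t - x t *\<^sub>R b t)) (at t within {0..T})"
    if "t \<in> {0..T}" for t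
    using ld[OF that] zd[OF that] has_field_derivative_at_within[OF x(1)]
    by (auto intro!: derivative_eq_intros simp: vec_eq_iff field_simps)
  show ?thesis
  proof (rule that[of "\<lambda>t. (x t, l t, (x t / 2) *\<^sub>R l t - z t)"])
    show "horizontal_on 0 T (\<lambda>t. (x t, l t, (x t / 2) *\<^sub>R l t - z t)) (\<lambda>t. (v t, b t))"
      using ld yd v b has_field_derivative_at_within[OF x(1)] by (intro horizontal_on_C1) auto
  qed (simp_all add: x l_def z_def zero_prod_def)
qed

lemma shorter_curve_after_period:
  fixes a :: real and u w :: "real^'n::finite"
  assumes w: "w \<noteq> 0" and unit: "a\<^sup>2 + u \<bullet> u = 1" and nz: "a \<noteq> 0 \<or> u \<bullet> w \<noteq> 0"
    and T: "2 * pi / norm w < T"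
  obtains h \<nu> where "horizontal_on 0 T h \<nu>" "h 0 = 0" "h T = sr_geodesic (a, u, w) T" "sr_length 0 T \<nu> < T"
proof -
  define r where "r = norm w"
  define c where "c = u \<bullet> w"
  \<comment> \<open>One full oscillation over \<open>{0..T}\<close>: the sine vanishes at both ends
    and has mean zero, so adding it to \<open>x\<close> preserves \<open>x T\<close> and
    \<open>I1\<close>. Its frequency is below \<open>r\<close> precisely because \<open>T\<close>
    exceeds the period.\<close>
  define \<mu> where "\<mu> = 2 * pi / T"
  have r0: "r > 0" using w by (simp add: r_def)
  have rn: "r \<noteq> 0" using r0 by simp
  have T0: "T > 0" using T r0 by (metis divide_pos_pos less_trans mult_pos_pos pi_gt_zero r_def zero_less_numeral)
  have Tn: "0 \<le> T" using T0 by simp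
  have mu: "0 < \<mu>" "\<mu> < r" using T T0 r0 by (auto simp: \<mu>_def r_def field_simps)
  have muT: "\<mu> * T = 2 * pi" using T0 by (simp add: \<mu>_def)
  define x where "x = flow_x a c r"
  define v where "v = flow_v a c r"
  define I1 where "I1 = flow_I1 a c r T"
  define I2 where "I2 = flow_I2 a c r T"
  define m where "m = I1 / T"
  define V where "V = I2 - I1\<^sup>2 / T"
  have V0: "V > 0" using flow_variance_pos[OF rn T0, of a c] nz by (simp add: V_def I1_def I2_def c_def)
  have xd: "(x has_real_derivative v t) (at t)" "(v has_real_derivative c - r\<^sup>2 * x t) (at t)" for t
    unfolding x_def v_def by (rule flow_derivs[OF rn])+
  have cont: "continuous_on S x" "continuous_on S v" for S unfolding x_def v_def by (rule flow_continuous[OF rn])+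
  have ww: "w \<bullet> w = r\<^sup>2" by (simp add: r_def dot_square_norm)
  have xi: "(x has_integral I1) {0..T}" "((\<lambda>t. (x t)\<^sup>2) has_integral I2) {0..T}"
    unfolding x_def I1_def I2_def by (rule flow_has_integrals[OF rn Tn])+
  have ftc: "(f' has_integral f T - f 0) {0..T}" if "\<And>t. (f has_real_derivative f' t) (at t)" for f f' :: "real \<Rightarrow> real"
    using that T0 by (intro fundamental_theorem_of_calculus)
      (auto simp: has_real_derivative_iff_has_vector_derivative[symmetric] intro: has_field_derivative_at_within)
  have const: "((\<lambda>t. k) has_integral T * k) {0..T}" for k :: real
    using has_integral_const_real[of k 0 T] T0 by simp
  have s1: "((\<lambda>t. sin (\<mu> * t)) has_integral 0) {0..T}"
  proof -
    have "((\<lambda>t. sin (\<mu> * t)) has_integral (- cos (\<mu> * T) / \<mu>) - (- cos (\<mu> * 0) / \<mu>)) {0..T}"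
      by (rule ftc) (use mu in \<open>auto intro!: derivative_eq_intros\<close>)
    then show ?thesis by (simp add: muT)
  qed
  have s2: "((\<lambda>t. (sin (\<mu> * t))\<^sup>2) has_integral T / 2) {0..T}"
  proof -
    have sc: "sin y * sin y = 1 - cos y * cos y" for y :: real
      using sin_squared_eq[of y] by (simp only: power2_eq_square)
    have "((\<lambda>t. (sin (\<mu> * t))\<^sup>2) has_integral (T / 2 - sin (\<mu> * T) * cos (\<mu> * T) / (2 * \<mu>)) - (0 / 2 - sin (\<mu> * 0) * cos (\<mu> * 0) / (2 * \<mu>))) {0..T}"
      by (rule ftc) (use mu in \<open>auto intro!: derivative_eq_intros simp: field_simps power2_eq_square sc\<close>)
    then show ?thesis by (simp add: muT)
  qed
  have c2: "((\<lambda>t. (cos (\<mu> * t))\<^sup>2) has_integral T / 2) {0..T}"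
    using has_integral_diff[OF const[of 1] s2] by (simp add: cos_squared_eq)
  define p where "p = integral {0..T} (\<lambda>t. x t * sin (\<mu> * t))"
  have xs: "((\<lambda>t. x t * sin (\<mu> * t)) has_integral p) {0..T}"
    unfolding p_def by (intro integrable_integral integrable_continuous_real continuous_intros cont)
  \<comment> \<open>By parts with \<open>v' = c - r\<^sup>2 x\<close>. The sine vanishes at the ends
    and has integral zero, so the cross term of the energy is governed by the same \<open>p\<close>
    as that of the variance.\<close>
  have vc: "((\<lambda>t. \<mu> * (v t * cos (\<mu> * t))) has_integral r\<^sup>2 * p) {0..T}"
  proof -
    have "((\<lambda>t. (c - r\<^sup>2 * x t) * sin (\<mu> * t) + v t * (\<mu> * cos (\<mu> * t))) has_integral v T * sin (\<mu> * T) - v 0 * sin (\<mu> * 0)) {0..T}"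
      by (intro ftc) (auto intro!: derivative_eq_intros xd)
    then have "((\<lambda>t. (c - r\<^sup>2 * x t) * sin (\<mu> * t) + v t * (\<mu> * cos (\<mu> * t))) has_integral 0) {0..T}"
      by (simp add: muT)
    from has_integral_diff[OF this has_integral_diff[OF has_integral_mult_right[OF s1, of c] has_integral_mult_right[OF xs, of "r\<^sup>2"]]]
    show ?thesis by (simp add: algebra_simps)
  qed
  define E where "E = integral {0..T} (\<lambda>t. (v t)\<^sup>2)"
  have vi: "((\<lambda>t. (v t)\<^sup>2) has_integral E) {0..T}"
    unfolding E_def by (intro integrable_integral integrable_continuous_real continuous_intros cont)
  obtain \<epsilon> where eps: "V + 2 * \<epsilon> * p + \<epsilon>\<^sup>2 * T / 2 > 0"
    "2 * \<epsilon> * r\<^sup>2 * p + \<epsilon>\<^sup>2 * \<mu>\<^sup>2 * T / 2 + r\<^sup>2 * (V\<^sup>2 / (V + 2 * \<epsilon> * p + \<epsilon>\<^sup>2 * T / 2) - V) < 0"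
    by (rule variance_perturbation[OF V0 T0 mu])
  define W where "W = V + 2 * \<epsilon> * p + \<epsilon>\<^sup>2 * T / 2"
  define x' where "x' = (\<lambda>t. x t + \<epsilon> * sin (\<mu> * t))"
  define v' where "v' = (\<lambda>t. v t + \<epsilon> * (\<mu> * cos (\<mu> * t)))"
  define lb where "lb = u - m *\<^sub>R w"
  \<comment> \<open>Among all controls with prescribed integral and prescribed integral against
    \<open>y\<close>, the one affine in \<open>y\<close> has the least energy. If \<open>y\<close>
    has mean \<open>m\<close>, the fluctuation integrates to zero and the end point of
    \<open>l\<close> is right for every \<open>\<kappa>\<close>; the other condition becomes
    \<open>\<kappa> * Q = V\<close> with \<open>Q\<close> the integral of the squared fluctuation,
    which explains \<open>V / W\<close> below. The geodesic itself is \<open>\<kappa> = 1\<close>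
    and \<open>y = x\<close>.\<close>
  define b where "b = (\<lambda>(\<kappa>::real) (y :: real \<Rightarrow> real) t. lb - (\<kappa> * (y t - m)) *\<^sub>R w)"
  have W0: "W > 0" using eps by (simp add: W_def)
  have x'i: "(x' has_integral I1) {0..T}"
    unfolding x'_def using has_integral_add[OF xi(1) has_integral_mult_right[OF s1, of \<epsilon>]] by simp
  have x'i2: "((\<lambda>t. (x' t)\<^sup>2) has_integral W + I1\<^sup>2 / T) {0..T}"
  proof -
    have "((\<lambda>t. (x t)\<^sup>2 + 2 * \<epsilon> * (x t * sin (\<mu> * t)) + \<epsilon>\<^sup>2 * (sin (\<mu> * t))\<^sup>2) has_integral I2 + 2 * \<epsilon> * p + \<epsilon>\<^sup>2 * (T / 2)) {0..T}"
      by (intro has_integral_add has_integral_mult_right xi xs s2)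
    moreover have "I2 + 2 * \<epsilon> * p + \<epsilon>\<^sup>2 * (T / 2) = W + I1\<^sup>2 / T" by (simp add: W_def V_def)
    ultimately show ?thesis by (simp add: x'_def power2_eq_square algebra_simps)
  qed
  have v'i: "((\<lambda>t. (v' t)\<^sup>2) has_integral E + 2 * \<epsilon> * (r\<^sup>2 * p) + \<epsilon>\<^sup>2 * \<mu>\<^sup>2 * (T / 2)) {0..T}"
  proof -
    have "((\<lambda>t. (v t)\<^sup>2 + 2 * \<epsilon> * (\<mu> * (v t * cos (\<mu> * t))) + \<epsilon>\<^sup>2 * \<mu>\<^sup>2 * (cos (\<mu> * t))\<^sup>2) has_integral E + 2 * \<epsilon> * (r\<^sup>2 * p) + \<epsilon>\<^sup>2 * \<mu>\<^sup>2 * (T / 2)) {0..T}"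
      by (intro has_integral_add has_integral_mult_right vi vc c2)
    then show ?thesis by (simp add: v'_def power2_eq_square algebra_simps)
  qed
  have mT: "T * m = I1" using T0 by (simp add: m_def)
  have mI: "m * I1 = I1\<^sup>2 / T" by (simp add: m_def power2_eq_square)
  have mT2: "T * m\<^sup>2 = I1\<^sup>2 / T" using mT mI by (metis mult.assoc mult.commute power2_eq_square)
  have constv: "((\<lambda>t. k) has_integral T *\<^sub>R k) {0..T}" for k :: "real^'n"
    using has_integral_const_real[of k 0 T] T0 by simp
  have moments: "(b \<kappa> y has_integral T *\<^sub>R lb) {0..T}"
    "((\<lambda>t. y t *\<^sub>R b \<kappa> y t) has_integral I1 *\<^sub>R lb - (\<kappa> * Q) *\<^sub>R w) {0..T}"
    "((\<lambda>t. b \<kappa> y t \<bullet> b \<kappa> y t) has_integral T * (lb \<bullet> lb) + \<kappa>\<^sup>2 * r\<^sup>2 * Q) {0..T}"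
    if y: "(y has_integral I1) {0..T}" "((\<lambda>t. (y t)\<^sup>2) has_integral Q + I1\<^sup>2 / T) {0..T}" for \<kappa> y Q
  proof -
    have y0: "((\<lambda>t. y t - m) has_integral 0) {0..T}"
      using has_integral_diff[OF y(1) const[of m]] mT by simp
    have y1: "((\<lambda>t. y t * (y t - m)) has_integral Q) {0..T}"
      using has_integral_diff[OF y(2) has_integral_mult_right[OF y(1), of m]] mI by (simp add: power2_eq_square algebra_simps)
    have y2: "((\<lambda>t. (y t - m) * (y t - m)) has_integral Q) {0..T}"
      using has_integral_diff[OF y1 has_integral_mult_right[OF y0, of m]] by (simp add: algebra_simps)
    show "(b \<kappa> y has_integral T *\<^sub>R lb) {0..T}"
      using has_integral_diff[OF constv[of lb] has_integral_scaleR_left[OF has_integral_mult_right[OF y0, of \<kappa>], of w]]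
      by (simp add: b_def)
    show "((\<lambda>t. y t *\<^sub>R b \<kappa> y t) has_integral I1 *\<^sub>R lb - (\<kappa> * Q) *\<^sub>R w) {0..T}"
      using has_integral_diff[OF has_integral_scaleR_left[OF y(1), of lb] has_integral_scaleR_left[OF has_integral_mult_right[OF y1, of \<kappa>], of w]]
      by (simp add: b_def scaleR_diff_right mult.left_commute)
    have "b \<kappa> y t \<bullet> b \<kappa> y t = lb \<bullet> lb - (2 * \<kappa> * (lb \<bullet> w)) * (y t - m) + (\<kappa>\<^sup>2 * r\<^sup>2) * ((y t - m) * (y t - m))" for t
      by (simp add: b_def inner_diff inner_commute[of w lb] ww power2_eq_square algebra_simps)
    then show "((\<lambda>t. b \<kappa> y t \<bullet> b \<kappa> y t) has_integral T * (lb \<bullet> lb) + \<kappa>\<^sup>2 * r\<^sup>2 * Q) {0..T}"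
      using has_integral_add[OF has_integral_diff[OF const[of "lb \<bullet> lb"] has_integral_mult_right[OF y0, of "2 * \<kappa> * (lb \<bullet> w)"]] has_integral_mult_right[OF y2, of "\<kappa>\<^sup>2 * r\<^sup>2"]]
      by simp
  qed
  have xi2: "((\<lambda>t. (x t)\<^sup>2) has_integral V + I1\<^sup>2 / T) {0..T}" using xi(2) by (simp add: V_def)
  have bx: "b 1 x t = u - x t *\<^sub>R w" for t
    by (simp add: b_def lb_def algebra_simps)
  have ET: "E + (T * (lb \<bullet> lb) + r\<^sup>2 * V) = T"
  proof -
    have "((\<lambda>t. (v t)\<^sup>2 + b 1 x t \<bullet> b 1 x t) has_integral E + (T * (lb \<bullet> lb) + 1\<^sup>2 * r\<^sup>2 * V)) {0..T}"
      by (intro has_integral_add vi moments(3)[OF xi(1) xi2])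
    moreover have "(v t)\<^sup>2 + b 1 x t \<bullet> b 1 x t = 1" for t
      using geo_ctrl_energy[OF w, of a u t] unit unfolding bx by (simp add: v_def x_def c_def r_def)
    ultimately have "((\<lambda>t::real. 1) has_integral E + (T * (lb \<bullet> lb) + 1\<^sup>2 * r\<^sup>2 * V)) {0..T}" by simp
    from has_integral_unique[OF this const[of 1]] show ?thesis by simp
  qed
  have bcont: "continuous_on {0..T} (b \<kappa> y)" if "continuous_on {0..T} y" for \<kappa> y
    unfolding b_def by (intro continuous_intros that)
  have x'd: "(x' has_real_derivative v' t) (at t)" for t
    unfolding x'_def v'_def by (auto intro!: derivative_eq_intros xd)
  have x'c: "continuous_on {0..T} x'" "continuous_on {0..T} v'"
    unfolding x'_def v'_def by (intro continuous_intros cont)+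
  have x'0: "x' 0 = 0" by (simp add: x'_def x_def)
  obtain h where h: "horizontal_on 0 T h (\<lambda>t. (v' t, b (V / W) x' t))" "h 0 = 0"
    "h T = (x' T, integral {0..T} (b (V / W) x'), (x' T / 2) *\<^sub>R integral {0..T} (b (V / W) x') - integral {0..T} (\<lambda>t. x' t *\<^sub>R b (V / W) x' t))"
    by (rule horizontal_curve_ex[OF Tn x'd x'0 x'c(2) bcont[OF x'c(1)]])
  have lT: "T *\<^sub>R lb = geo_l a u w T"
    by (simp add: geo_l_def lb_def scaleR_diff_right mT I1_def r_def c_def)
  have zT: "I1 *\<^sub>R lb - V *\<^sub>R w = I1 *\<^sub>R u - I2 *\<^sub>R w"
    by (simp add: lb_def V_def mI[symmetric] algebra_simps)
  have "h T = sr_geodesic (a, u, w) T"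
    unfolding h(3) integral_unique[OF moments(1)[OF x'i x'i2]] integral_unique[OF moments(2)[OF x'i x'i2]]
      sr_geodesic_eq[OF w] geo_y_def
    using W0 by (simp add: lT zT x'_def muT) (simp add: x_def c_def r_def I1_def I2_def)
  moreover have "sr_length 0 T (\<lambda>t. (v' t, b (V / W) x' t)) < T"
  proof -
    let ?\<nu> = "\<lambda>t. (v' t, b (V / W) x' t)"
    let ?F = "(E + 2 * \<epsilon> * (r\<^sup>2 * p) + \<epsilon>\<^sup>2 * \<mu>\<^sup>2 * (T / 2)) + (T * (lb \<bullet> lb) + (V / W)\<^sup>2 * r\<^sup>2 * W)"
    have n2: "(norm (?\<nu> t))\<^sup>2 = (v' t)\<^sup>2 + b (V / W) x' t \<bullet> b (V / W) x' t" for t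
      by (simp add: norm_prod_def power2_norm_eq_inner)
    have "((\<lambda>t. (norm (?\<nu> t))\<^sup>2) has_integral ?F) {0..T}"
      unfolding n2 by (intro has_integral_add v'i moments(3)[OF x'i x'i2])
    from has_integral_mult_right[OF has_integral_add[OF const[of 1] this], of "1 / 2"]
    have J: "((\<lambda>t. (1 / 2) * (1 + (norm (?\<nu> t))\<^sup>2)) has_integral (1 / 2) * (T * 1 + ?F)) {0..T}" .
    \<comment> \<open>A speed \<open>n\<close> satisfies \<open>n \<le> (1 + n\<^sup>2) / 2\<close>,
      so energy below \<open>T\<close> already gives length below \<open>T\<close>, without a
      reparametrization.\<close>
    have "sr_length 0 T ?\<nu> \<le> (1 / 2) * (T * 1 + ?F)"
      unfolding sr_length_def
    proof (rule has_integral_le[OF integrable_integral J])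
      show "(\<lambda>t. norm (?\<nu> t)) integrable_on {0..T}"
        using h(1) by (simp add: horizontal_on_def absolutely_integrable_on_def)
      show "norm (?\<nu> t) \<le> (1 / 2) * (1 + (norm (?\<nu> t))\<^sup>2)" for t
        using sum_squares_bound[of "norm (?\<nu> t)" 1] by simp
    qed
    also have "\<dots> < T"
    proof -
      have "(V / W)\<^sup>2 * r\<^sup>2 * W = r\<^sup>2 * (V\<^sup>2 / W)" using W0 by (simp add: power2_eq_square)
      moreover have "r\<^sup>2 * (V\<^sup>2 / W - V) = r\<^sup>2 * (V\<^sup>2 / W) - r\<^sup>2 * V" by (simp add: algebra_simps)
      moreover have "2 * \<epsilon> * (r\<^sup>2 * p) = 2 * \<epsilon> * r\<^sup>2 * p" "\<epsilon>\<^sup>2 * \<mu>\<^sup>2 * (T / 2) = \<epsilon>\<^sup>2 * \<mu>\<^sup>2 * T / 2" by simp_all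
      ultimately have "?F < T" using eps(2) ET unfolding W_def[symmetric] by linarith
      then show ?thesis by simp
    qed
    finally show ?thesis .
  qed
  ultimately show ?thesis using that h(1,2) by blast
qed

text \<open>For the supremum it is enough that the period itself is a minimizing time and that no
  later time is one.\<close>

theorem cut_time_geodesic:
  fixes a :: real and u w :: "real^'n::finite"
  assumes w: "w \<noteq> 0" and unit: "a\<^sup>2 + u \<bullet> u = 1" and nz: "a \<noteq> 0 \<or> u \<bullet> w \<noteq> 0"
  shows "cut_time (sr_geodesic (a, u, w)) = ereal (2 * pi / norm w)"
  unfolding cut_time_def
proof (rule Sup_eqI)
  fix y assume "y \<in> {ereal t |t. 0 < t \<and> length_minimizing_on 0 t (sr_geodesic (a, u, w))}"
  then obtain t where t: "y = ereal t" "0 < t" "length_minimizing_on 0 t (sr_geodesic (a, u, w))" by blast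
  have "t \<le> 2 * pi / norm w"
  proof (rule ccontr)
    assume "\<not> t \<le> 2 * pi / norm w"
    then have "2 * pi / norm w < t" by simp
    from shorter_curve_after_period[OF w unit nz this] obtain h \<nu> where
      h: "horizontal_on 0 t h \<nu>" "h 0 = 0" "h t = sr_geodesic (a, u, w) t" "sr_length 0 t \<nu> < t" by blast
    obtain \<nu>' where v': "horizontal_on 0 t (sr_geodesic (a, u, w)) \<nu>'" 
      "\<And>c d h v. c \<le> d \<Longrightarrow> horizontal_on c d h v \<Longrightarrow> h c = sr_geodesic (a, u, w) 0 \<Longrightarrow> h d = sr_geodesic (a, u, w) t \<Longrightarrow>
         sr_length 0 t \<nu>' \<le> sr_length c d v"
      using t(3) unfolding length_minimizing_on_def by blast
    have "t \<le> sr_length 0 t \<nu>'" using horizontal_length_ge_time[OF w unit _ v'(1)] t by simp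
    moreover have "sr_length 0 t \<nu>' \<le> sr_length 0 t \<nu>"
      using v'(2)[OF _ h(1)] h t by (simp add: sr_geodesic_eq[OF w] geo_l_def geo_y_def zero_prod_def)
    ultimately show False using h by simp
  qed
  then show "y \<le> ereal (2 * pi / norm w)" using t by simp
next
  fix y assume "\<And>z. z \<in> {ereal t |t. 0 < t \<and> length_minimizing_on 0 t (sr_geodesic (a, u, w))} \<Longrightarrow> z \<le> y"
  then show "ereal (2 * pi / norm w) \<le> y"
    using geodesic_minimizing_period[OF w unit] w by auto
qed

section \<open>The differential of the exponential map\<close>

text \<open>The extremal with initial covector $P = (a, u, w)$ is read at time 1; \<open>jacobi P v\<close> is the
  derivative of its $x$-component in the direction $v$.\<close>

definition cov_r :: "'n::finite path_group \<Rightarrow> real" where "cov_r P = norm (snd (snd P))"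
definition cov_c :: "'n::finite path_group \<Rightarrow> real" where "cov_c P = fst (snd P) \<bullet> snd (snd P)"

definition cov_x :: "'n::finite path_group \<Rightarrow> real \<Rightarrow> real" where
  "cov_x P t = flow_x (fst P) (cov_c P) (cov_r P) t"

definition d_c :: "'n::finite path_group \<Rightarrow> 'n path_group \<Rightarrow> real" where
  "d_c P v = fst (snd P) \<bullet> snd (snd v) + fst (snd v) \<bullet> snd (snd P)"

definition d_r :: "'n::finite path_group \<Rightarrow> 'n path_group \<Rightarrow> real" where
  "d_r P v = (snd (snd P) \<bullet> snd (snd v)) / cov_r P"

definition jacobi :: "'n::finite path_group \<Rightarrow> 'n path_group \<Rightarrow> real \<Rightarrow> real" where
  "jacobi P v t = fst v * (sin (cov_r P * t) / cov_r P) + d_c P v * ((1 - cos (cov_r P * t)) / (cov_r P)\<^sup>2)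
    + d_r P v * (fst P * (t * cos (cov_r P * t) / cov_r P - sin (cov_r P * t) / (cov_r P)\<^sup>2)
        + cov_c P * (t * sin (cov_r P * t) / (cov_r P)\<^sup>2 - 2 * (1 - cos (cov_r P * t)) / cov_r P ^ 3))"

definition jacobi' :: "'n::finite path_group \<Rightarrow> 'n path_group \<Rightarrow> real \<Rightarrow> real" where
  "jacobi' P v t = fst v * cos (cov_r P * t) + d_c P v * (sin (cov_r P * t) / cov_r P)
    + d_r P v * (- (fst P * (t * sin (cov_r P * t)))
        + cov_c P * (t * cos (cov_r P * t) / cov_r P - sin (cov_r P * t) / (cov_r P)\<^sup>2))"

text \<open>\<open>x\<close> depends on the covector only through \<open>a\<close>,
  \<open>c = u \<bullet> w\<close> and \<open>r = norm w\<close>, so the chain rule passes through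
  \<open>d_c\<close> and \<open>d_r\<close>.\<close>

lemma cov_x_has_derivative:
  assumes "snd (snd P) \<noteq> 0"
  shows "((\<lambda>P. cov_x P t) has_derivative (\<lambda>v. jacobi P v t)) (at P within S)"
proof -
  have r: "cov_r P \<noteq> 0" using assms by (simp add: cov_r_def)
  have dr: "(cov_r has_derivative d_r P) (at P within S)"
  proof -
    have "((\<lambda>P. norm (snd (snd P))) has_derivative (\<lambda>v. sgn (snd (snd P)) \<bullet> snd (snd v))) (at P within S)"
      using has_derivative_compose[where f="\<lambda>P. snd (snd P)" and g=norm and x=P and f'="\<lambda>v. snd (snd v)", OF _ has_derivative_norm[OF assms]]
      by (simp add: has_derivative_snd inner_commute)
    then show ?thesis
      by (simp add: cov_r_def[abs_def] d_r_def[abs_def] sgn_div_norm divide_inverse mult.commute)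
  qed
  have dc: "(cov_c has_derivative d_c P) (at P within S)"
    unfolding cov_c_def[abs_def] d_c_def[abs_def] by (auto intro!: derivative_eq_intros)
  have S: "((\<lambda>r. sin (r * t) / r) has_real_derivative t * cos (cov_r P * t) / cov_r P - sin (cov_r P * t) / (cov_r P)\<^sup>2) (at (cov_r P))"
    using r by (auto intro!: derivative_eq_intros simp: field_simps power2_eq_square)
  have C: "((\<lambda>r. (1 - cos (r * t)) / r\<^sup>2) has_real_derivative t * sin (cov_r P * t) / (cov_r P)\<^sup>2 - 2 * (1 - cos (cov_r P * t)) / cov_r P ^ 3) (at (cov_r P))"
    unfolding power2_eq_square power3_eq_cube using r by (auto intro!: derivative_eq_intros simp: field_simps)
  note comp = DERIV_compose_FDERIV[OF _ dr]
  have eq: "cov_x P t = fst P * (sin (cov_r P * t) / cov_r P) + cov_c P * ((1 - cos (cov_r P * t)) / (cov_r P)\<^sup>2)" for P :: "'a path_group"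
    by (simp add: cov_x_def flow_x_def)
  show ?thesis
    unfolding eq jacobi_def[abs_def]
    by (rule has_derivative_eq_rhs[OF has_derivative_add[OF has_derivative_mult[OF has_derivative_fst[OF has_derivative_ident] comp[OF S]] has_derivative_mult[OF dc comp[OF C]]]])
       (simp add: fun_eq_iff algebra_simps)
qed

text \<open>The second equation is the linearization of \<open>x'' = c - r\<^sup>2 x\<close> in the
  covector.\<close>

lemma jacobi_derivs:
  assumes "snd (snd P) \<noteq> 0"
  shows "(jacobi P v has_real_derivative jacobi' P v t) (at t within S)"
    and "(jacobi' P v has_real_derivative d_c P v - 2 * cov_r P * d_r P v * cov_x P t - (cov_r P)\<^sup>2 * jacobi P v t) (at t within S)"
proof -
  define r where "r = cov_r P"
  have r: "r \<noteq> 0" using assms by (simp add: r_def cov_r_def)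
  have 1: "((\<lambda>t. sin (r * t) / r) has_real_derivative cos (r * t)) (at t within S)" for t
    using r by (auto intro!: derivative_eq_intros)
  have 2: "((\<lambda>t. (1 - cos (r * t)) / r\<^sup>2) has_real_derivative sin (r * t) / r) (at t within S)" for t
    using r by (auto intro!: derivative_eq_intros simp: power2_eq_square)
  have 3: "((\<lambda>t. t * cos (r * t) / r - sin (r * t) / r\<^sup>2) has_real_derivative - (t * sin (r * t))) (at t within S)" for t
    unfolding power2_eq_square using r by (auto intro!: derivative_eq_intros simp: field_simps)
  have 4: "((\<lambda>t. t * sin (r * t) / r\<^sup>2 - 2 * (1 - cos (r * t)) / r ^ 3) has_real_derivative t * cos (r * t) / r - sin (r * t) / r\<^sup>2) (at t within S)" for t
    unfolding power2_eq_square power3_eq_cube using r by (auto intro!: derivative_eq_intros simp: field_simps)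
  have 5: "((\<lambda>t. cos (r * t)) has_real_derivative - r * sin (r * t)) (at t within S)" for t
    by (auto intro!: derivative_eq_intros)
  have 6: "((\<lambda>t. - (a * (t * sin (r * t)))) has_real_derivative - (a * (sin (r * t) + r * t * cos (r * t)))) (at t within S)" for t a
    by (auto intro!: derivative_eq_intros simp: algebra_simps)
  show "(jacobi P v has_real_derivative jacobi' P v t) (at t within S)"
    unfolding jacobi_def[abs_def] jacobi'_def r_def[symmetric]
    by (rule DERIV_cong[OF DERIV_add[OF DERIV_add[OF DERIV_cmult[OF 1] DERIV_cmult[OF 2]] DERIV_cmult[OF DERIV_add[OF DERIV_cmult[OF 3] DERIV_cmult[OF 4]]]]]) simp
  have "d_c P v * cos (r * t) = d_c P v - r\<^sup>2 * (d_c P v * ((1 - cos (r * t)) / r\<^sup>2))"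
  proof -
    have "r\<^sup>2 * (d_c P v * ((1 - cos (r * t)) / r\<^sup>2)) = d_c P v * (1 - cos (r * t))" using r by simp
    then show ?thesis by (simp add: right_diff_distrib)
  qed
  moreover have "fst v * (- r * sin (r * t)) = - r\<^sup>2 * (fst v * (sin (r * t) / r))"
    using r by (simp add: power2_eq_square)
  moreover have "d_r P v * (- (fst P * (sin (r * t) + r * t * cos (r * t))) + cov_c P * (- (t * sin (r * t)))) =
     - 2 * r * d_r P v * (fst P * sin (r * t) / r + cov_c P * (1 - cos (r * t)) / r\<^sup>2) -
     r\<^sup>2 * (d_r P v * (fst P * (t * cos (r * t) / r - sin (r * t) / r\<^sup>2)
        + cov_c P * (t * sin (r * t) / r\<^sup>2 - 2 * (1 - cos (r * t)) / r ^ 3)))"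
    using r by (simp add: power2_eq_square power3_eq_cube field_simps)
  ultimately show "(jacobi' P v has_real_derivative d_c P v - 2 * cov_r P * d_r P v * cov_x P t - (cov_r P)\<^sup>2 * jacobi P v t) (at t within S)"
    unfolding jacobi_def jacobi'_def[abs_def] cov_x_def flow_x_def r_def[symmetric]
    by (intro DERIV_cong[OF DERIV_add[OF DERIV_add[OF DERIV_cmult[OF 5] DERIV_cmult[OF 1]] DERIV_cmult[OF DERIV_add[OF 6 DERIV_cmult[OF 3]]]]])
       (simp add: distrib_left)
qed

lemma jacobi_0 [simp]: "jacobi P v 0 = 0" "jacobi' P v 0 = fst v"
  by (simp_all add: jacobi_def jacobi'_def)

text \<open>The Leibniz rule asks for a derivative that is continuous as an operator-valued map. In
  finite dimension this follows from continuity in each fixed direction, through the matrix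
  entries.\<close>

lemma integral_has_derivative_param:
  fixes f :: "'a::euclidean_space \<Rightarrow> real \<Rightarrow> real"
  assumes U: "open U" "P0 \<in> U"
    and der: "\<And>P t S. P \<in> U \<Longrightarrow> ((\<lambda>P. f P t) has_derivative (\<lambda>v. f' P v t)) (at P within S)"
    and f: "\<And>P. P \<in> U \<Longrightarrow> continuous_on {0..1} (f P)"
    and f': "\<And>v. continuous_on (U \<times> {0..1}) (\<lambda>(P, t). f' P v t)"
  shows "((\<lambda>P. integral {0..1} (f P)) has_derivative (\<lambda>v. integral {0..1} (f' P0 v))) (at P0)"
proof -
  obtain e where e: "e > 0" "ball P0 e \<subseteq> U" using U open_contains_ball by blast
  define fx where "fx = (\<lambda>P t. Blinfun (\<lambda>v. f' P v t))"
  have ap: "blinfun_apply (fx P t) = (\<lambda>v. f' P v t)" if "P \<in> U" for P t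
    unfolding fx_def by (rule bounded_linear_Blinfun_apply[OF has_derivative_bounded_linear[OF der[OF that]]])
  have cont: "continuous_on (U \<times> {0..1}) (\<lambda>(P, t). fx P t)"
  proof -
    have "continuous_on (U \<times> {0..1}) (\<lambda>z. blinfun_of_matrix (\<lambda>i j. blinfun_apply (fx (fst z) (snd z)) j \<bullet> i))"
    proof (rule continuous_on_blinfun_of_matrix)
      fix i :: real and j :: 'a
      have "continuous_on (U \<times> {0..1}) (\<lambda>z. f' (fst z) j (snd z) \<bullet> i)"
        using f'[of j] by (intro continuous_intros) (simp add: case_prod_beta)
      then show "continuous_on (U \<times> {0..1}) (\<lambda>z. blinfun_apply (fx (fst z) (snd z)) j \<bullet> i)"
        by (rule continuous_on_eq) (auto simp: ap)
    qed
    then show ?thesis unfolding blinfun_of_matrix_works by (simp add: case_prod_beta)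
  qed
  have "((\<lambda>P. integral (cbox 0 1) (f P)) has_derivative integral (cbox 0 1) (fx P0)) (at P0 within ball P0 e)"
  proof (rule leibniz_rule)
    show "continuous_on (ball P0 e \<times> cbox 0 1) (\<lambda>(P, t). fx P t)"
      by (rule continuous_on_subset[OF cont]) (use e in auto)
    show "f P integrable_on cbox 0 1" if "P \<in> ball P0 e" for P
      using f[OF subsetD[OF e(2) that]] by (simp add: integrable_continuous_real)
    show "((\<lambda>P. f P t) has_derivative blinfun_apply (fx P t)) (at P within ball P0 e)" if "P \<in> ball P0 e" for P t
      using that e der[of P] ap[of P t] by auto
  qed (use e in auto)
  moreover have "blinfun_apply (integral {0..1} (fx P0)) = (\<lambda>v. integral {0..1} (f' P0 v))"
  proof
    fix v
    have "continuous_on {0..1} (\<lambda>t. fx P0 t)"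
      using continuous_on_compose2[OF cont continuous_on_Pair[OF continuous_on_const[of _ P0] continuous_on_id], of "{0..1}"] U by auto
    then show "blinfun_apply (integral {0..1} (fx P0)) v = integral {0..1} (f' P0 v)"
      using U by (simp add: blinfun_apply_integral integrable_continuous_real ap)
  qed
  moreover have "at P0 within ball P0 e = at P0" using e(1) by (intro at_within_open) auto
  ultimately show ?thesis by (simp only: box_real)
qed

section \<open>Moments of \<open>x\<close> and the differential of the exponential map\<close>

lemma jacobi_continuous:
  fixes U :: "'n::finite path_group set"
  assumes "\<And>P. P \<in> U \<Longrightarrow> snd (snd P) \<noteq> 0"
  shows "continuous_on ((U \<times> UNIV) \<times> S) (\<lambda>((P, v), t). jacobi P v t)"
    and "continuous_on (U \<times> S) (\<lambda>(P, t). jacobi P v t)"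
    and "continuous_on (U \<times> S) (\<lambda>(P, t). cov_x P t)"
  unfolding jacobi_def cov_x_def flow_x_def case_prod_beta d_c_def d_r_def cov_c_def cov_r_def
  by (intro continuous_intros; use assms in force)+

text \<open>The moments are kept as integrals in spite of their closed forms, because their
  differentials are then integrals of the Jacobi field, which is the form needed for the energy
  identity and Wirtinger's inequality.\<close>

definition mean_x :: "'n::finite path_group \<Rightarrow> real" where "mean_x P = integral {0..1} (cov_x P)"
definition mean_x2 :: "'n::finite path_group \<Rightarrow> real" where "mean_x2 P = integral {0..1} (\<lambda>t. (cov_x P t)\<^sup>2)"
definition d_mean_x :: "'n::finite path_group \<Rightarrow> 'n path_group \<Rightarrow> real" where "d_mean_x P v = integral {0..1} (jacobi P v)"
definition d_mean_x2 :: "'n::finite path_group \<Rightarrow> 'n path_group \<Rightarrow> real" where "d_mean_x2 P v = integral {0..1} (\<lambda>t. 2 * cov_x P t * jacobi P v t)"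

lemma open_nonzero_cov: "open {P :: 'n::finite path_group. snd (snd P) \<noteq> 0}"
  by (intro open_Collect_neq continuous_intros)

lemma cov_x_continuous:
  assumes "snd (snd P) \<noteq> 0"
  shows "continuous_on S (cov_x P)" "continuous_on S (jacobi P v)" "continuous_on S (jacobi' P v)"
  using flow_continuous[of "cov_r P" S "fst P" "cov_c P"] assms DERIV_continuous_on[OF jacobi_derivs(1)[OF assms]] DERIV_continuous_on[OF jacobi_derivs(2)[OF assms]]
  by (auto simp: cov_x_def[abs_def] cov_r_def)

lemma mean_x_has_derivative:
  assumes "snd (snd P) \<noteq> 0"
  shows "(mean_x has_derivative d_mean_x P) (at P)" "(mean_x2 has_derivative d_mean_x2 P) (at P)"
proof -
  let ?U = "{P :: 'a path_group. snd (snd P) \<noteq> 0}"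
  show "(mean_x has_derivative d_mean_x P) (at P)"
    unfolding mean_x_def[abs_def] d_mean_x_def[abs_def]
  proof (rule integral_has_derivative_param[OF open_nonzero_cov])
    show "continuous_on (?U \<times> {0..1}) (\<lambda>(P, t). jacobi P v t)" for v :: "'a path_group"
      by (rule jacobi_continuous(2)) simp
  qed (use assms in \<open>simp_all add: cov_x_has_derivative cov_x_continuous\<close>)
  show "(mean_x2 has_derivative d_mean_x2 P) (at P)"
    unfolding mean_x2_def[abs_def] d_mean_x2_def[abs_def]
  proof (rule integral_has_derivative_param[OF open_nonzero_cov])
    fix Q :: "'a path_group" and t S assume Q: "Q \<in> ?U"
    show "((\<lambda>P. (cov_x P t)\<^sup>2) has_derivative (\<lambda>v. 2 * cov_x Q t * jacobi Q v t)) (at Q within S)"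
      using cov_x_has_derivative[of Q t S] Q by (auto intro!: derivative_eq_intros)
    show "continuous_on {0..1} (\<lambda>t. (cov_x Q t)\<^sup>2)"
      using cov_x_continuous[of Q] Q by (auto intro!: continuous_intros)
  next
    fix v :: "'a path_group"
    show "continuous_on (?U \<times> {0..1}) (\<lambda>(P, t). 2 * cov_x P t * jacobi P v t)"
      using jacobi_continuous(2)[of ?U "{0..1}" v] jacobi_continuous(3)[of ?U "{0..1}"]
      by (simp add: case_prod_beta continuous_intros)
  qed (use assms in auto)
qed

lemma mean_x_eq:
  fixes a :: real and u w :: "real^'n::finite"
  assumes "w \<noteq> 0"
  shows "mean_x (a, u, w) = flow_I1 a (u \<bullet> w) (norm w) 1" "mean_x2 (a, u, w) = flow_I2 a (u \<bullet> w) (norm w) 1"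
  using flow_has_integrals[of "norm w" 1 a "u \<bullet> w"] assms
  by (simp_all add: mean_x_def mean_x2_def cov_x_def[abs_def] cov_c_def cov_r_def integral_unique)

lemma sr_exp_eq:
  assumes "snd (snd P) \<noteq> 0"
  shows "sr_exp P = (cov_x P 1, fst (snd P) - mean_x P *\<^sub>R snd (snd P),
    (cov_x P 1 / 2) *\<^sub>R (fst (snd P) - mean_x P *\<^sub>R snd (snd P)) - (mean_x P *\<^sub>R fst (snd P) - mean_x2 P *\<^sub>R snd (snd P)))"
proof (cases P)
  case (fields a u w)
  then have w: "w \<noteq> 0" using assms by simp
  show ?thesis
    unfolding fields sr_exp_def sr_geodesic_eq[OF w] mean_x_eq[OF w] geo_y_def geo_l_def cov_x_def cov_r_def cov_c_def by simp
qed

definition d_exp :: "'n::finite path_group \<Rightarrow> 'n path_group \<Rightarrow> 'n path_group" where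
  "d_exp P v =
    (let l = fst (snd P) - mean_x P *\<^sub>R snd (snd P);
         dl = fst (snd v) - mean_x P *\<^sub>R snd (snd v) - d_mean_x P v *\<^sub>R snd (snd P)
     in (jacobi P v 1, dl,
         (cov_x P 1 / 2) *\<^sub>R dl + (jacobi P v 1 / 2) *\<^sub>R l
          - (mean_x P *\<^sub>R fst (snd v) + d_mean_x P v *\<^sub>R fst (snd P) - mean_x2 P *\<^sub>R snd (snd v) - d_mean_x2 P v *\<^sub>R snd (snd P))))"

lemma sr_exp_has_derivative:
  assumes "snd (snd P) \<noteq> 0"
  shows "(sr_exp has_derivative d_exp P) (at P)"
proof -
  note d = cov_x_has_derivative[OF assms, of 1 UNIV] mean_x_has_derivative[OF assms]
  have l: "((\<lambda>P. fst (snd P) - mean_x P *\<^sub>R snd (snd P)) has_derivative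
      (\<lambda>v. fst (snd v) - mean_x P *\<^sub>R snd (snd v) - d_mean_x P v *\<^sub>R snd (snd P))) (at P)"
    by (auto intro!: derivative_eq_intros d simp: fun_eq_iff algebra_simps)
  have z: "((\<lambda>P. mean_x P *\<^sub>R fst (snd P) - mean_x2 P *\<^sub>R snd (snd P)) has_derivative
      (\<lambda>v. mean_x P *\<^sub>R fst (snd v) + d_mean_x P v *\<^sub>R fst (snd P) - mean_x2 P *\<^sub>R snd (snd v) - d_mean_x2 P v *\<^sub>R snd (snd P))) (at P)"
    by (auto intro!: derivative_eq_intros d simp: fun_eq_iff algebra_simps)
  have half: "((\<lambda>P. cov_x P 1 / 2) has_derivative (\<lambda>v. jacobi P v 1 / 2)) (at P)"
    using has_derivative_mult_right[OF d(1), of "1 / 2"] by simp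
  have "((\<lambda>P. (cov_x P 1, fst (snd P) - mean_x P *\<^sub>R snd (snd P),
    (cov_x P 1 / 2) *\<^sub>R (fst (snd P) - mean_x P *\<^sub>R snd (snd P)) - (mean_x P *\<^sub>R fst (snd P) - mean_x2 P *\<^sub>R snd (snd P))))
    has_derivative d_exp P) (at P)"
    unfolding d_exp_def[abs_def] Let_def
    by (intro has_derivative_Pair d l has_derivative_diff has_derivative_scaleR half z)
  then show ?thesis
    by (rule has_derivative_transform_within_open[OF _ open_nonzero_cov]) (use assms in \<open>auto simp: sr_exp_eq\<close>)
qed

text \<open>Joint continuity in covector and direction makes the pairs of a conjugate time and a
  unit kernel vector a closed set.\<close>

lemma d_exp_continuous:
  fixes U :: "'n::finite path_group set"
  assumes U: "\<And>P. P \<in> U \<Longrightarrow> snd (snd P) \<noteq> 0"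
  shows "continuous_on (U \<times> UNIV) (\<lambda>(P, v). d_exp P v)"
proof -
  have c: "continuous_on ((U \<times> UNIV) \<times> S) (\<lambda>z. jacobi (fst (fst z)) (snd (fst z)) (snd z))" for S
    using jacobi_continuous(1)[OF U, of U S] by (simp add: case_prod_beta)
  have c': "continuous_on (U \<times> S) (\<lambda>z. cov_x (fst z) (snd z))" for S
    using jacobi_continuous(3)[OF U, of U S] by (simp add: case_prod_beta)
  have 1: "continuous_on (U \<times> UNIV) (\<lambda>z. mean_x (fst z))" "continuous_on (U \<times> UNIV) (\<lambda>z. mean_x2 (fst z))"
  proof -
    have "continuous_on U mean_x" "continuous_on U mean_x2"
      by (rule has_derivative_continuous_on, rule has_derivative_at_withinI, rule mean_x_has_derivative, erule U)+
    then show "continuous_on (U \<times> UNIV) (\<lambda>z. mean_x (fst z))" "continuous_on (U \<times> UNIV) (\<lambda>z. mean_x2 (fst z))"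
      by (auto intro!: continuous_on_compose2[of U _ "U \<times> UNIV" fst] continuous_intros)
  qed
  have 2: "continuous_on (U \<times> UNIV) (\<lambda>z. d_mean_x (fst z) (snd z))"
    unfolding d_mean_x_def
    using integral_continuous_on_param[of "U \<times> UNIV" 0 1 "\<lambda>z t. jacobi (fst z) (snd z) t"] c[of "{0..1}"]
    by (simp add: case_prod_beta)
  have cx: "continuous_on ((U \<times> UNIV) \<times> {0..1}) (\<lambda>z. cov_x (fst (fst z)) (snd z))"
    using continuous_on_compose2[OF c'[of "{0..1}"], of "(U \<times> UNIV) \<times> {0..1}" "\<lambda>z. (fst (fst z), snd z)"]
    by (force intro!: continuous_intros)
  have cxj: "continuous_on ((U \<times> UNIV) \<times> {0..1}) (\<lambda>z. 2 * cov_x (fst (fst z)) (snd z) * jacobi (fst (fst z)) (snd (fst z)) (snd z))"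
    by (intro continuous_on_mult continuous_on_const cx c)
  have 3: "continuous_on (U \<times> UNIV) (\<lambda>z. d_mean_x2 (fst z) (snd z))"
    unfolding d_mean_x2_def
    using integral_continuous_on_param[of "U \<times> UNIV" 0 1 "\<lambda>z t. 2 * cov_x (fst z) t * jacobi (fst z) (snd z) t"] cxj
    by (simp add: case_prod_beta)
  have 4: "continuous_on (U \<times> UNIV) (\<lambda>z. jacobi (fst z) (snd z) 1)" "continuous_on (U \<times> UNIV) (\<lambda>z. cov_x (fst z) 1)"
    using continuous_on_compose2[OF c[of UNIV], of "U \<times> UNIV" "\<lambda>z. (z, 1)"]
      continuous_on_compose2[OF c'[of UNIV], of "U \<times> UNIV" "\<lambda>z. (fst z, 1)"]
    by (force intro!: continuous_intros)+
  show ?thesis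
    unfolding d_exp_def Let_def case_prod_beta by (intro continuous_intros 1 2 3 4) simp_all
qed

text \<open>Source and target have equal dimension, so failure of surjectivity means a nonzero
  kernel vector.\<close>

lemma critical_point_sr_exp_iff:
  assumes "snd (snd P) \<noteq> 0"
  shows "critical_point sr_exp P \<longleftrightarrow> (\<exists>v. v \<noteq> 0 \<and> d_exp P v = 0)"
proof -
  note d = sr_exp_has_derivative[OF assms]
  have lin: "linear (d_exp P)" by (rule bounded_linear.linear[OF has_derivative_bounded_linear[OF d]])
  have "critical_point sr_exp P \<longleftrightarrow> \<not> surj (d_exp P)"
    unfolding critical_point_def
  proof
    assume "\<exists>f'. (sr_exp has_derivative f') (at P) \<and> \<not> surj f'"
    then obtain f' where f': "(sr_exp has_derivative f') (at P)" "\<not> surj f'" by blast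
    have "f' = d_exp P" by (rule has_derivative_unique[OF f'(1) d])
    then show "\<not> surj (d_exp P)" using f'(2) by simp
  qed (use d in blast)
  also have "surj (d_exp P) \<longleftrightarrow> inj (d_exp P)"
    using linear_injective_imp_surjective[OF lin] linear_surjective_imp_injective[OF lin] by blast
  finally show ?thesis unfolding linear_injective_0[OF lin] by auto
qed

section \<open>Conjugate times\<close>

text \<open>The Jacobi equation is multiplied by the field and integrated by parts, with vanishing
  boundary terms. The coefficients \<open>d_c\<close> and \<open>d_r\<close> are then eliminated
  with the two vector equations that express membership in the kernel.\<close>

lemma jacobi_energy:
  fixes P v :: "'n::finite path_group"
  assumes w: "snd (snd P) \<noteq> 0" and ker: "d_exp P v = 0"
  shows "integral {0..1} (\<lambda>t. (jacobi' P v t)\<^sup>2) =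
    (cov_r P)\<^sup>2 * (integral {0..1} (\<lambda>t. (jacobi P v t)\<^sup>2) - (d_mean_x P v)\<^sup>2)
     - (mean_x2 P - (mean_x P)\<^sup>2) * (snd (snd v) \<bullet> snd (snd v))"
    and "jacobi P v 1 = 0"
    and "fst (snd v) = mean_x P *\<^sub>R snd (snd v) + d_mean_x P v *\<^sub>R snd (snd P)"
    and "mean_x P *\<^sub>R fst (snd v) + d_mean_x P v *\<^sub>R fst (snd P) =
      mean_x2 P *\<^sub>R snd (snd v) + d_mean_x2 P v *\<^sub>R snd (snd P)"
proof -
  define u where "u = fst (snd P)"
  define w where "w = snd (snd P)"
  define du where "du = fst (snd v)"
  define dw where "dw = snd (snd v)"
  define r where "r = cov_r P"
  define J1 where "J1 = mean_x P"
  define J2 where "J2 = mean_x2 P"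
  define K1 where "K1 = d_mean_x P v"
  define K2 where "K2 = d_mean_x2 P v"
  define \<eta> where "\<eta> = jacobi P v"
  define \<eta>' where "\<eta>' = jacobi' P v"
  show j1: "jacobi P v 1 = 0" using ker by (simp add: d_exp_def Let_def zero_prod_def)
  have k1: "du - J1 *\<^sub>R dw - K1 *\<^sub>R w = 0"
    using ker by (simp add: d_exp_def Let_def zero_prod_def du_def J1_def dw_def K1_def w_def)
  then show k1': "fst (snd v) = mean_x P *\<^sub>R snd (snd v) + d_mean_x P v *\<^sub>R snd (snd P)"
    by (simp add: du_def J1_def dw_def K1_def w_def algebra_simps)
  \<comment> \<open>Once the contributions of the first two components are removed, the last
    component is the variation of \<open>z = x l / 2 - y\<close>.\<close>
  have k2: "J1 *\<^sub>R du + K1 *\<^sub>R u - J2 *\<^sub>R dw - K2 *\<^sub>R w = 0"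
  proof -
    have "snd (snd (d_exp P v)) = 0" using ker by simp
    then have "(cov_x P 1 / 2) *\<^sub>R (du - J1 *\<^sub>R dw - K1 *\<^sub>R w) + (jacobi P v 1 / 2) *\<^sub>R (u - J1 *\<^sub>R w)
        - (J1 *\<^sub>R du + K1 *\<^sub>R u - J2 *\<^sub>R dw - K2 *\<^sub>R w) = 0"
      by (simp only: d_exp_def Let_def snd_conv du_def J1_def dw_def K1_def w_def u_def J2_def K2_def)
    then show ?thesis unfolding k1 j1 by simp
  qed
  then show "mean_x P *\<^sub>R fst (snd v) + d_mean_x P v *\<^sub>R fst (snd P) =
      mean_x2 P *\<^sub>R snd (snd v) + d_mean_x2 P v *\<^sub>R snd (snd P)"
    by (simp add: du_def J1_def dw_def K1_def w_def u_def J2_def K2_def algebra_simps)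
  have r: "r \<noteq> 0" "r\<^sup>2 = w \<bullet> w" using w by (auto simp: r_def cov_r_def w_def dot_square_norm)
  have rdr: "r * d_r P v = w \<bullet> dw" using r by (simp add: d_r_def r_def[symmetric] w_def dw_def)
  have dc: "d_c P v = u \<bullet> dw + du \<bullet> w" by (simp add: d_c_def u_def dw_def du_def w_def)
  have i0: "(\<eta> has_integral K1) {0..1}"
    unfolding K1_def d_mean_x_def \<eta>_def by (intro integrable_integral integrable_continuous_real cov_x_continuous w)
  have i1: "((\<lambda>t. 2 * cov_x P t * \<eta> t) has_integral K2) {0..1}"
    unfolding K2_def d_mean_x2_def \<eta>_def
    by (intro integrable_integral integrable_continuous_real continuous_intros cov_x_continuous w)
  have i2: "((\<lambda>t. (\<eta> t)\<^sup>2) has_integral integral {0..1} (\<lambda>t. (\<eta> t)\<^sup>2)) {0..1}"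
    unfolding \<eta>_def by (intro integrable_integral integrable_continuous_real continuous_intros cov_x_continuous w)
  have i3: "((\<lambda>t. (\<eta>' t)\<^sup>2) has_integral integral {0..1} (\<lambda>t. (\<eta>' t)\<^sup>2)) {0..1}"
    unfolding \<eta>'_def by (intro integrable_integral integrable_continuous_real continuous_intros cov_x_continuous w)
  have "((\<lambda>t. (\<eta>' t)\<^sup>2 + \<eta> t * (d_c P v - 2 * r * d_r P v * cov_x P t - r\<^sup>2 * \<eta> t)) has_integral \<eta> 1 * \<eta>' 1 - \<eta> 0 * \<eta>' 0) {0..1}"
  proof (rule fundamental_theorem_of_calculus)
    fix t :: real
    have "((\<lambda>t. \<eta> t * \<eta>' t) has_real_derivative (\<eta>' t)\<^sup>2 + \<eta> t * (d_c P v - 2 * r * d_r P v * cov_x P t - r\<^sup>2 * \<eta> t)) (at t within {0..1})"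
      unfolding \<eta>_def \<eta>'_def r_def
      by (rule DERIV_cong[OF DERIV_mult[OF jacobi_derivs[OF w]]]) (simp add: power2_eq_square algebra_simps)
    then show "((\<lambda>t. \<eta> t * \<eta>' t) has_vector_derivative (\<eta>' t)\<^sup>2 + \<eta> t * (d_c P v - 2 * r * d_r P v * cov_x P t - r\<^sup>2 * \<eta> t)) (at t within {0..1})"
      by (simp add: has_real_derivative_iff_has_vector_derivative)
  qed simp
  then have z: "((\<lambda>t. (\<eta>' t)\<^sup>2 + \<eta> t * (d_c P v - 2 * r * d_r P v * cov_x P t - r\<^sup>2 * \<eta> t)) has_integral 0) {0..1}"
    using j1 by (simp add: \<eta>_def)
  have "((\<lambda>t. (\<eta>' t)\<^sup>2 + (d_c P v * \<eta> t - r * d_r P v * (2 * cov_x P t * \<eta> t) - r\<^sup>2 * (\<eta> t)\<^sup>2)) has_integral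
     integral {0..1} (\<lambda>t. (\<eta>' t)\<^sup>2) + (d_c P v * K1 - r * d_r P v * K2 - r\<^sup>2 * integral {0..1} (\<lambda>t. (\<eta> t)\<^sup>2))) {0..1}"
    by (intro has_integral_add has_integral_diff has_integral_mult_right i0 i1 i2 i3)
  then have "((\<lambda>t. (\<eta>' t)\<^sup>2 + \<eta> t * (d_c P v - 2 * r * d_r P v * cov_x P t - r\<^sup>2 * \<eta> t)) has_integral
     integral {0..1} (\<lambda>t. (\<eta>' t)\<^sup>2) + (d_c P v * K1 - r * d_r P v * K2 - r\<^sup>2 * integral {0..1} (\<lambda>t. (\<eta> t)\<^sup>2))) {0..1}"
    by (simp add: power2_eq_square algebra_simps)
  from has_integral_unique[OF this z]
  have main: "integral {0..1} (\<lambda>t. (\<eta>' t)\<^sup>2) + (d_c P v * K1 - r * d_r P v * K2 - r\<^sup>2 * integral {0..1} (\<lambda>t. (\<eta> t)\<^sup>2)) = 0" .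
  \<comment> \<open>\<open>e1\<close> trades \<open>u \<bullet> dw\<close> and the \<open>K2\<close>
    term for \<open>du \<bullet> dw\<close> and \<open>dw \<bullet> dw\<close>; \<open>e2\<close>
    and \<open>e3\<close> then eliminate \<open>du\<close>, so that only \<open>K1\<close> and the
    variance of \<open>x\<close> remain.\<close>
  have e1: "J1 * (du \<bullet> dw) + K1 * (u \<bullet> dw) - J2 * (dw \<bullet> dw) - K2 * (w \<bullet> dw) = 0"
    using arg_cong[OF k2, of "\<lambda>z. z \<bullet> dw"] by (simp add: inner_add_left inner_diff_left)
  have e2: "du \<bullet> w = J1 * (dw \<bullet> w) + K1 * (w \<bullet> w)"
    using arg_cong[OF k1, of "\<lambda>z. z \<bullet> w"] by (simp add: inner_diff_left)
  have e3: "du \<bullet> dw = J1 * (dw \<bullet> dw) + K1 * (w \<bullet> dw)"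
    using arg_cong[OF k1, of "\<lambda>z. z \<bullet> dw"] by (simp add: inner_diff_left)
  have "d_c P v * K1 - r * d_r P v * K2 = r\<^sup>2 * K1\<^sup>2 + (J2 - J1\<^sup>2) * (dw \<bullet> dw)"
  proof -
    have "d_c P v * K1 - r * d_r P v * K2 = (u \<bullet> dw) * K1 + (du \<bullet> w) * K1 - (w \<bullet> dw) * K2"
      by (simp add: dc rdr algebra_simps)
    also have "\<dots> = (du \<bullet> w) * K1 - J1 * (du \<bullet> dw) + J2 * (dw \<bullet> dw)"
      using e1 by (simp add: algebra_simps)
    also have "\<dots> = r\<^sup>2 * K1\<^sup>2 + (J2 - J1\<^sup>2) * (dw \<bullet> dw)"
      unfolding e2 e3 r(2) by (simp add: power2_eq_square algebra_simps inner_commute)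
    finally show ?thesis .
  qed
  with main have "integral {0..1} (\<lambda>t. (\<eta>' t)\<^sup>2) = r\<^sup>2 * (integral {0..1} (\<lambda>t. (\<eta> t)\<^sup>2) - K1\<^sup>2) - (J2 - J1\<^sup>2) * (dw \<bullet> dw)"
    by (simp add: algebra_simps)
  then show "integral {0..1} (\<lambda>t. (jacobi' P v t)\<^sup>2) =
    (cov_r P)\<^sup>2 * (integral {0..1} (\<lambda>t. (jacobi P v t)\<^sup>2) - (d_mean_x P v)\<^sup>2)
     - (mean_x2 P - (mean_x P)\<^sup>2) * (snd (snd v) \<bullet> snd (snd v))"
    by (simp add: \<eta>_def \<eta>'_def r_def K1_def J2_def J1_def dw_def)
qed

lemma jacobi_wirtinger:
  fixes P v :: "'n::finite path_group"
  assumes w: "snd (snd P) \<noteq> 0" and ker: "d_exp P v = 0"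
  shows "4 * pi\<^sup>2 * (integral {0..1} (\<lambda>t. (jacobi P v t)\<^sup>2) - (d_mean_x P v)\<^sup>2) \<le> integral {0..1} (\<lambda>t. (jacobi' P v t)\<^sup>2)"
    and "0 \<le> integral {0..1} (\<lambda>t. (jacobi P v t)\<^sup>2) - (d_mean_x P v)\<^sup>2"
  unfolding d_mean_x_def
  using wirtinger[of "jacobi P v" "jacobi' P v"] jacobi_derivs(1)[OF w] cov_x_continuous[OF w] jacobi_energy(2)[OF w ker]
    integral_power2_le[of "jacobi P v"]
  by simp_all

lemma mean_variance_pos:
  assumes "snd (snd P) \<noteq> 0" "fst P \<noteq> 0 \<or> cov_c P \<noteq> 0"
  shows "mean_x2 P - (mean_x P)\<^sup>2 > 0"
  using flow_variance_pos[of "cov_r P" 1 "fst P" "cov_c P"] assms mean_x_eq[of "snd (snd P)" "fst P" "fst (snd P)"]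
  by (simp add: cov_r_def cov_c_def)

text \<open>Below \<open>2 * pi\<close> the energy identity and Wirtinger's inequality leave two
  nonnegative terms whose sum is at most zero. Hence the variation of \<open>w\<close> vanishes and
  the Jacobi field is constant; the explicit derivative, read at two times, annihilates the
  remaining parameters.\<close>

lemma d_exp_injective_before_period:
  fixes P v :: "'n::finite path_group"
  assumes w: "snd (snd P) \<noteq> 0" and nz: "fst P \<noteq> 0 \<or> cov_c P \<noteq> 0"
    and r: "cov_r P < 2 * pi" and ker: "d_exp P v = 0"
  shows "v = 0"
proof -
  define W where "W = integral {0..1} (\<lambda>t. (jacobi P v t)\<^sup>2) - (d_mean_x P v)\<^sup>2"
  define D where "D = integral {0..1} (\<lambda>t. (jacobi' P v t)\<^sup>2)"
  define V where "V = mean_x2 P - (mean_x P)\<^sup>2"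
  define q where "q = snd (snd v) \<bullet> snd (snd v)"
  have r0: "cov_r P > 0" using w by (simp add: cov_r_def)
  have V: "V > 0" using mean_variance_pos[OF w nz] by (simp add: V_def)
  have W: "W \<ge> 0" "4 * pi\<^sup>2 * W \<le> D" using jacobi_wirtinger[OF w ker] by (auto simp: W_def D_def)
  have D: "D = (cov_r P)\<^sup>2 * W - V * q" using jacobi_energy(1)[OF w ker] by (simp add: W_def D_def V_def q_def)
  have q: "q \<ge> 0" by (simp add: q_def)
  have "(cov_r P)\<^sup>2 < (2 * pi)\<^sup>2" using r r0 by (intro power_strict_mono) auto
  then have rr: "0 < 4 * pi\<^sup>2 - (cov_r P)\<^sup>2" by (simp add: power_mult_distrib)
  have "(4 * pi\<^sup>2 - (cov_r P)\<^sup>2) * W + V * q \<le> 0" using W D by (simp add: algebra_simps)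
  moreover have "0 \<le> (4 * pi\<^sup>2 - (cov_r P)\<^sup>2) * W" using rr W by simp
  moreover have "0 \<le> V * q" using V q by simp
  ultimately have "(4 * pi\<^sup>2 - (cov_r P)\<^sup>2) * W = 0" "V * q = 0" by linarith+
  then have W0: "W = 0" and q0: "q = 0" using rr V by auto
  then have dw: "snd (snd v) = 0" by (simp add: q_def)
  have "D = 0" using D W0 q0 by simp
  moreover have "continuous_on {0..1} (\<lambda>t. (jacobi' P v t)\<^sup>2)" by (intro continuous_intros cov_x_continuous w)
  ultimately have "\<forall>t\<in>{0..1}. (jacobi' P v t)\<^sup>2 = 0"
    using integral_eq_0_iff[of 0 1 "\<lambda>t. (jacobi' P v t)\<^sup>2"] by (simp add: D_def)
  then have j0: "jacobi' P v t = 0" if "t \<in> {0..1}" for t using that by simp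
  have da: "fst v = 0" using j0[of 0] by simp
  have dr: "d_r P v = 0" using dw by (simp add: d_r_def)
  \<comment> \<open>At time \<open>1 / 2\<close> the angle lies strictly between 0 and
    \<open>pi\<close> for every \<open>cov_r P\<close> below \<open>2 * pi\<close>.\<close>
  have "sin (cov_r P * (1 / 2)) > 0" using r r0 by (intro sin_gt_zero) auto
  then have dc: "d_c P v = 0" using j0[of "1 / 2"] r0 by (simp add: jacobi'_def da dr)
  have "d_mean_x P v = 0" by (simp add: d_mean_x_def jacobi_def[abs_def] da dr dc)
  then have "fst (snd v) = 0" using jacobi_energy(3)[OF w ker] dw by simp
  then show ?thesis using da dw by (simp add: prod_eq_iff)
qed

text \<open>At \<open>2 * pi\<close> the Wirtinger terms cancel, but the variance term still forces
  the variation of \<open>w\<close> to vanish. The direction \<open>k\<close> detects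
  \<open>u\<close> and not \<open>w\<close>, so the kernel equations give
  \<open>d_mean_x P v = 0\<close>. What remains is a multiple of the sine, and
  \<open>d_mean_x2\<close> pairs it with \<open>x\<close>, whose sine coefficient is proportional to
  \<open>fst P\<close>.\<close>

lemma d_exp_injective_at_period:
  fixes P v :: "'n::finite path_group"
  assumes a: "fst P \<noteq> 0" and r: "cov_r P = 2 * pi"
    and k: "snd (snd P) \<bullet> k = 0" "fst (snd P) \<bullet> k \<noteq> 0" and ker: "d_exp P v = 0"
  shows "v = 0"
proof -
  have w: "snd (snd P) \<noteq> 0" using r by (auto simp: cov_r_def)
  have V: "mean_x2 P - (mean_x P)\<^sup>2 > 0" using mean_variance_pos[OF w] a by simp
  have "(mean_x2 P - (mean_x P)\<^sup>2) * (snd (snd v) \<bullet> snd (snd v)) \<le> 0"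
    using jacobi_wirtinger(1)[OF w ker] jacobi_energy(1)[OF w ker] by (simp add: r power_mult_distrib)
  then have dw: "snd (snd v) = 0"
    using V by (metis antisym inner_eq_zero_iff inner_ge_zero mult_le_0_iff not_less)
  note e = jacobi_energy(3,4)[OF w ker]
  have "d_mean_x P v * (fst (snd P) \<bullet> k) = 0"
    using arg_cong[OF e(2), of "\<lambda>z. z \<bullet> k"] arg_cong[OF e(1), of "\<lambda>z. z \<bullet> k"] k dw by (simp add: inner_add_left)
  then have K1: "d_mean_x P v = 0" using k by simp
  then have du: "fst (snd v) = 0" using e(1) dw by simp
  have K2: "d_mean_x2 P v = 0" using e(2) w K1 du dw by simp
  have dr: "d_r P v = 0" "d_c P v = 0" using dw du by (auto simp: d_r_def d_c_def)
  have sc: "sin y * sin y = 1 - cos y * cos y" for y :: real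
    using sin_squared_eq[of y] by (simp only: power2_eq_square)
  define c where "c = cov_c P"
  \<comment> \<open>A primitive of \<open>2 * x * \<eta>\<close> for a Jacobi field
    \<open>\<eta>\<close> that is a multiple of the sine. The \<open>c\<close> term has equal values
    at 0 and 1, so only the product \<open>fst v * fst P\<close> survives.\<close>
  define F where "F = (\<lambda>t. 2 * fst v * (fst P / (2 * pi)\<^sup>2 * (t / 2 - sin (2 * pi * t) * cos (2 * pi * t) / (2 * (2 * pi)))
      + c / (2 * pi)^3 * ((1 - cos (2 * pi * t))\<^sup>2 / (2 * (2 * pi)))))"
  have "((\<lambda>t. 2 * cov_x P t * jacobi P v t) has_integral F 1 - F 0) {0..1}"
  proof (rule fundamental_theorem_of_calculus)
    fix t :: real
    have 1: "((\<lambda>t. t / 2 - sin (2 * pi * t) * cos (2 * pi * t) / (2 * (2 * pi))) has_real_derivative sin (2 * pi * t) * sin (2 * pi * t)) (at t within {0..1})"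
      by (auto intro!: derivative_eq_intros simp: field_simps sc)
    have 2: "((\<lambda>t. (1 - cos (2 * pi * t))\<^sup>2 / (2 * (2 * pi))) has_real_derivative (1 - cos (2 * pi * t)) * sin (2 * pi * t)) (at t within {0..1})"
      by (auto intro!: derivative_eq_intros simp: field_simps)
    have "(F has_real_derivative 2 * cov_x P t * jacobi P v t) (at t within {0..1})"
      unfolding F_def
      by (rule DERIV_cong[OF DERIV_cmult[OF DERIV_add[OF DERIV_cmult[OF 1] DERIV_cmult[OF 2]]]])
         (simp add: cov_x_def flow_x_def jacobi_def dr r c_def[symmetric] power2_eq_square power3_eq_cube algebra_simps diff_divide_distrib)
    then show "(F has_vector_derivative 2 * cov_x P t * jacobi P v t) (at t within {0..1})"
      by (simp add: has_real_derivative_iff_has_vector_derivative)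
  qed simp
  then have "d_mean_x2 P v = F 1 - F 0" by (simp add: d_mean_x2_def integral_unique)
  then have "fst v * fst P = 0" using K2 by (auto simp: F_def)
  then show ?thesis using a du dw by (simp add: prod_eq_iff)
qed

text \<open>\<open>sin s\<close> has disappeared from the end point, which is why the geodesics with
  angles \<open>s\<close> and \<open>- s\<close> meet here. The condition on \<open>B\<close> is
  satisfied both by orthogonal \<open>k'\<close> and by an absent transverse part.\<close>

lemma sr_exp_period:
  fixes k k' :: "real^'n::finite"
  assumes "norm k = 1" "B * (k \<bullet> k') = 0"
  shows "sr_exp (A * sin s, (A * cos s) *\<^sub>R k + B *\<^sub>R k', (2 * pi) *\<^sub>R k) =
    (0, B *\<^sub>R k', (A\<^sup>2 / (4 * pi)) *\<^sub>R k - (A * B * cos s / (2 * pi)) *\<^sub>R k')"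
proof -
  define w where "w = (2 * pi) *\<^sub>R k"
  define u where "u = (A * cos s) *\<^sub>R k + B *\<^sub>R k'"
  have nw: "norm w = 2 * pi" and w0: "w \<noteq> 0" using assms(1) by (auto simp: w_def)
  have kk: "k \<bullet> k = 1" using assms(1) by (simp add: norm_eq_1)
  have c: "u \<bullet> w = 2 * pi * (A * cos s)"
    using assms(2) by (simp add: u_def w_def inner_add_left kk inner_commute[of k' k] algebra_simps)
  have sc: "(sin s)\<^sup>2 = 1 - (cos s)\<^sup>2" by (rule sin_squared_eq)
  have "sr_exp (A * sin s, u, w) = sr_geodesic (A * sin s, u, w) (2 * pi / norm w)"
    by (simp add: sr_exp_def nw)
  also have "\<dots> = (0, u - (A * cos s) *\<^sub>R k,
      - ((2 * pi * (2 * pi * (A * cos s)) / (2 * pi) ^ 3) *\<^sub>R u - (pi / (2 * pi) * ((A * sin s / (2 * pi))\<^sup>2 + 3 * (2 * pi * (A * cos s) / (2 * pi)\<^sup>2)\<^sup>2)) *\<^sub>R w))"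
  proof -
    have one: "2 * pi / (2 * pi) = 1" by simp
    have cw: "(2 * pi * (A * cos s) / (2 * pi)\<^sup>2) *\<^sub>R w = (A * cos s) *\<^sub>R k" by (simp add: w_def power2_eq_square)
    show ?thesis
      using geodesic_period_endpoint[OF w0, of "A * sin s" u] by (simp only: nw c cw one scaleR_one)
  qed
  also have "u - (A * cos s) *\<^sub>R k = B *\<^sub>R k'" by (simp add: u_def)
  also have "2 * pi * (2 * pi * (A * cos s)) / (2 * pi) ^ 3 = A * cos s / (2 * pi)"
    by (simp add: power3_eq_cube)
  also have "pi / (2 * pi) * ((A * sin s / (2 * pi))\<^sup>2 + 3 * (2 * pi * (A * cos s) / (2 * pi)\<^sup>2)\<^sup>2) = (A\<^sup>2 / (8 * pi\<^sup>2)) * (1 + 2 * (cos s)\<^sup>2)"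
    by (simp add: power_divide power_mult_distrib sc) (simp add: power2_eq_square power4_eq_xxxx field_simps)
  also have "- ((A * cos s / (2 * pi)) *\<^sub>R u - ((A\<^sup>2 / (8 * pi\<^sup>2)) * (1 + 2 * (cos s)\<^sup>2)) *\<^sub>R w) =
      (A\<^sup>2 / (4 * pi)) *\<^sub>R k - (A * B * cos s / (2 * pi)) *\<^sub>R k'"
  proof -
    have "(A\<^sup>2 / (8 * pi\<^sup>2)) * (1 + 2 * (cos s)\<^sup>2) * (2 * pi) - A * cos s / (2 * pi) * (A * cos s) = A\<^sup>2 / (4 * pi)"
      by (simp add: power2_eq_square field_simps)
    moreover have "- ((A * cos s / (2 * pi)) *\<^sub>R u - ((A\<^sup>2 / (8 * pi\<^sup>2)) * (1 + 2 * (cos s)\<^sup>2)) *\<^sub>R w) =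
       ((A\<^sup>2 / (8 * pi\<^sup>2)) * (1 + 2 * (cos s)\<^sup>2) * (2 * pi) - A * cos s / (2 * pi) * (A * cos s)) *\<^sub>R k - (A * B * cos s / (2 * pi)) *\<^sub>R k'"
      by (simp add: u_def w_def scaleR_add_right scaleR_diff_left mult.commute mult.left_commute)
    ultimately show ?thesis by simp
  qed
  finally show ?thesis by (simp add: u_def w_def)
qed

text \<open>The kernel is spanned by the rotation of the angle $s$, which moves the end point only through
  $\cos s$.\<close>

lemma critical_point_period:
  fixes k k' :: "real^'n::finite"
  assumes k: "norm k = 1" "B * (k \<bullet> k') = 0" and A: "A \<noteq> 0" and s: "B * sin s = 0"
  shows "critical_point sr_exp (A * sin s, (A * cos s) *\<^sub>R k + B *\<^sub>R k', (2 * pi) *\<^sub>R k)"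
proof -
  define \<beta> where "\<beta> = (\<lambda>s. (A * sin s, (A * cos s) *\<^sub>R k + B *\<^sub>R k', (2 * pi) *\<^sub>R k))"
  define d where "d = (A * cos s, - (A * sin s) *\<^sub>R k, 0 :: real^'n)"
  have w: "snd (snd (\<beta> s)) \<noteq> 0" using k by (auto simp: \<beta>_def)
  have "(\<beta> has_vector_derivative d) (at s)"
    unfolding \<beta>_def d_def
    by (intro has_vector_derivative_Pair) (auto intro!: derivative_eq_intros simp: has_real_derivative_iff_has_vector_derivative[symmetric])
  \<comment> \<open>The curve of end points is differentiated both by the chain rule and from its
    closed form; uniqueness of the derivative evaluates \<open>d_exp\<close> on \<open>d\<close>
    without its integral formula.\<close>
  then have 1: "((\<lambda>s. sr_exp (\<beta> s)) has_derivative (\<lambda>h. d_exp (\<beta> s) (h *\<^sub>R d))) (at s)"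
    using has_derivative_compose[where f=\<beta> and g=sr_exp, OF _ sr_exp_has_derivative[OF w]] by (simp add: has_vector_derivative_def)
  have "((\<lambda>s. (0 :: real, B *\<^sub>R k', (A\<^sup>2 / (4 * pi)) *\<^sub>R k - (A * B * cos s / (2 * pi)) *\<^sub>R k')) has_vector_derivative
      (0, 0, (A * (B * sin s) / (2 * pi)) *\<^sub>R k')) (at s)"
    by (intro has_vector_derivative_Pair has_vector_derivative_const) (auto intro!: derivative_eq_intros)
  then have "((\<lambda>s. sr_exp (\<beta> s)) has_derivative (\<lambda>h. h *\<^sub>R (0, 0, (A * (B * sin s) / (2 * pi)) *\<^sub>R k'))) (at s)"
    unfolding \<beta>_def sr_exp_period[OF k] by (simp add: has_vector_derivative_def)
  from has_derivative_unique[OF 1 this] have "d_exp (\<beta> s) (1 *\<^sub>R d) = 1 *\<^sub>R (0, 0, (A * (B * sin s) / (2 * pi)) *\<^sub>R k')" by meson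
  then have "d_exp (\<beta> s) d = 0" using s by (simp add: zero_prod_def)
  moreover have "d \<noteq> 0"
  proof
    assume "d = 0"
    then have "cos s = 0" "sin s = 0" using A k by (auto simp: d_def zero_prod_def)
    then show False using sin_cos_squared_add[of s] by simp
  qed
  ultimately have "critical_point sr_exp (\<beta> s)" unfolding critical_point_sr_exp_iff[OF w] by blast
  then show ?thesis by (simp add: \<beta>_def)
qed

text \<open>Kernel vectors can be normalized, so those over \<open>{T..T + 1}\<close> form a compact
  set, and so do the conjugate times in that interval. Since \<open>T\<close> is not one of them,
  there is a positive distance.\<close>

lemma no_conjugate_after:
  fixes p :: "'n::finite path_group"
  assumes w: "snd (snd p) \<noteq> 0" and T: "T > 0" and inj: "\<And>v. d_exp (T *\<^sub>R p) v = 0 \<Longrightarrow> v = 0"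
  obtains \<delta> where "\<delta> > 0" "\<And>t. T \<le> t \<Longrightarrow> critical_point sr_exp (t *\<^sub>R p) \<Longrightarrow> T + \<delta> \<le> t"
proof -
  define S where "S = {T..T + 1} \<times> sphere (0 :: 'n path_group) 1"
  define K where "K = S \<inter> (\<lambda>(t, v). d_exp (t *\<^sub>R p) v) -` {0}"
  have "continuous_on ({P :: 'n path_group. snd (snd P) \<noteq> 0} \<times> UNIV) (\<lambda>(P, v). d_exp P v)"
    by (rule d_exp_continuous) simp
  then have c: "continuous_on ({P :: 'n path_group. snd (snd P) \<noteq> 0} \<times> UNIV) (\<lambda>z. d_exp (fst z) (snd z))"
    by (simp add: case_prod_beta)
  have "continuous_on S (\<lambda>z. (fst z *\<^sub>R p, snd z))" by (intro continuous_intros)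
  then have "continuous_on S (\<lambda>z. d_exp (fst (fst z *\<^sub>R p, snd z)) (snd (fst z *\<^sub>R p, snd z)))"
    by (rule continuous_on_compose2[OF c]) (use w T in \<open>auto simp: S_def\<close>)
  then have cont: "continuous_on S (\<lambda>(t, v). d_exp (t *\<^sub>R p) v)" by (simp add: case_prod_beta)
  have S: "compact S" unfolding S_def by (intro compact_Times) auto
  have "closed K" unfolding K_def by (rule continuous_closed_preimage[OF cont compact_imp_closed[OF S]]) simp
  then have "compact (S \<inter> K)" by (rule compact_Int_closed[OF S])
  then have "compact K" by (simp add: K_def Int_absorb1 Int_assoc[symmetric])
  then have cK: "compact (fst ` K)" by (intro compact_continuous_image continuous_intros)
  have inK: "t \<in> fst ` K" if t: "T \<le> t" "t \<le> T + 1" and cr: "critical_point sr_exp (t *\<^sub>R p)" for t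
  proof -
    have wt: "snd (snd (t *\<^sub>R p)) \<noteq> 0" using w T t by simp
    obtain v where v: "v \<noteq> 0" "d_exp (t *\<^sub>R p) v = 0" using cr critical_point_sr_exp_iff[OF wt] by blast
    have lin: "linear (d_exp (t *\<^sub>R p))"
      by (rule bounded_linear.linear[OF has_derivative_bounded_linear[OF sr_exp_has_derivative[OF wt]]])
    have "d_exp (t *\<^sub>R p) ((1 / norm v) *\<^sub>R v) = 0" using v linear_scale[OF lin] by simp
    then have "(t, (1 / norm v) *\<^sub>R v) \<in> K" using v t by (simp add: K_def S_def)
    then show ?thesis by force
  qed
  have above: "T < t" if t: "t \<in> fst ` K" for t
  proof -
    obtain z where "t = fst z" "z \<in> K" using t by (rule imageE)
    then have z: "t \<in> {T..T + 1}" "norm (snd z) = 1" "d_exp (t *\<^sub>R p) (snd z) = 0"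
      by (simp_all add: K_def S_def case_prod_beta mem_Times_iff)
    have "t \<noteq> T" using z inj[of "snd z"] by auto
    then show ?thesis using z by auto
  qed
  show ?thesis
  proof (cases "fst ` K = {}")
    case True
    show ?thesis
    proof (rule that[of 1])
      fix t assume "T \<le> t" "critical_point sr_exp (t *\<^sub>R p)"
      then show "T + 1 \<le> t" using inK[of t] True by (cases "t \<le> T + 1") auto
    qed simp
  next
    case False
    obtain m where m: "m \<in> fst ` K" "\<And>t. t \<in> fst ` K \<Longrightarrow> m \<le> t" using compact_attains_inf[OF cK False] by blast
    show ?thesis
    \<comment> \<open>\<open>m\<close> is the first conjugate time within the window of length 1;
      the cap at 1 accounts for conjugate times beyond it.\<close>
    proof (rule that[of "min 1 (m - T)"])
      show "0 < min 1 (m - T)" using above[OF m(1)] by simp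
      fix t assume "T \<le> t" "critical_point sr_exp (t *\<^sub>R p)"
      then show "T + min 1 (m - T) \<le> t" using inK[of t] m(2)[of t] by (cases "t \<le> T + 1") auto
    qed
  qed
qed

section \<open>From covectors to the parameters of the theorem\<close>

lemma period_times_covector:
  fixes k k' :: "real^'n::finite"
  assumes "\<rho> > 0"
  shows "(2 * pi / \<rho> * sqrt (1 + \<sigma>\<^sup>2)) *\<^sub>R covector \<alpha> \<rho> \<sigma> k k' =
    ((2 * pi / \<rho>) * sin \<alpha>, ((2 * pi / \<rho>) * cos \<alpha>) *\<^sub>R k + (2 * pi / \<rho> * \<sigma>) *\<^sub>R k', (2 * pi) *\<^sub>R k)"
proof -
  have "sqrt (1 + \<sigma>\<^sup>2) > 0" by (simp add: add_pos_nonneg)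
  then show ?thesis
    using assms by (simp add: covector_def scaleR_add_right mult.assoc)
qed

text \<open>\<open>\<sigma> * (k \<bullet> k') = 0\<close> says that \<open>\<sigma>\<close> is zero
  or the vectors are orthogonal, so both cases run together. The geodesic is not a line because sine
  and cosine have no common zero.\<close>

lemma covector_nondegenerate:
  fixes k k' :: "real^'n::finite"
  assumes "\<rho> > 0" "norm k = 1" "\<sigma> * (k \<bullet> k') = 0"
  shows "snd (snd (covector \<alpha> \<rho> \<sigma> k k')) \<noteq> 0"
    and "2 * pi / cov_r (covector \<alpha> \<rho> \<sigma> k k') = 2 * pi / \<rho> * sqrt (1 + \<sigma>\<^sup>2)"
    and "fst (covector \<alpha> \<rho> \<sigma> k k') \<noteq> 0 \<or> cov_c (covector \<alpha> \<rho> \<sigma> k k') \<noteq> 0"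
proof -
  define s where "s = sqrt (1 + \<sigma>\<^sup>2)"
  have s: "s > 0" by (simp add: s_def add_pos_nonneg)
  have cov: "covector \<alpha> \<rho> \<sigma> k k' = (sin \<alpha> / s, (1 / s) *\<^sub>R (cos \<alpha> *\<^sub>R k + \<sigma> *\<^sub>R k'), (\<rho> / s) *\<^sub>R k)"
    by (simp add: covector_def s_def)
  have kk: "k \<bullet> k = 1" using assms(2) by (simp add: norm_eq_1)
  show "snd (snd (covector \<alpha> \<rho> \<sigma> k k')) \<noteq> 0" using s assms(1,2) by (auto simp: cov)
  show "2 * pi / cov_r (covector \<alpha> \<rho> \<sigma> k k') = 2 * pi / \<rho> * sqrt (1 + \<sigma>\<^sup>2)"
    using s assms(1,2) by (simp add: cov cov_r_def s_def[symmetric])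
  have c: "cov_c (covector \<alpha> \<rho> \<sigma> k k') = \<rho> * cos \<alpha> / s\<^sup>2"
    using assms(3) by (simp add: cov cov_c_def inner_add_left kk inner_commute[of k' k] power2_eq_square)
  show "fst (covector \<alpha> \<rho> \<sigma> k k') \<noteq> 0 \<or> cov_c (covector \<alpha> \<rho> \<sigma> k k') \<noteq> 0"
  proof (rule ccontr)
    assume "\<not> ?thesis"
    then have "sin \<alpha> = 0" "cos \<alpha> = 0" unfolding c using s assms(1) by (auto simp: cov)
    then show False using sin_cos_squared_add[of \<alpha>] by simp
  qed
qed

lemma cut_time_covector:
  fixes k k' :: "real^'n::finite"
  assumes "\<rho> > 0" "\<sigma> \<ge> 0" "norm k = 1" "\<sigma> > 0 \<Longrightarrow> norm k' = 1 \<and> k \<bullet> k' = 0"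
  shows "cut_time (sr_geodesic (covector \<alpha> \<rho> \<sigma> k k')) = ereal (2 * pi / \<rho> * sqrt (1 + \<sigma>\<^sup>2))"
proof -
  obtain a u w where p: "covector \<alpha> \<rho> \<sigma> k k' = (a, u, w)" by (rule prod_cases3)
  have "\<sigma> * (k \<bullet> k') = 0" using assms by (cases "\<sigma> = 0") auto
  note nd = covector_nondegenerate[OF assms(1,3) this, of \<alpha>, unfolded p cov_r_def cov_c_def fst_conv snd_conv]
  have "Ham 0 (a, u, w) = 1 / 2" using covector_arc_length[of k \<sigma> k' \<alpha> \<rho>] assms by (simp add: p)
  then have "a\<^sup>2 + u \<bullet> u = 1" using Ham_eq[of 0 0 0 a u w] by (simp add: zero_prod_def)
  from cut_time_geodesic[OF nd(1) this nd(3)] show ?thesis by (simp only: p nd(2))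
qed

text \<open>Scaling a covector by \<open>t\<close> scales \<open>cov_r\<close> by \<open>t\<close>,
  so the times before the period are those with
  \<open>cov_r (t *\<^sub>R p) < 2 * pi\<close>.\<close>

lemma critical_point_imp_period_le:
  fixes p :: "'n::finite path_group"
  assumes w: "snd (snd p) \<noteq> 0" and nz: "fst p \<noteq> 0 \<or> cov_c p \<noteq> 0"
    and t: "0 < t" and crit: "critical_point sr_exp (t *\<^sub>R p)"
  shows "2 * pi / cov_r p \<le> t"
proof (rule ccontr)
  assume less: "\<not> 2 * pi / cov_r p \<le> t"
  have wt: "snd (snd (t *\<^sub>R p)) \<noteq> 0" using t w by simp
  have r: "cov_r (t *\<^sub>R p) = t * cov_r p" "cov_r p > 0" using t w by (simp_all add: cov_r_def)
  have "cov_r (t *\<^sub>R p) < 2 * pi" unfolding r(1) using less r(2) by (simp add: field_simps)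
  moreover have "fst (t *\<^sub>R p) \<noteq> 0 \<or> cov_c (t *\<^sub>R p) \<noteq> 0" using nz t by (simp add: cov_c_def)
  ultimately have "d_exp (t *\<^sub>R p) v = 0 \<Longrightarrow> v = 0" for v
    using d_exp_injective_before_period[OF wt] by blast
  then show False using crit critical_point_sr_exp_iff[OF wt] by blast
qed

lemma first_conjugate_time_eqI:
  assumes "0 < T" "critical_point sr_exp (T *\<^sub>R p)"
    and "\<And>t. 0 < t \<Longrightarrow> critical_point sr_exp (t *\<^sub>R p) \<Longrightarrow> T \<le> t"
  shows "first_conjugate_time p = ereal T"
  unfolding first_conjugate_time_def
proof (rule antisym)
  show "Inf {ereal t |t. 0 < t \<and> critical_point sr_exp (t *\<^sub>R p)} \<le> ereal T"
    using assms(1,2) by (intro Inf_lower) auto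
  show "ereal T \<le> Inf {ereal t |t. 0 < t \<and> critical_point sr_exp (t *\<^sub>R p)}"
    using assms(3) by (intro Inf_greatest) auto
qed

lemma first_conjugate_time_gtI:
  assumes "0 < \<delta>" and "\<And>t. 0 < t \<Longrightarrow> critical_point sr_exp (t *\<^sub>R p) \<Longrightarrow> T + \<delta> \<le> t"
  shows "ereal T < first_conjugate_time p"
proof -
  have "ereal T < ereal (T + \<delta>)" using assms(1) by simp
  also have "\<dots> \<le> first_conjugate_time p"
    unfolding first_conjugate_time_def using assms(2) by (intro Inf_greatest) auto
  finally show ?thesis .
qed

text \<open>The condition \<open>\<sigma> * sin \<alpha> = 0\<close> unites the case
  \<open>\<sigma> = 0\<close> with the zeros of the sine. If it fails, \<open>k'\<close> is the
  direction orthogonal to \<open>w\<close> but not to \<open>u\<close> that injectivity at the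
  period requires.\<close>

lemma first_conjugate_time_covector:
  fixes k k' :: "real^'n::finite"
  assumes \<rho>: "\<rho> > 0" and \<sigma>: "\<sigma> \<ge> 0" and k: "norm k = 1" and k': "\<sigma> > 0 \<Longrightarrow> norm k' = 1 \<and> k \<bullet> k' = 0"
  shows "first_conjugate_time (covector \<alpha> \<rho> \<sigma> k k') = ereal (2 * pi / \<rho> * sqrt (1 + \<sigma>\<^sup>2)) \<longleftrightarrow> \<sigma> * sin \<alpha> = 0"
proof -
  define p where "p = covector \<alpha> \<rho> \<sigma> k k'"
  define T where "T = 2 * pi / \<rho> * sqrt (1 + \<sigma>\<^sup>2)"
  have "sqrt (1 + \<sigma>\<^sup>2) > 0" by (simp add: add_pos_nonneg)
  then have T: "T > 0" using \<rho> by (simp add: T_def)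
  have sk: "\<sigma> * (k \<bullet> k') = 0" using k' \<sigma> by (cases "\<sigma> = 0") auto
  note nd = covector_nondegenerate[OF \<rho> k sk, of \<alpha>, folded p_def T_def]
  have before: "T \<le> t" if "0 < t" "critical_point sr_exp (t *\<^sub>R p)" for t
    using critical_point_imp_period_le[OF nd(1,3) that] by (simp only: nd(2))
  have Tp: "T *\<^sub>R p = ((2 * pi / \<rho>) * sin \<alpha>, ((2 * pi / \<rho>) * cos \<alpha>) *\<^sub>R k + (2 * pi / \<rho> * \<sigma>) *\<^sub>R k', (2 * pi) *\<^sub>R k)"
    unfolding p_def T_def by (rule period_times_covector[OF \<rho>])
  have "first_conjugate_time p = ereal T" if "\<sigma> * sin \<alpha> = 0"
  proof (rule first_conjugate_time_eqI[OF T _ before])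
    show "critical_point sr_exp (T *\<^sub>R p)"
      unfolding Tp using that sk \<rho> k by (intro critical_point_period) auto
  qed
  moreover have "first_conjugate_time p \<noteq> ereal T" if "\<sigma> * sin \<alpha> \<noteq> 0"
  proof -
    have sin: "sin \<alpha> \<noteq> 0" and k': "norm k' = 1" "k \<bullet> k' = 0" and \<sigma>: "\<sigma> > 0" using that k' \<sigma> by auto
    have "d_exp (T *\<^sub>R p) v = 0 \<Longrightarrow> v = 0" for v
    proof (rule d_exp_injective_at_period)
      show "fst (T *\<^sub>R p) \<noteq> 0" unfolding Tp using sin \<rho> by simp
      show "cov_r (T *\<^sub>R p) = 2 * pi" unfolding Tp using k by (simp add: cov_r_def)
      show "snd (snd (T *\<^sub>R p)) \<bullet> k' = 0" unfolding Tp using k' by simp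
      show "fst (snd (T *\<^sub>R p)) \<bullet> k' \<noteq> 0" unfolding Tp using k' \<rho> \<sigma> by (simp add: inner_add_left dot_square_norm)
    qed
    then obtain \<delta> where \<delta>: "\<delta> > 0" "\<And>t. T \<le> t \<Longrightarrow> critical_point sr_exp (t *\<^sub>R p) \<Longrightarrow> T + \<delta> \<le> t"
      using no_conjugate_after[OF nd(1) T] by blast
    have "ereal T < first_conjugate_time p"
      using first_conjugate_time_gtI[OF \<delta>(1)] \<delta>(2) before by blast
    then show ?thesis by simp
  qed
  ultimately show ?thesis by (auto simp: p_def T_def)
qed

text \<open>Justifies reading the critical points of \<open>sr_exp\<close> along \<open>t *\<^sub>R p\<close> as conjugate points of the
  geodesic of \<open>p\<close>.\<close>

lemma sr_exp_scaleR:
  fixes p :: "'n::finite path_group"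
  assumes "snd (snd p) \<noteq> 0" and t: "0 < t"
  shows "sr_exp (t *\<^sub>R p) = sr_geodesic p t"
proof (cases p)
  case (fields a u w)
  then have w: "w \<noteq> 0" "t *\<^sub>R w \<noteq> 0" and r: "norm w \<noteq> 0" using assms by auto
  have n: "norm (t *\<^sub>R w) = t * norm w" and c: "(t *\<^sub>R u) \<bullet> (t *\<^sub>R w) = t * (t * (u \<bullet> w))" using t by simp_all
  have flow: "flow_x (t * a) (t * (t * c)) (t * r) 1 = flow_x a c r t" "flow_I1 (t * a) (t * (t * c)) (t * r) 1 = flow_I1 a c r t / t"
    "flow_I2 (t * a) (t * (t * c)) (t * r) 1 = flow_I2 a c r t / t" if "r \<noteq> 0" for r c
    using t that by (simp_all add: flow_x_def flow_I1_def flow_I2_def power_mult_distrib field_simps power2_eq_square power3_eq_cube)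
  show ?thesis
    using t unfolding fields sr_exp_def scaleR_Pair sr_geodesic_eq[OF w(1)] sr_geodesic_eq[OF w(2)]
    by (simp add: n c geo_l_def geo_y_def flow[OF r] scaleR_diff_right)
qed

theorem proposition4p2:
  fixes \<alpha> \<rho> \<sigma> :: real and k k' :: "real^'n::finite"
  assumes "0 \<le> \<alpha>" "\<alpha> < 2 * pi" and "\<rho> > 0" and "\<sigma> \<ge> 0"
    and "norm k = 1"
    and "\<sigma> > 0 \<Longrightarrow> norm k' = 1 \<and> k \<bullet> k' = 0"
  defines "p \<equiv> covector \<alpha> \<rho> \<sigma> k k'"
  shows "cut_time (sr_geodesic p) = ereal (2 * pi / \<rho> * sqrt (1 + \<sigma>\<^sup>2)) \<and>
    (\<sigma> = 0 \<longrightarrow> cut_time (sr_geodesic p) = first_conjugate_time p) \<and>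
    (\<sigma> > 0 \<longrightarrow>
       (cut_time (sr_geodesic p) = first_conjugate_time p \<longleftrightarrow> \<alpha> = 0 \<or> \<alpha> = pi))"
proof -
  have "sin \<alpha> = 0 \<longleftrightarrow> \<alpha> = 0 \<or> \<alpha> = pi"
    using assms(1,2) sin_gt_zero[of \<alpha>] sin_lt_zero[of \<alpha>]
    by (cases \<alpha> pi rule: linorder_cases) (auto simp: less_le)
  moreover have cut: "cut_time (sr_geodesic p) = ereal (2 * pi / \<rho> * sqrt (1 + \<sigma>\<^sup>2))"
    unfolding p_def by (rule cut_time_covector[OF assms(3-6)])
  ultimately have "cut_time (sr_geodesic p) = first_conjugate_time p \<longleftrightarrow> \<sigma> = 0 \<or> \<alpha> = 0 \<or> \<alpha> = pi"
    unfolding cut unfolding p_def using first_conjugate_time_covector[OF assms(3-6), of \<alpha>]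
    by (metis mult_eq_0_iff)
  with cut show ?thesis by blast
qed

end
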